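(* Let $N\ge 2$ identical nonlinear circuits, each consisting of the parallel connection of a passive LTI impedance $z_{\mathrm{osc}}(s)$ and a voltage-dependent current source $i_{\mathrm g}=-g(v)$ with $\sigma:=\sup_{v\in\mathbb R}\left|\frac{\mathrm d}{\mathrm dv}g(v)\right|<\infty$, be coupled through a passive, connected LTI electrical network whose Kron-reduced admittance matrix is of the form $$Y(s)=y_{\mathrm{shunt}}(s)\,I+y_{\mathrm{series}}(s)\,\Gamma,\qquad \Gamma=NI-\mathbf 1\mathbf 1^{\mathrm T}.$$ Let $z_{\mathrm{shunt}}:=y_{\mathrm{shunt}}^{-1}$ and $z_{\mathrm{eq}}:=\dfrac{z_{\mathrm{shunt}}\,z_{\mathrm{osc}}}{z_{\mathrm{shunt}}+z_{\mathrm{osc}}}$. If $$\left\Vert \mathcal F\big(z_{\mathrm{eq}}(\mathrm j\omega),\,y_{\mathrm{series}}(\mathrm j\omega)N\big)\right\Vert_\infty\,\sigma<1,$$ then the terminal voltages synchronize globally asymptotically, i.e. (for all initial conditions) $$\lim_{t\to\infty}\big(v_j(t)-v_k(t)\big)=0\qquad\forall\, j,k\in\{1,\dots,N\}.$$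
   Context: Coupled system. Circuit $j$ has terminal voltage $v_j$, injects current $i_j$ into the network, and has source current $i_{\mathrm gj}=-g(v_j)$; $g:\mathbb R\to\mathbb R$ may be piecewise linear (then the supremum defining $\sigma$ is over its slopes). In the Laplace domain the linear part obeys $v_j=z_{\mathrm{osc}}\,(i_{\mathrm gj}-i_j)$, where $z_{\mathrm{osc}}(s)$ is the impedance of an interconnection of passive LTI circuit elements, and the network imposes $i=Yv$ with $i=[i_1,\dots,i_N]^{\mathrm T}$, $v=[v_1,\dots,v_N]^{\mathrm T}$, where $Y$ is the Kron-reduced admittance matrix. Initial conditions refer to the states of the energy-storage elements. Kron-reduced admittance matrix: if the full network has admittance matrix $Y_{\mathcal A}$, partitioned into blocks for the boundary nodes $\mathcal N=\{1,\dots,N\}$ (where the circuits are connected) and the interior nodes $\mathcal I$ (zero current injection), then $Y=Y_{\mathcal{NN}}-Y_{\mathcal{NI}}Y_{\mathcal{II}}^{-1}Y_{\mathcal{NI}}^{\mathrm T}$ ($Y_{\mathcal{II}}$ is assumed nonsingular). $Y_{\mathcal A}$ has diagonal entries $y_m+\sum_k y_{mk}$ (shunt admittance to ground plus branch admittances at $m$) and off-diagonal entries $-y_{mn}$ for branches, $0$ otherwise. Linear fractional transformation: $\mathcal F(A,B):=(I+AB)^{-1}A$; for scalars $\mathcal F(a,b)=a/(1+ab)$. For a scalar transfer function $h$ all of whose poles have strictly negative real part, $\Vert h\Vert_\infty:=\sup_{\omega\in\mathbb R}|h(\mathrm j\omega)|$ (the condition on the norm includes that it is defined in this sense). *)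

theory Defs
  imports
    Complex_Main
    "HOL-Computational_Algebra.Computational_Algebra"
    "HOL-Computational_Algebra.Field_as_Ring"
    "Jordan_Normal_Form.Gauss_Jordan_Elimination"
begin

text \<open>
  Transfer functions are rational functions of the Laplace variable, i.e. elements of the field
  \<^typ>\<open>complex poly fract\<close>; \<^const>\<open>quot_of_fract\<close> gives numerator and denominator in lowest terms,
  so that poles and values are those left after all cancellations.
\<close>

type_synonym transfer_function = "complex poly fract"

definition tf_poles :: "transfer_function \<Rightarrow> complex set" where
  "tf_poles h = {s. poly (snd (quot_of_fract h)) s = 0}"

definition tf_eval :: "transfer_function \<Rightarrow> complex \<Rightarrow> complex" where
  "tf_eval h s = poly (fst (quot_of_fract h)) s / poly (snd (quot_of_fract h)) s"

definition hinf_norm :: "transfer_function \<Rightarrow> real" where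
  "hinf_norm h = (SUP \<omega>::real. cmod (tf_eval h (\<i> * of_real \<omega>)))"

text \<open>
  \<^const>\<open>hinf_norm\<close> is meaningful only under the following condition. The boundedness conjunct
  excludes improper transfer functions, whose supremum is infinite.
\<close>

definition hinf_defined :: "transfer_function \<Rightarrow> bool" where
  "hinf_defined h \<longleftrightarrow>
     (\<forall>s\<in>tf_poles h. Re s < 0) \<and>
     bdd_above (range (\<lambda>\<omega>::real. cmod (tf_eval h (\<i> * of_real \<omega>))))"

definition lft :: "'a::field \<Rightarrow> 'a \<Rightarrow> 'a" where
  "lft a b = a / (1 + a * b)"

text \<open>
  Networks of two-terminal passive elements. The non-ground nodes are \<open>Vertex m\<close> with
  \<open>m < n_nodes net\<close>; the first \<open>n_boundary net\<close> of them are the boundary nodes, at which current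
  may be injected, and the remaining ones are interior. Parallel branches are allowed. A branch
  or shunt consisting of several elements is represented by its elements and interior nodes.
\<close>

datatype rlc_element = Resistor real | Inductor real | Capacitor real

datatype rlc_node = Ground | Vertex nat

record rlc_network =
  n_boundary :: nat
  n_interior :: nat
  branches :: "(rlc_node \<times> rlc_node \<times> rlc_element) list"

definition n_nodes :: "rlc_network \<Rightarrow> nat" where
  "n_nodes net = n_boundary net + n_interior net"

fun passive_element :: "rlc_element \<Rightarrow> bool" where
  "passive_element (Resistor R) \<longleftrightarrow> R > 0"
| "passive_element (Inductor L) \<longleftrightarrow> L > 0"
| "passive_element (Capacitor C) \<longleftrightarrow> C > 0"

definition node_set :: "rlc_network \<Rightarrow> rlc_node set" where
  "node_set net = insert Ground (Vertex ` {..<n_nodes net})"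

definition passive_network :: "rlc_network \<Rightarrow> bool" where
  "passive_network net \<longleftrightarrow>
     (\<forall>(p, q, x)\<in>set (branches net).
        p \<in> node_set net \<and> q \<in> node_set net \<and> p \<noteq> q \<and> passive_element x)"

text \<open>Connectedness does not count connections through the ground.\<close>

definition connected_network :: "rlc_network \<Rightarrow> bool" where
  "connected_network net \<longleftrightarrow>
     (\<forall>a<n_nodes net. \<forall>b<n_nodes net.
        (a, b) \<in> {(m, k). \<exists>x. (Vertex m, Vertex k, x) \<in> set (branches net) \<or>
                              (Vertex k, Vertex m, x) \<in> set (branches net)}\<^sup>*)"

fun element_admittance :: "rlc_element \<Rightarrow> transfer_function" where
  "element_admittance (Resistor R) = Fract 1 [:of_real R:]"
| "element_admittance (Inductor L) = Fract 1 [:0, of_real L:]"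
| "element_admittance (Capacitor C) = Fract [:0, of_real C:] 1"

definition branch_admittance :: "rlc_network \<Rightarrow> rlc_node \<Rightarrow> rlc_node \<Rightarrow> transfer_function" where
  "branch_admittance net a b =
     (\<Sum>(p, q, x)\<leftarrow>branches net. if {p, q} = {a, b} then element_admittance x else 0)"

definition admittance_matrix :: "rlc_network \<Rightarrow> transfer_function mat" where
  "admittance_matrix net =
     mat (n_nodes net) (n_nodes net) (\<lambda>(m, k).
       if m = k
       then branch_admittance net (Vertex m) Ground +
            (\<Sum>l\<in>{..<n_nodes net} - {m}. branch_admittance net (Vertex m) (Vertex l))
       else - branch_admittance net (Vertex m) (Vertex k))"

definition interior_admittance :: "rlc_network \<Rightarrow> transfer_function mat" where
  "interior_admittance net =
     (case split_block (admittance_matrix net) (n_boundary net) (n_boundary net) of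
        (Y_NN, Y_NI, Y_IN, Y_II) \<Rightarrow> Y_II)"

text \<open>Meaningful only if \<^term>\<open>interior_admittance net\<close> is invertible.\<close>

definition kron_reduction :: "rlc_network \<Rightarrow> transfer_function mat" where
  "kron_reduction net =
     (case split_block (admittance_matrix net) (n_boundary net) (n_boundary net) of
        (Y_NN, Y_NI, Y_IN, Y_II) \<Rightarrow>
          Y_NN - Y_NI * the (mat_inverse Y_II) * transpose_mat Y_NI)"

text \<open>
  A network with a single boundary node is a one-port between that node and the ground.
  Its impedance is the reciprocal of its one-by-one Kron-reduced admittance.
\<close>

definition one_port_impedance :: "rlc_network \<Rightarrow> transfer_function \<Rightarrow> bool" where
  "one_port_impedance net z \<longleftrightarrow>
     n_boundary net = 1 \<and> invertible_mat (interior_admittance net) \<and>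
     kron_reduction net $$ (0, 0) \<noteq> 0 \<and> z = inverse (kron_reduction net $$ (0, 0))"

text \<open>
  If there is no shunt, \<open>z_shunt\<close> is an open circuit and the parallel connection is \<open>z_osc\<close> alone.
\<close>

definition equivalent_impedance ::
  "transfer_function \<Rightarrow> transfer_function \<Rightarrow> transfer_function" where
  "equivalent_impedance y_shunt z_osc =
     (if y_shunt = 0 then z_osc
      else (let z_shunt = inverse y_shunt in (z_shunt * z_osc) / (z_shunt + z_osc)))"

definition complete_laplacian :: "nat \<Rightarrow> transfer_function mat" where
  "complete_laplacian N = of_nat N \<cdot>\<^sub>m 1\<^sub>m N - mat N N (\<lambda>_. 1)"

fun element_law ::
  "rlc_element \<Rightarrow> (real \<Rightarrow> real) \<Rightarrow> (real \<Rightarrow> real) \<Rightarrow> real \<Rightarrow> bool" where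
  "element_law (Resistor R) v i t \<longleftrightarrow> v t = R * i t"
| "element_law (Inductor L) v i t \<longleftrightarrow> (i has_real_derivative v t / L) (at t)"
| "element_law (Capacitor C) v i t \<longleftrightarrow> (v has_real_derivative i t / C) (at t)"

fun potential :: "(nat \<Rightarrow> real \<Rightarrow> real) \<Rightarrow> rlc_node \<Rightarrow> real \<Rightarrow> real" where
  "potential e Ground t = 0"
| "potential e (Vertex m) t = e m t"

text \<open>\<open>+1\<close> if the reference direction of the branch leaves the node, \<open>-1\<close> if it enters it.\<close>

definition incidence :: "rlc_node \<times> rlc_node \<times> rlc_element \<Rightarrow> rlc_node \<Rightarrow> real" where
  "incidence br a = (case br of (p, q, x) \<Rightarrow> of_bool (p = a) - of_bool (q = a))"

text \<open>
  \<open>v m\<close> and \<open>i m\<close> are the potential of and the current injected into boundary node \<open>m\<close>. They form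
  a trajectory if there are node potentials \<open>e\<close> and branch currents \<open>c\<close> satisfying the element laws
  and Kirchhoff's laws at all positive times. The capacitor voltages and inductor currents are not
  prescribed anywhere, so that all initial conditions are covered. Nothing is required at \<open>t = 0\<close>:
  initial data violating Kirchhoff's laws (as for two parallel capacitors) are redistributed
  at that instant.
\<close>

definition network_trajectory ::
  "rlc_network \<Rightarrow> (nat \<Rightarrow> real \<Rightarrow> real) \<Rightarrow> (nat \<Rightarrow> real \<Rightarrow> real) \<Rightarrow> bool" where
  "network_trajectory net v i \<longleftrightarrow>
     (\<exists>e c.
        (\<forall>m<n_nodes net. continuous_on {0<..} (e m)) \<and>
        (\<forall>k<length (branches net). continuous_on {0<..} (c k)) \<and>
        (\<forall>m<n_boundary net. \<forall>t>0. e m t = v m t) \<and>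
        (\<forall>k<length (branches net). \<forall>t>0.
           case branches net ! k of (p, q, x) \<Rightarrow>
             element_law x (\<lambda>t. potential e p t - potential e q t) (c k) t) \<and>
        (\<forall>m<n_nodes net. \<forall>t>0.
           (\<Sum>k<length (branches net). incidence (branches net ! k) (Vertex m) * c k t) =
             (if m < n_boundary net then i m t else 0)))"

text \<open>
  The terminal voltages \<open>v j\<close> (\<open>j < N\<close>) of \<open>N\<close> identical circuits coupled through \<open>net\<close>: circuit \<open>j\<close>
  injects \<open>i j\<close> into \<open>net\<close>, and the remainder of its source current \<open>- g (v j)\<close> flows into
  its own copy of the one-port \<open>osc\<close>.
\<close>

definition coupled_trajectory ::
  "nat \<Rightarrow> rlc_network \<Rightarrow> (real \<Rightarrow> real) \<Rightarrow> rlc_network \<Rightarrow> (nat \<Rightarrow> real \<Rightarrow> real) \<Rightarrow> bool" where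
  "coupled_trajectory N osc g net v \<longleftrightarrow>
     (\<exists>i. network_trajectory net v i \<and>
          (\<forall>j<N. network_trajectory osc (\<lambda>_. v j) (\<lambda>_ t. - g (v j t) - i j t)))"

text \<open>
  The source characteristic may have breakpoints, finitely many in every bounded interval; its
  slopes are then taken outside the breakpoints.
\<close>

definition piecewise_differentiable :: "(real \<Rightarrow> real) \<Rightarrow> bool" where
  "piecewise_differentiable g \<longleftrightarrow>
     continuous_on UNIV g \<and> (\<forall>a b. finite {v\<in>{a..b}. \<not> g differentiable (at v)})"

definition abs_slopes :: "(real \<Rightarrow> real) \<Rightarrow> real set" where
  "abs_slopes g = {\<bar>D\<bar> | D v. (g has_real_derivative D) (at v)}"

end

theory Submission
  imports Defs "HOL-Analysis.Henstock_Kurzweil_Integration"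
begin

text \<open>
  By linearity and reciprocity, pair the trajectory (through Tellegen's theorem) with the response
  of the whole passive network to opposite unit currents injected at the terminals \<open>j\<close> and \<open>k\<close>.
  That response has voltages \<open>\<plusminus>h\<close> with \<open>h = F(z_eq, y_series N) = q/d\<close>, and passivity
  keeps the poles of its internal voltages and currents in the open left half plane, so that
  clearing denominators leaves a Hurwitz polynomial \<open>d\<close>. The pairing reads \<open>d(D) (v_j - v_k) = - q(D) (g(v_j) - g(v_k))\<close> in
  integrated form, hence \<open>v_j - v_k\<close> is the output of the filter \<open>q/d\<close> up to a decaying transient.
  A spectral factorization \<open>\<gamma>\<^sup>2 d d~ - q q~ = r r~\<close> gives the energy gain bound \<open>\<gamma>\<close> of the filter, and
  \<open>\<gamma> \<sigma> < 1\<close> makes \<open>v_j - v_k\<close> square integrable and then convergent to zero.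
\<close>

text \<open>Trajectories are merely continuous, so differential equations appear only after K
  integrations, as polynomials in the integration operator; the initial data then form a polynomial
  in time of degree below K. The function h arises because e_j - e_k is an eigenvector of \<Gamma>
  with eigenvalue N: with y_osc = 1 / z_osc, F(z_eq, N y_series) is 1 / (y_osc + y_shunt + N
  y_series), the voltage at terminal j per unit of differential current. A condition on h alone does
  not control factors that cancel between q and d, such as undamped modes inside the network; the
  power balance is what shows that they can be divided out of all internal quantities. Square
  integrability of v_j - v_k does not yield a limit, since q/d may have direct feedthrough; but the
  feedthrough gain is at most \<gamma>, so the loop can also be closed pointwise. Here \<gamma> lies
  strictly above the norm, because the spectral factorization has to avoid zeros on the imaginary
  axis.\<close>

unbundle no vec_syntax
hide_const (open) Finite_Cartesian_Product.vec Finite_Cartesian_Product.mat Module.smult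

section \<open>Signals and the integration operator\<close>

text \<open>Signals live on \<open>t \<ge> 0\<close>. They are extended by a constant to the left so that identities
  between them are equalities of functions.\<close>

definition signals :: "(real \<Rightarrow> complex) set" where
  "signals = {f. continuous_on UNIV f \<and> (\<forall>t\<le>0. f t = f 0)}"

definition primitive :: "(real \<Rightarrow> complex) \<Rightarrow> real \<Rightarrow> complex" where
  "primitive f = (\<lambda>t. integral {0..t} f)"

lemma signals_neg: "f \<in> signals \<Longrightarrow> t \<le> 0 \<Longrightarrow> f t = f 0"
  unfolding signals_def by blast

lemma signals_cont_UNIV: "f \<in> signals \<Longrightarrow> continuous_on UNIV f"
  by (simp add: signals_def)

lemma signalsI: "continuous_on UNIV f \<Longrightarrow> (\<And>t. t < 0 \<Longrightarrow> f t = f 0) \<Longrightarrow> f \<in> signals"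
proof (unfold signals_def, intro CollectI conjI allI impI)
  fix t :: real assume "\<And>t. t < 0 \<Longrightarrow> f t = f 0" "t \<le> 0"
  then show "f t = f 0" by (cases "t = 0") auto
qed

lemma signals_cont: "f \<in> signals \<Longrightarrow> continuous_on A f"
  using continuous_on_subset signals_cont_UNIV by blast

text \<open>Continuity settles \<open>t = 0\<close>, and constancy to the left settles the rest.
  Derivatives are available at positive times only.\<close>

lemma signals_eqI:
  assumes "f \<in> signals" "g \<in> signals" "\<And>t. t > 0 \<Longrightarrow> f t = g t"
  shows "f = g"
proof -
  have 0: "f 0 = g 0"
  proof -
    have lim: "(h \<longlongrightarrow> h 0) (at_right 0)" if "h \<in> signals" for h
    proof (rule tendsto_within_subset)
      show "(h \<longlongrightarrow> h 0) (at 0)"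
        using signals_cont_UNIV[OF that] by (simp add: continuous_on_def)
    qed simp
    have "eventually (\<lambda>t. g t = f t) (at_right 0)"
      unfolding eventually_at_filter by (simp add: assms(3))
    then have "(f \<longlongrightarrow> g 0) (at_right 0)"
      by (rule Lim_transform_eventually[OF lim[OF assms(2)]])
    then show ?thesis
      by (rule tendsto_unique[OF trivial_limit_at_right_real lim[OF assms(1)]])
  qed
  show ?thesis
  proof
    fix t show "f t = g t"
      using 0 assms(3) signals_neg[OF assms(1), of t] signals_neg[OF assms(2), of t]
      by (cases "t > 0") auto
  qed
qed

lemma signals_const [simp]: "(\<lambda>t. c) \<in> signals"
  by (simp add: signals_def)

lemma signals_add: "f \<in> signals \<Longrightarrow> g \<in> signals \<Longrightarrow> (\<lambda>t. f t + g t) \<in> signals"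
  by (rule signalsI, intro continuous_intros signals_cont; (assumption)?)
    (metis less_imp_le signals_neg)

lemma signals_diff: "f \<in> signals \<Longrightarrow> g \<in> signals \<Longrightarrow> (\<lambda>t. f t - g t) \<in> signals"
  by (rule signalsI, intro continuous_intros signals_cont; (assumption)?)
    (metis less_imp_le signals_neg)

lemma signals_scale: "f \<in> signals \<Longrightarrow> (\<lambda>t. c * f t) \<in> signals"
  by (rule signalsI, intro continuous_intros signals_cont; (assumption)?)
    (metis less_imp_le signals_neg)

lemma signals_sum: "(\<And>i. i \<in> A \<Longrightarrow> f i \<in> signals) \<Longrightarrow> (\<lambda>t. \<Sum>i\<in>A. f i t) \<in> signals"
  by (induction A rule: infinite_finite_induct) (auto intro!: signals_add)

lemma primitive_neg: "t \<le> 0 \<Longrightarrow> primitive f t = 0"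
  unfolding primitive_def by (cases "t = 0") auto

lemma primitive_vector_derivative:
  assumes "continuous_on UNIV f" "t > 0"
  shows "(primitive f has_vector_derivative f t) (at t)"
proof -
  have "((\<lambda>u. integral {0..u} f) has_vector_derivative f t) (at t within {0..t+1})"
    by (rule integral_has_vector_derivative)
      (use assms in \<open>auto intro: continuous_on_subset\<close>)
  then show ?thesis
    unfolding primitive_def using assms(2)
    by (metis at_within_Icc_at less_add_one)
qed

lemma primitive_signals:
  assumes "continuous_on UNIV f"
  shows "primitive f \<in> signals"
proof -
  have *: "continuous_on {0..b} (primitive f)" for b
    unfolding primitive_def
    by (rule indefinite_integral_continuous_1, rule integrable_continuous_real)
      (use assms in \<open>auto intro: continuous_on_subset\<close>)
  have "continuous (at t) (primitive f)" for t
  proof -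
    \<comment> \<open>Precomposing with \<open>max 0\<close> gives continuity on a two-sided
      neighbourhood of \<open>t\<close>, also at \<open>t = 0\<close>, from continuity on
      \<open>{0..b}\<close> alone.\<close>
    have "continuous_on {-\<bar>t\<bar>-1<..<\<bar>t\<bar>+1} (\<lambda>x. primitive f (max 0 x))"
      by (rule continuous_on_compose2[OF *[of "\<bar>t\<bar>+1"]]) (auto intro!: continuous_intros)
    moreover have "primitive f (max 0 x) = primitive f x" for x
      by (cases "x > 0") (auto simp: primitive_neg max_def)
    ultimately have "continuous_on {-\<bar>t\<bar>-1<..<\<bar>t\<bar>+1} (primitive f)"
      by simp
    then show ?thesis
      by (rule continuous_on_interior) (auto simp: abs_if)
  qed
  then show ?thesis
    by (auto intro!: signalsI simp: primitive_neg continuous_at_imp_continuous_on)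
qed

lemma primitive_in [intro]: "f \<in> signals \<Longrightarrow> primitive f \<in> signals"
  by (auto intro: primitive_signals signals_cont)

lemma primitive_pow_in [intro]: "f \<in> signals \<Longrightarrow> (primitive ^^ k) f \<in> signals"
  by (induction k) auto

lemma signals_integrable: "f \<in> signals \<Longrightarrow> f integrable_on {a..b}"
  by (auto intro: integrable_continuous_real signals_cont)

lemma primitive_add:
  assumes "f \<in> signals" "g \<in> signals"
  shows "primitive (\<lambda>t. f t + g t) = (\<lambda>t. primitive f t + primitive g t)"
  unfolding primitive_def using assms by (auto simp: integral_add signals_integrable)

lemma primitive_scale: "primitive (\<lambda>t. c * f t) = (\<lambda>t. c * primitive f t)"
  unfolding primitive_def by simp

lemma primitive_diff:
  assumes "f \<in> signals" "g \<in> signals"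
  shows "primitive (\<lambda>t. f t - g t) = (\<lambda>t. primitive f t - primitive g t)"
  unfolding primitive_def using assms by (auto simp: integral_diff signals_integrable)

lemma primitive_0 [simp]: "primitive (\<lambda>t. 0) = (\<lambda>t. 0)"
  unfolding primitive_def by simp

lemma primitive_unique:
  assumes "F \<in> signals" "continuous_on UNIV f"
    and "\<And>t. t > 0 \<Longrightarrow> (F has_vector_derivative f t) (at t)"
  shows "F = (\<lambda>t. F 0 + primitive f t)"
proof
  fix t
  show "F t = F 0 + primitive f t"
  proof (cases "t > 0")
    case True
    have "(f has_integral (F t - F 0)) {0..t}"
      by (rule fundamental_theorem_of_calculus_interior)
        (use assms True in \<open>auto intro: signals_cont\<close>)
    then show ?thesis by (simp add: primitive_def integral_unique)
  qed (use signals_neg[OF assms(1), of t] in \<open>simp add: primitive_neg\<close>)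
qed

lemma primitive_inj:
  assumes "f \<in> signals" "g \<in> signals" "primitive f = primitive g"
  shows "f = g"
proof (rule signals_eqI[OF assms(1,2)])
  fix t :: real assume "t > 0"
  then show "f t = g t"
    using vector_derivative_unique_at[of "primitive f" "f t" t "g t"] assms
      primitive_vector_derivative[of f t] primitive_vector_derivative[of g t]
    by (simp add: signals_cont)
qed

text \<open>The Horner scheme of \<open>p\<close> evaluated at the integration operator J =
  \<open>primitive\<close>, i.e. the action of polynomials on signals in which the variable acts as
  J. Integration acts rather than differentiation, since signals are only continuous.\<close>

definition poly_act :: "complex poly \<Rightarrow> (real \<Rightarrow> complex) \<Rightarrow> real \<Rightarrow> complex" where
  "poly_act p f = fold_coeffs (\<lambda>c F t. c * f t + primitive F t) p (\<lambda>_. 0)"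

lemma poly_act_0 [simp]: "poly_act 0 f = (\<lambda>_. 0)"
  by (simp add: poly_act_def)

lemma poly_act_pCons: "poly_act (pCons c p) f = (\<lambda>t. c * f t + primitive (poly_act p f) t)"
  by (cases "p = 0 \<and> c = 0") (auto simp: poly_act_def)

lemma poly_act_in [intro]: "f \<in> signals \<Longrightarrow> poly_act p f \<in> signals"
  by (induction p) (auto simp: poly_act_pCons intro!: signals_add signals_scale)

lemma poly_act_add:
  "f \<in> signals \<Longrightarrow> poly_act (p + q) f = (\<lambda>t. poly_act p f t + poly_act q f t)"
  by (induction p q rule: poly_induct2)
    (auto simp: poly_act_pCons primitive_add poly_act_in algebra_simps)

lemma poly_act_smult: "f \<in> signals \<Longrightarrow> poly_act (smult c p) f = (\<lambda>t. c * poly_act p f t)"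
  by (induction p) (auto simp: poly_act_pCons primitive_scale poly_act_in algebra_simps)

lemma poly_act_diff:
  "f \<in> signals \<Longrightarrow> poly_act (p - q) f = (\<lambda>t. poly_act p f t - poly_act q f t)"
  using poly_act_add[of f p "smult (-1) q"] poly_act_smult[of f "-1" q] by simp

lemma poly_act_sum:
  "f \<in> signals \<Longrightarrow> poly_act (\<Sum>i\<in>A. p i) f = (\<lambda>t. \<Sum>i\<in>A. poly_act (p i) f t)"
  by (induction A rule: infinite_finite_induct) (auto simp: poly_act_add)

lemma poly_act_add_right:
  assumes "f \<in> signals" "g \<in> signals"
  shows "poly_act p (\<lambda>t. f t + g t) = (\<lambda>t. poly_act p f t + poly_act p g t)"
  by (induction p) (use assms in \<open>auto simp: poly_act_pCons primitive_add poly_act_in algebra_simps\<close>)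

lemma poly_act_scale_right: "poly_act p (\<lambda>t. c * f t) = (\<lambda>t. c * poly_act p f t)"
  by (induction p) (auto simp: poly_act_pCons primitive_scale algebra_simps)

lemma poly_act_diff_right:
  assumes "f \<in> signals" "g \<in> signals"
  shows "poly_act p (\<lambda>t. f t - g t) = (\<lambda>t. poly_act p f t - poly_act p g t)"
  by (induction p) (use assms in \<open>auto simp: poly_act_pCons primitive_diff poly_act_in algebra_simps\<close>)

lemma poly_act_zero_right [simp]: "poly_act p (\<lambda>t. 0) = (\<lambda>t. 0)"
  using poly_act_scale_right[of p 0 "\<lambda>t. 0"] by simp

lemma poly_act_sum_right:
  "(\<And>i. i \<in> A \<Longrightarrow> f i \<in> signals) \<Longrightarrow>
    poly_act p (\<lambda>t. \<Sum>i\<in>A. f i t) = (\<lambda>t. \<Sum>i\<in>A. poly_act p (f i) t)"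
  by (induction A rule: infinite_finite_induct)
    (auto simp: poly_act_add_right signals_sum)

lemma primitive_poly_act: "f \<in> signals \<Longrightarrow> primitive (poly_act p f) = poly_act p (primitive f)"
  by (induction p)
    (auto simp: poly_act_pCons primitive_add primitive_scale signals_scale primitive_in poly_act_in)

lemma poly_act_mult:
  "f \<in> signals \<Longrightarrow> poly_act (p * q) f = poly_act p (poly_act q f)"
  by (induction p)
    (auto simp: poly_act_pCons poly_act_add poly_act_smult)

lemma poly_act_const [simp]: "poly_act [:c:] f = (\<lambda>t. c * f t)"
  by (simp add: poly_act_pCons)

lemma poly_act_monom: "poly_act (monom c k) f = (\<lambda>t. c * (primitive ^^ k) f t)"
  by (induction k) (auto simp: monom_0 monom_Suc poly_act_pCons primitive_scale)

section \<open>First-order lags and stability\<close>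

abbreviation energy :: "(real \<Rightarrow> complex) \<Rightarrow> real \<Rightarrow> real \<Rightarrow> real" where
  "energy f a b \<equiv> integral {a..b} (\<lambda>t. (cmod (f t))\<^sup>2)"

text \<open>The energies increase with the horizon, so boundedness means finite energy on the
  half-line, without improper integrals. For \<open>T < 0\<close> the interval is empty and the
  energy is 0.\<close>

definition square_integrable :: "(real \<Rightarrow> complex) \<Rightarrow> bool" where
  "square_integrable f \<longleftrightarrow> bdd_above (range (\<lambda>T. energy f 0 T))"

text \<open>Neither condition implies the other. Energy is what the gain estimate propagates; the
  limit makes boundary terms vanish.\<close>

definition stable :: "(real \<Rightarrow> complex) \<Rightarrow> bool" where
  "stable f \<longleftrightarrow> square_integrable f \<and> (f \<longlongrightarrow> 0) at_top"

lemma square_integrableI: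
  assumes "\<And>T. T > 0 \<Longrightarrow> energy f 0 T \<le> M"
  shows "square_integrable f"
proof -
  have "energy f 0 T \<le> max M 0" for T
    using assms[of T] by (cases "T > 0"; cases "T = 0") auto
  then show ?thesis unfolding square_integrable_def by (intro bdd_aboveI) auto
qed

lemma square_integrableD:
  assumes "square_integrable f"
  obtains M where "M \<ge> 0" "\<And>T. energy f 0 T \<le> M"
proof -
  obtain M where M: "\<And>T. energy f 0 T \<le> M"
    using assms unfolding square_integrable_def bdd_above_def by auto
  with M[of "-1"] show ?thesis by (intro that[of M]) auto
qed

lemma signals_norm2_integrable:
  "f \<in> signals \<Longrightarrow> (\<lambda>t. (cmod (f t))\<^sup>2) integrable_on {a..b}"
  by (intro integrable_continuous_real continuous_intros signals_cont)

lemma square_integrable_le: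
  assumes "f \<in> signals" "square_integrable f" "square_integrable g" "g \<in> signals" "h \<in> signals"
    and le: "\<And>t. t \<ge> 0 \<Longrightarrow> (cmod (h t))\<^sup>2 \<le> a * (cmod (f t))\<^sup>2 + b * (cmod (g t))\<^sup>2"
    and "a \<ge> 0" "b \<ge> 0"
  shows "square_integrable h"
proof -
  obtain M where M: "\<And>T. energy f 0 T \<le> M"
    using square_integrableD[OF assms(2)] by metis
  obtain N where N: "\<And>T. energy g 0 T \<le> N"
    using square_integrableD[OF assms(3)] by metis
  show ?thesis
  proof (rule square_integrableI)
    fix T :: real
    have "energy h 0 T
        \<le> integral {0..T} (\<lambda>t. a * (cmod (f t))\<^sup>2 + b * (cmod (g t))\<^sup>2)"
      by (intro integral_le integrable_add integrable_on_mult_right signals_norm2_integrable assms) auto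
    also have "\<dots> = a * energy f 0 T + b * energy g 0 T"
      by (subst integral_add) (auto intro!: integrable_on_mult_right signals_norm2_integrable assms)
    also have "\<dots> \<le> a * M + b * N"
      using M N assms by (intro add_mono mult_left_mono) auto
    finally show "energy h 0 T \<le> a * M + b * N" .
  qed
qed

lemma weighted_am_gm:
  fixes x y a :: real
  assumes "a > 0"
  shows "2 * (x * y) \<le> a * x\<^sup>2 + y\<^sup>2 / a"
proof -
  have "0 \<le> (a * x - y)\<^sup>2 / a" using assms by simp
  also have "(a * x - y)\<^sup>2 / a = (a * (a * x\<^sup>2 - 2 * (x * y)) + y\<^sup>2) / a"
    by (simp add: power2_eq_square algebra_simps)
  also have "\<dots> = a * x\<^sup>2 - 2 * (x * y) + y\<^sup>2 / a"
    using assms by (simp add: add_divide_distrib)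
  finally show ?thesis by simp
qed

lemma cmod_add_squared_weighted:
  fixes a b :: complex
  assumes "e > 0"
  shows "(cmod (a + b))\<^sup>2 \<le> (1 + e) * (cmod a)\<^sup>2 + (1 + 1 / e) * (cmod b)\<^sup>2"
proof -
  have "(cmod (a + b))\<^sup>2 \<le> (cmod a + cmod b)\<^sup>2"
    by (intro power_mono norm_triangle_ineq) auto
  also have "\<dots> \<le> (1 + e) * (cmod a)\<^sup>2 + (1 + 1 / e) * (cmod b)\<^sup>2"
    using weighted_am_gm[OF assms, of "cmod a" "cmod b"] by (simp add: power2_sum distrib_right)
  finally show ?thesis .
qed

lemma square_integrable_add:
  assumes "f \<in> signals" "g \<in> signals" "square_integrable f" "square_integrable g"
  shows "square_integrable (\<lambda>t. f t + g t)"
  by (rule square_integrable_le[where f = f and g = g and a = 2 and b = 2])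
    (use cmod_add_squared_weighted[of 1] assms in \<open>auto intro: signals_add\<close>)

lemma square_integrable_scale:
  assumes "f \<in> signals" "square_integrable f"
  shows "square_integrable (\<lambda>t. c * f t)"
  by (rule square_integrable_le[where f = f and g = f and a = "(cmod c)\<^sup>2" and b = 0])
    (auto intro: assms signals_scale simp: norm_mult power_mult_distrib)

lemma stable_0 [simp]: "stable (\<lambda>t. 0)"
  by (simp add: stable_def square_integrable_def)

lemma stable_add:
  "f \<in> signals \<Longrightarrow> g \<in> signals \<Longrightarrow> stable f \<Longrightarrow> stable g \<Longrightarrow> stable (\<lambda>t. f t + g t)"
  by (simp add: stable_def square_integrable_add tendsto_add_zero)

lemma stable_scale: "f \<in> signals \<Longrightarrow> stable f \<Longrightarrow> stable (\<lambda>t. c * f t)"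
  by (simp add: stable_def square_integrable_scale tendsto_mult_right_zero)

text \<open>The solution of \<open>z' = l z + f\<close>, \<open>z 0 = 0\<close>. The resolvent \<open>l * lag l f + f\<close> inverts \<open>1 - l * primitive\<close>.\<close>

definition lag :: "complex \<Rightarrow> (real \<Rightarrow> complex) \<Rightarrow> real \<Rightarrow> complex" where
  "lag l f = (\<lambda>t. exp (l * complex_of_real t) * primitive (\<lambda>s. exp (- l * complex_of_real s) * f s) t)"

lemma lag_cont: "f \<in> signals \<Longrightarrow> continuous_on UNIV (\<lambda>s. exp (- l * complex_of_real s) * f s)"
  by (intro continuous_intros signals_cont)

lemma lag_in [intro]:
  assumes "f \<in> signals"
  shows "lag l f \<in> signals"
proof (rule signalsI)
  show "continuous_on UNIV (lag l f)"
    unfolding lag_def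
    by (intro continuous_intros signals_cont primitive_signals lag_cont assms)
qed (simp add: lag_def primitive_neg)

lemma lag_0: "t \<le> 0 \<Longrightarrow> lag l f t = 0"
  by (simp add: lag_def primitive_neg)

lemma exp_vector_derivative:
  "((\<lambda>t. exp (l * complex_of_real t)) has_vector_derivative l * exp (l * t)) (at t within A)"
proof -
  have "((\<lambda>z. exp (l * z)) has_field_derivative l * exp (l * of_real t)) (at (of_real t))"
    by (rule derivative_eq_intros refl | simp)+
  from has_vector_derivative_real_field[OF this] show ?thesis by (simp add: mult.commute)
qed

lemma lag_vector_derivative:
  assumes "f \<in> signals" "t > 0"
  shows "(lag l f has_vector_derivative l * lag l f t + f t) (at t)"
proof -
  have "(lag l f has_vector_derivative
      exp (l * complex_of_real t) * (exp (- l * complex_of_real t) * f t) + l * exp (l * complex_of_real t) * primitive (\<lambda>s. exp (- l * complex_of_real s) * f s) t) (at t)"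
    unfolding lag_def
    by (rule has_vector_derivative_mult[OF exp_vector_derivative
          primitive_vector_derivative[OF lag_cont[OF assms(1)] assms(2)]])
  then show ?thesis
    by (simp add: lag_def exp_minus field_simps)
qed

lemma lag_eq_primitive:
  assumes "f \<in> signals"
  shows "lag l f = primitive (\<lambda>t. l * lag l f t + f t)"
proof -
  have "(\<lambda>t. l * lag l f t + f t) \<in> signals"
    by (intro signals_add signals_scale lag_in assms)
  then have "lag l f = (\<lambda>t. lag l f 0 + primitive (\<lambda>t. l * lag l f t + f t) t)"
    by (intro primitive_unique lag_in assms signals_cont_UNIV lag_vector_derivative)
  then show ?thesis by (simp add: lag_0)
qed

text \<open>\<open>[:1, -l:]\<close> is the reversal of \<open>[:-l, 1:]\<close>: composing D - l
  with one integration gives 1 - l J.\<close>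

lemma poly_act_resolvent: "poly_act [:1, -l:] f = (\<lambda>t. f t - l * primitive f t)"
  using primitive_scale[of "-l" f] by (simp add: poly_act_pCons)

lemma resolvent_right:
  assumes "f \<in> signals"
  shows "poly_act [:1, -l:] (\<lambda>t. l * lag l f t + f t) = f"
proof -
  have "primitive (\<lambda>t. l * lag l f t + f t) = lag l f"
    by (simp flip: lag_eq_primitive[OF assms])
  then show ?thesis
    by (simp add: poly_act_resolvent)
qed

lemma resolvent_inj:
  assumes "f \<in> signals" "poly_act [:1, -l:] f = (\<lambda>t. 0)"
  shows "f = (\<lambda>t. 0)"
proof -
  have f: "f t = l * primitive f t" for t
    using fun_cong[OF assms(2), of t] by (simp add: poly_act_resolvent)
  \<comment> \<open>\<open>primitive f\<close> solves y' = l y with y(0) = 0, so its product with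
    the integrating factor is constant. \<open>max 0\<close> keeps the factor constant to the left,
    as a signal requires.\<close>
  define h where "h = (\<lambda>t. exp (- l * complex_of_real (max 0 t)) * primitive f t)"
  have "h \<in> signals"
  proof (rule signalsI)
    show "continuous_on UNIV h"
      unfolding h_def by (intro continuous_intros signals_cont primitive_in assms)
  qed (simp add: h_def primitive_neg)
  moreover have "(h has_vector_derivative 0) (at t)" if "t > 0" for t
  proof (rule has_vector_derivative_transform_within[where d = t])
    have "((\<lambda>t. exp (- l * complex_of_real t) * primitive f t) has_vector_derivative
        exp (- l * t) * f t + (- l) * exp (- l * t) * primitive f t) (at t)"
      by (rule has_vector_derivative_mult[OF exp_vector_derivative
          primitive_vector_derivative[OF signals_cont_UNIV[OF assms(1)] that]])
    also have "exp (- l * t) * f t + (- l) * exp (- l * t) * primitive f t = 0"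
      by (simp add: f)
    finally show "((\<lambda>t. exp (- l * complex_of_real t) * primitive f t) has_vector_derivative 0) (at t)" .
  qed (use that in \<open>auto simp: h_def dist_real_def\<close>)
  ultimately have "h = (\<lambda>t. h 0 + primitive (\<lambda>t. 0) t)"
    by (intro primitive_unique) auto
  then have "h t = h 0" for t
    by (metis primitive_0 add.right_neutral)
  then have "h t = 0" for t
    by (simp add: h_def primitive_neg)
  then have "primitive f t = 0" for t
    by (simp add: h_def)
  then show ?thesis using f by auto
qed

lemma resolvent:
  assumes "f \<in> signals" "g \<in> signals" "poly_act [:1, -l:] f = g"
  shows "f = (\<lambda>t. l * lag l g t + g t)"
proof -
  have *: "(\<lambda>t. l * lag l g t + g t) \<in> signals"
    by (intro signals_add signals_scale lag_in assms)
  have "poly_act [:1, -l:] (\<lambda>t. f t - (l * lag l g t + g t)) = (\<lambda>t. 0)"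
    using assms * by (subst poly_act_diff_right) (auto simp: resolvent_right)
  from resolvent_inj[OF signals_diff[OF assms(1) *] this] show ?thesis
    by (auto simp: fun_eq_iff)
qed

section \<open>Dissipation and decay of first-order lags\<close>

lemma real_primitive:
  fixes g :: "real \<Rightarrow> real"
  assumes "continuous_on UNIV g"
  shows "continuous_on {0..b} (\<lambda>t. integral {0..t} g)"
    and "t > 0 \<Longrightarrow> ((\<lambda>t. integral {0..t} g) has_real_derivative g t) (at t)"
proof -
  show "continuous_on {0..b} (\<lambda>t. integral {0..t} g)"
    by (rule indefinite_integral_continuous_1, rule integrable_continuous_real)
      (rule continuous_on_subset[OF assms subset_UNIV])
  assume "t > 0"
  have "((\<lambda>u. integral {0..u} g) has_real_derivative g t) (at t within {0..t+1})"
    by (rule integral_has_real_derivative)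
      (use \<open>t > 0\<close> continuous_on_subset[OF assms subset_UNIV] in auto)
  then show "((\<lambda>t. integral {0..t} g) has_real_derivative g t) (at t)"
    using \<open>t > 0\<close> by (metis at_within_Icc_at less_add_one)
qed

lemma norm2_derivative:
  assumes "(f has_vector_derivative d) (at t)"
  shows "((\<lambda>t. (cmod (f t))\<^sup>2) has_real_derivative 2 * Re (cnj (f t) * d)) (at t)"
proof -
  have "((\<lambda>t. cnj (f t)) has_vector_derivative cnj d) (at t)"
    by (rule bounded_linear.has_vector_derivative[OF bounded_linear_cnj assms])
  from has_vector_derivative_mult[OF assms this]
  have "((\<lambda>t. Re (f t * cnj (f t))) has_vector_derivative Re (f t * cnj d + d * cnj (f t))) (at t)"
    by (rule bounded_linear.has_vector_derivative[OF bounded_linear_Re])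
  moreover have "Re (f t * cnj d + d * cnj (f t)) = 2 * Re (cnj (f t) * d)"
    by simp
  moreover have "(\<lambda>t. Re (f t * cnj (f t))) = (\<lambda>t. (cmod (f t))\<^sup>2)"
    by (simp add: complex_mult_cnj cmod_power2)
  ultimately show ?thesis
    by (simp add: has_real_derivative_iff_has_vector_derivative mult.commute)
qed

text \<open>The energies up to T increase to a finite supremum, so little energy is left beyond a
  late time.\<close>

lemma square_integrable_tail:
  assumes "f \<in> signals" "square_integrable f" "e > 0"
  obtains N where "N \<ge> 0" "\<And>s T. N \<le> s \<Longrightarrow> s \<le> T \<Longrightarrow> energy f s T \<le> e"
proof -
  define G where "G T = energy f 0 T" for T
  have bdd: "bdd_above (range G)"
    using assms(2) by (simp add: square_integrable_def G_def[abs_def])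
  have comb: "G s + energy f s T = G T" if "0 \<le> s" "s \<le> T" for s T
    unfolding G_def by (rule integral_combine) (use that signals_norm2_integrable assms in auto)
  have nn: "energy f s T \<ge> 0" for s T
    by (rule integral_nonneg) (use signals_norm2_integrable assms in auto)
  have "Sup (range G) - e < Sup (range G)" using assms by simp
  then obtain N where N: "Sup (range G) - e < G N"
    by (subst (asm) less_cSup_iff) (use bdd in auto)
  have upper: "G T \<le> Sup (range G)" for T
    by (rule cSup_upper) (use bdd in auto)
  have "G N \<le> G (max N 0)"
    using nn[of 0 0] by (cases "N \<ge> 0") (auto simp: G_def max_def)
  then have *: "Sup (range G) - e < G (max N 0)" using N by simp
  show ?thesis
  proof (rule that[of "max N 0"])
    fix s T assume "max N 0 \<le> s" "s \<le> T"
    with comb[of "max N 0" s] comb[of s T] nn[of "max N 0" s] upper[of T] *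
    show "energy f s T \<le> e" by simp
  qed simp
qed

text \<open>With z = \<open>lag l f\<close>, the derivative of |z|^2 is -2 a |z|^2 + 2 Re (cnj z f),
  and the weighted AM-GM inequality bounds the mixed term by a |z|^2 + |f|^2 / a: half of the
  damping pays for the input.\<close>

lemma lag_dissipation:
  assumes f: "f \<in> signals" and l: "Re l < 0" and "0 \<le> s" "s \<le> t"
  defines "a \<equiv> - Re l"
  shows "(cmod (lag l f t))\<^sup>2 + a * energy (lag l f) s t
    \<le> (cmod (lag l f s))\<^sup>2 + energy f s t / a"
proof -
  have a: "a > 0" using l by (simp add: a_def)
  define z where "z = lag l f"
  have z: "z \<in> signals" by (simp add: z_def lag_in f)
  have cz: "continuous_on A (\<lambda>t. (cmod (z t))\<^sup>2)" for A
    by (intro continuous_intros signals_cont z)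
  have cf: "continuous_on A (\<lambda>t. (cmod (f t))\<^sup>2)" for A
    by (intro continuous_intros signals_cont f)
  define \<psi> where "\<psi> t = (cmod (z t))\<^sup>2 + a * energy z 0 t
      - energy f 0 t / a" for t
  have "\<psi> t \<le> \<psi> s"
  proof (rule DERIV_nonpos_imp_decreasing_open[OF \<open>s \<le> t\<close>])
    fix x assume x: "s < x" "x < t"
    then have x0: "x > 0" using \<open>0 \<le> s\<close> by simp
    let ?d = "2 * Re (cnj (z x) * (l * z x + f x)) + a * (cmod (z x))\<^sup>2 - (cmod (f x))\<^sup>2 / a"
    have "(\<psi> has_real_derivative ?d) (at x)"
      unfolding \<psi>_def
      by (intro DERIV_add DERIV_diff DERIV_cmult DERIV_cdivide norm2_derivative real_primitive cz cf x0)
        (use lag_vector_derivative[OF f x0] in \<open>simp add: z_def\<close>)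
    moreover have "?d \<le> 0"
    proof -
      have "Re (cnj (z x) * (l * z x + f x)) = - a * (cmod (z x))\<^sup>2 + Re (cnj (z x) * f x)"
        unfolding cmod_power2 by (simp add: a_def algebra_simps power2_eq_square)
      moreover have "Re (cnj (z x) * f x) \<le> cmod (z x) * cmod (f x)"
        using complex_Re_le_cmod[of "cnj (z x) * f x"] by (simp add: norm_mult)
      moreover have "2 * (cmod (z x) * cmod (f x)) \<le> a * (cmod (z x))\<^sup>2 + (cmod (f x))\<^sup>2 / a"
        by (rule weighted_am_gm[OF a])
      ultimately show ?thesis by (simp add: algebra_simps)
    qed
    ultimately show "\<exists>y. (\<psi> has_real_derivative y) (at x) \<and> y \<le> 0" by blast
  next
    have "continuous_on {s..t} (\<lambda>t. integral {0..t} g)" if "continuous_on UNIV g" for g :: "real \<Rightarrow> real"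
      by (rule continuous_on_subset[OF real_primitive(1)[OF that]]) (use \<open>0 \<le> s\<close> in auto)
    from this[OF cz] this[OF cf] show "continuous_on {s..t} \<psi>"
      unfolding \<psi>_def divide_inverse
      by (intro continuous_on_diff continuous_on_add continuous_on_mult continuous_on_const cz cf)
  qed
  moreover have "integral {0..s} g + integral {s..t} g = integral {0..t} g"
    if "continuous_on {0..t} g" for g :: "real \<Rightarrow> real"
    by (rule integral_combine[OF \<open>0 \<le> s\<close> \<open>s \<le> t\<close>]) (rule integrable_continuous_real[OF that])
  from this[OF cz] this[OF cf] have
    "energy z 0 t = energy z 0 s + energy z s t"
    "energy f 0 t = energy f 0 s + energy f s t"
    by simp_all
  ultimately show ?thesis
    unfolding \<psi>_def z_def by (simp add: algebra_simps add_divide_distrib)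
qed

text \<open>Dissipation from time 0 on bounds the energy. Finite energy makes |z| small at some late
  time, and dissipation from there on, with little input energy left, keeps it small.\<close>

lemma lag_stable:
  assumes f: "f \<in> signals" "square_integrable f" and l: "Re l < 0"
  shows "stable (lag l f)"
proof -
  define a where "a = - Re l"
  have a: "a > 0" using l by (simp add: a_def)
  define z where "z = lag l f"
  have z: "z \<in> signals" by (simp add: z_def lag_in f)
  note diss = lag_dissipation[OF f(1) l, folded a_def z_def]
  obtain M where M: "\<And>T. energy f 0 T \<le> M"
    using square_integrableD[OF f(2)] by metis
  have sq: "square_integrable z"
  proof (rule square_integrableI)
    fix T :: real assume "T > 0"
    have "a * energy z 0 T \<le> M / a"
    proof -
      have "a * energy z 0 T
          \<le> (cmod (z T))\<^sup>2 + a * energy z 0 T" by simp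
      also have "\<dots> \<le> (cmod (z 0))\<^sup>2 + energy f 0 T / a"
        using diss[of 0 T] \<open>T > 0\<close> by simp
      also have "\<dots> \<le> M / a"
        using M[of T] a by (simp add: z_def lag_0 divide_right_mono)
      finally show ?thesis .
    qed
    then show "energy z 0 T \<le> M / a / a"
      using a by (simp add: pos_le_divide_eq mult.commute)
  qed
  have "eventually (\<lambda>t. cmod (z t) < e) at_top" if "e > 0" for e
  proof -
    have e: "e\<^sup>2 / 4 > 0" using that by simp
    obtain N where N: "N \<ge> 0"
      "\<And>s T. N \<le> s \<Longrightarrow> s \<le> T \<Longrightarrow> energy f s T \<le> a * (e\<^sup>2 / 4)"
      using square_integrable_tail[OF f, of "a * (e\<^sup>2 / 4)"] a e by auto
    obtain N' where N': "N' \<ge> 0"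
      "\<And>s T. N' \<le> s \<Longrightarrow> s \<le> T \<Longrightarrow> energy z s T \<le> e\<^sup>2 / 4"
      using square_integrable_tail[OF z sq e] by auto
    define s where "s = max N N'"
    \<comment> \<open>Otherwise |z|^2 would exceed e^2 / 2 on a window of length 1, against a tail
      energy of at most e^2 / 4.\<close>
    have "\<exists>x\<in>{s..s+1}. (cmod (z x))\<^sup>2 \<le> 2 * (e\<^sup>2 / 4)"
    proof (rule ccontr)
      assume "\<not> ?thesis"
      then have "integral {s..s+1} (\<lambda>t. 2 * (e\<^sup>2 / 4)) \<le> energy z s (s+1)"
        by (intro integral_le signals_norm2_integrable z) (auto simp: not_le intro: less_imp_le)
      moreover have "energy z s (s+1) \<le> e\<^sup>2 / 4"
        by (rule N'(2)) (auto simp: s_def)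
      ultimately show False using e by simp
    qed
    then obtain x where x: "x \<ge> s" "(cmod (z x))\<^sup>2 \<le> 2 * (e\<^sup>2 / 4)" by auto
    have "cmod (z t) < e" if "t > x" for t
    proof -
      have "0 \<le> a * energy z x t"
        using a by (intro mult_nonneg_nonneg integral_nonneg signals_norm2_integrable z) auto
      then have "(cmod (z t))\<^sup>2 \<le> (cmod (z x))\<^sup>2 + energy f x t / a"
        using diss[of x t] that x N N' by (simp add: s_def)
      also have "energy f x t / a \<le> e\<^sup>2 / 4"
        using N(2)[of x t] that x a by (simp add: s_def pos_divide_le_eq mult.commute)
      finally have "(cmod (z t))\<^sup>2 < e\<^sup>2" using x(2) e by linarith
      then show ?thesis using \<open>e > 0\<close> by (simp add: power_less_imp_less_base)
    qed
    then show ?thesis by (auto simp: eventually_at_top_dense)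
  qed
  then have "(z \<longlongrightarrow> 0) at_top"
    by (auto simp: tendsto_iff)
  with sq show ?thesis by (simp add: stable_def z_def)
qed

lemma resolvent_square_integrable:
  "f \<in> signals \<Longrightarrow> square_integrable f \<Longrightarrow> Re l < 0 \<Longrightarrow> square_integrable (\<lambda>t. l * lag l f t + f t)"
  using lag_stable[of f l]
  by (auto intro!: square_integrable_add square_integrable_scale signals_scale simp: stable_def)

lemma resolvent_stable:
  "f \<in> signals \<Longrightarrow> stable f \<Longrightarrow> Re l < 0 \<Longrightarrow> stable (\<lambda>t. l * lag l f t + f t)"
  by (intro stable_add stable_scale signals_scale lag_stable lag_in) (auto simp: stable_def)

section \<open>Hurwitz polynomials and their filters\<close>

definition hurwitz :: "complex poly \<Rightarrow> bool" where
  "hurwitz p \<longleftrightarrow> p \<noteq> 0 \<and> (\<forall>s. poly p s = 0 \<longrightarrow> Re s < 0)"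

text \<open>Splitting off one root at a time reduces facts about filters to first-order
  lags.\<close>

lemma hurwitz_induct [consumes 1, case_names const factor]:
  assumes "hurwitz p"
    and const: "\<And>c. c \<noteq> 0 \<Longrightarrow> P [:c:]"
    and factor: "\<And>l q. Re l < 0 \<Longrightarrow> hurwitz q \<Longrightarrow> P q \<Longrightarrow> P ([:-l, 1:] * q)"
  shows "P p"
  using assms(1)
proof (induction "degree p" arbitrary: p)
  case 0
  then obtain c where "p = [:c:]" by (metis degree_eq_zeroE)
  with 0 const[of c] show ?case by (simp add: hurwitz_def)
next
  case (Suc n)
  have "\<not> constant (poly p)" using Suc(2) by (simp add: constant_degree)
  then obtain l where l: "poly p l = 0" using fundamental_theorem_of_algebra by blast
  then obtain q where q: "p = [:-l, 1:] * q" unfolding poly_eq_0_iff_dvd dvd_def by blast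
  have "q \<noteq> 0" using Suc q by (auto simp: hurwitz_def)
  then have "degree p = Suc (degree q)" by (simp add: q degree_mult_eq del: mult_pCons_left)
  moreover have "hurwitz q" using Suc(3) q \<open>q \<noteq> 0\<close> by (auto simp: hurwitz_def)
  moreover have "Re l < 0" using Suc(3) l by (auto simp: hurwitz_def)
  ultimately show ?case using factor[of l q] Suc by (simp add: q del: mult_pCons_left)
qed

lemma reflect_factor: "l \<noteq> 0 \<Longrightarrow> reflect_poly ([:-l, 1:] * q) = [:1, -l:] * reflect_poly (q :: complex poly)"
  by (subst reflect_poly_mult) (simp add: reflect_poly_pCons)

text \<open>With n = \<open>degree p\<close>, p(D) J^n is the reversed polynomial in J. So
  \<open>z\<close> is the n-th derivative of the solution x = J^n z of p(D) x = u with zero initial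
  data.\<close>

lemma hurwitz_solve:
  assumes "hurwitz p" "u \<in> signals"
  shows "\<exists>z\<in>signals. poly_act (reflect_poly p) z = u"
  using assms
proof (induction arbitrary: u rule: hurwitz_induct)
  case (const c)
  then show ?case by (intro bexI[of _ "\<lambda>t. u t / c"]) (use signals_scale[of u "1/c"] in auto)
next
  case (factor l q)
  have "(\<lambda>t. l * lag l u t + u t) \<in> signals"
    by (intro signals_add signals_scale lag_in factor)
  from factor(3)[OF this] obtain z where z: "z \<in> signals" "poly_act (reflect_poly q) z = (\<lambda>t. l * lag l u t + u t)"
    by auto
  have "l \<noteq> 0" using factor by auto
  then have "poly_act (reflect_poly ([:-l, 1:] * q)) z = u"
    using z factor by (simp add: reflect_factor poly_act_mult resolvent_right del: mult_pCons_left)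
  then show ?case using z by blast
qed

text \<open>For j >= 1, \<open>(primitive ^^ j) z\<close> is the derivative of order n - j < n of
  the solution x of p(D) x = u. It is a strictly proper output and tends to 0 even if the input is
  merely square integrable, whereas \<open>z\<close> itself has direct feedthrough and needs a
  convergent input.\<close>

lemma hurwitz_response:
  assumes "hurwitz p" "z \<in> signals"
  defines "u \<equiv> poly_act (reflect_poly p)"
  shows "(square_integrable (u z) \<longrightarrow> square_integrable z) \<and> (stable (u z) \<longrightarrow> stable z) \<and>
    (square_integrable (u z) \<longrightarrow> (\<forall>j\<in>{1..degree p}. stable ((primitive ^^ j) z)))"
  using assms(1,2) unfolding u_def
proof (induction arbitrary: z rule: hurwitz_induct)
  case (const c)
  then show ?case
    using square_integrable_scale[of "\<lambda>t. c * z t" "1/c"] stable_scale[of "\<lambda>t. c * z t" "1/c"] signals_scale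
    by auto
next
  case (factor l q)
  define y where "y = poly_act (reflect_poly q) z"
  have y: "y \<in> signals" using factor by (auto simp: y_def)
  define u where "u = poly_act (reflect_poly ([:-l, 1:] * q)) z"
  have u: "u \<in> signals" using factor by (auto simp: u_def)
  have "l \<noteq> 0" using factor by auto
  then have "poly_act [:1, -l:] y = u"
    using factor by (simp add: reflect_factor poly_act_mult y_def u_def del: mult_pCons_left)
  then have yu: "y = (\<lambda>t. l * lag l u t + u t)" using resolvent y u by blast
  note IH = factor(3)[OF \<open>z \<in> signals\<close>, folded y_def]
  have sq: "square_integrable y" if "square_integrable u"
    unfolding yu using resolvent_square_integrable[OF u that factor(1)] .
  have "stable y" if "stable u"
    unfolding yu using resolvent_stable[OF u that factor(1)] .
  moreover have "stable ((primitive ^^ j) z)" if su: "square_integrable u" and j: "j \<in> {1..degree ([:-l, 1:] * q)}" for j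
  proof (cases "j \<le> degree q")
    case True
    then show ?thesis using IH sq[OF su] j by auto
  next
    case False
    have "degree ([:-l, 1:] * q) = Suc (degree q)"
      using factor by (subst degree_mult_eq) (auto simp: hurwitz_def)
    then have j: "j = Suc (degree q)" using j False by auto
    \<comment> \<open>The deepest integral: with respect to \<open>q\<close>,
      \<open>primitive z\<close> is the response to \<open>lag l u\<close>, which tends to 0 even if
      \<open>u\<close> does not.\<close>
    have "poly_act (reflect_poly q) (primitive z) = lag l u"
      using factor(4) lag_eq_primitive[OF u, of l] by (simp flip: primitive_poly_act y_def yu)
    moreover have lu: "stable (lag l u)" using lag_stable[OF u su factor(1)] .
    ultimately have "stable (primitive z)" "\<forall>j\<in>{1..degree q}. stable ((primitive ^^ j) (primitive z))"
      using factor(3)[OF primitive_in[OF factor(4)]] by (auto simp: stable_def)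
    moreover have "(primitive ^^ j) z = (primitive ^^ degree q) (primitive z)"
      by (simp add: j funpow_swap1)
    ultimately show ?thesis by (cases "degree q = 0") auto
  qed
  ultimately show ?case using IH sq unfolding u_def by blast
qed

text \<open>The signal is exp(l t), written as the resolvent applied to 1. The constant 1 is not
  square integrable, so the decay is checked directly.\<close>

lemma exp_stable:
  assumes "Re l < 0"
  shows "stable (\<lambda>t. l * lag l (\<lambda>t. 1) t + 1)"
proof -
  define z where "z = (\<lambda>t. l * lag l (\<lambda>t. 1) t + 1)"
  have z: "z \<in> signals" unfolding z_def by (intro signals_add signals_scale lag_in signals_const)
  have l: "l \<noteq> 0" using assms by auto
  have zt: "z t = exp (l * complex_of_real t)" if "t > 0" for t
  proof -
    define h where "h = (\<lambda>t. exp (l * complex_of_real (max 0 t)))"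
    have h: "h \<in> signals"
      unfolding h_def by (rule signalsI) (auto intro!: continuous_intros)
    have *: "h = (\<lambda>t. h 0 + primitive (\<lambda>t. l * h t) t)"
    proof (rule primitive_unique[OF h signals_cont_UNIV[OF signals_scale[OF h]]])
      fix t :: real assume t: "t > 0"
      show "(h has_vector_derivative l * h t) (at t)"
        by (rule has_vector_derivative_transform_within[where d = t and f = "\<lambda>t. exp (l * complex_of_real t)"])
          (use t exp_vector_derivative[of l t UNIV] in \<open>auto simp: h_def dist_real_def\<close>)
    qed
    have "h t = 1 + l * primitive h t" for t
    proof -
      have "h 0 = 1" by (simp add: h_def)
      with fun_cong[OF *, of t] show ?thesis by (simp only: primitive_scale)
    qed
    then have "poly_act [:1, -l:] h = (\<lambda>t. 1)"
      unfolding poly_act_resolvent by (metis add_diff_cancel_right')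
    from resolvent[OF h signals_const this] show ?thesis
      using that by (auto simp: z_def h_def max_def dest: fun_cong[of _ _ t])
  qed
  have nz: "cmod (z t) = exp (Re l * t)" if "t > 0" for t
    using zt[OF that] by (simp add: norm_exp_eq_Re)
  have "(z \<longlongrightarrow> 0) at_top"
  proof (rule tendsto_norm_zero_cancel, rule Lim_transform_eventually)
    show "((\<lambda>t. exp (Re l * t)) \<longlongrightarrow> 0) at_top"
      by (rule filterlim_compose[OF exp_at_bot filterlim_tendsto_neg_mult_at_bot[OF tendsto_const assms filterlim_ident]])
    show "\<forall>\<^sub>F t in at_top. exp (Re l * t) = cmod (z t)"
      using eventually_gt_at_top[of 0] by eventually_elim (simp add: nz)
  qed
  moreover have "square_integrable z"
  proof (rule square_integrableI)
    fix T :: real assume T: "T > 0"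
    define r where "r = 2 * Re l"
    have "((\<lambda>t. exp (r * t)) has_integral exp (r * T) / r - exp (r * 0) / r) {0..T}"
      by (rule fundamental_theorem_of_calculus)
        (use T assms in \<open>auto simp: r_def simp flip: has_real_derivative_iff_has_vector_derivative intro!: derivative_eq_intros\<close>)
    moreover have "(cmod (z t))\<^sup>2 = exp (r * t)" if "t \<in> {0..T} - {0}" for t
      using nz[of t] that by (simp add: r_def exp_double[symmetric] power2_eq_square exp_add[symmetric])
    ultimately have "((\<lambda>t. (cmod (z t))\<^sup>2) has_integral exp (r * T) / r - exp (r * 0) / r) {0..T}"
      using has_integral_spike_finite[of "{0}"] by (metis finite.emptyI finite.insertI)
    then have "energy z 0 T = exp (r * T) / r - 1 / r"
      by (simp add: integral_unique)
    also have "\<dots> \<le> - 1 / r" using assms by (simp add: r_def divide_nonneg_neg)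
    finally show "energy z 0 T \<le> - 1 / r" .
  qed
  ultimately show ?thesis by (simp add: stable_def z_def)
qed

text \<open>Polynomial forcing of degree below that of \<open>p\<close> encodes the initial data of \<open>p(d/dt) w = 0\<close>.\<close>

lemma hurwitz_polynomial_forcing:
  assumes "hurwitz p" "w \<in> signals" "poly_act (reflect_poly p) w = poly_act a (\<lambda>t. 1)"
    and "\<And>k. k \<ge> degree p \<Longrightarrow> coeff a k = 0"
  shows "stable w"
  using assms
proof (induction arbitrary: w a rule: hurwitz_induct)
  case (const c)
  then have "a = 0" by (intro poly_eqI) auto
  then have "w = (\<lambda>t. 0)" using const by (auto simp: fun_eq_iff)
  then show ?case by simp
next
  case (factor l q)
  have l: "l \<noteq> 0" using factor by auto
  define m where "m = [:1, -l:]"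
  have dm: "degree m = 1" using l by (simp add: m_def)
  \<comment> \<open>Modulo \<open>m\<close> the forcing is a constant, whose response is a multiple
    of exp(l t). The quotient \<open>b\<close> is the forcing left for \<open>q\<close>, with a
    degree bound lower by one.\<close>
  define b where "b = a div m"
  have "degree (a mod m) < 1 \<or> a mod m = 0" using degree_mod_less[of m a] dm by (auto simp: m_def)
  then have "degree (a mod m) = 0" by auto
  then obtain \<alpha> where \<alpha>: "a mod m = [:\<alpha>:]" using degree_eq_zeroE by blast
  have a: "a = m * b + [:\<alpha>:]" unfolding b_def \<alpha>[symmetric] by simp
  have deg: "degree ([:-l, 1:] * q) = Suc (degree q)"
    using factor by (subst degree_mult_eq) (auto simp: hurwitz_def)
  have b: "coeff b k = 0" if "k \<ge> degree q" for k
  proof (cases "b = 0")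
    case False
    have "degree (m * b) = Suc (degree b)" using False dm by (subst degree_mult_eq) (auto simp: m_def)
    then have "coeff a (Suc (degree b)) \<noteq> 0"
      using False lead_coeff_mult[of m b] unfolding a by (auto simp: m_def l)
    then have "Suc (degree b) < Suc (degree q)"
      using factor(6)[of "Suc (degree b)"] unfolding deg by (meson not_le)
    then show ?thesis using that by (simp add: coeff_eq_0)
  qed simp
  define y where "y = poly_act (reflect_poly q) w"
  have y: "y \<in> signals" using factor by (auto simp: y_def)
  define v where "v = (\<lambda>t. \<alpha> * (l * lag l (\<lambda>t. 1) t + 1))"
  have v: "v \<in> signals" unfolding v_def by (intro signals_add signals_scale lag_in signals_const)
  have sv: "stable v" unfolding v_def
    by (intro stable_scale exp_stable factor) (intro signals_add signals_scale lag_in signals_const)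
  have 1: "poly_act m v = (\<lambda>t. \<alpha>)"
    unfolding v_def m_def by (simp add: poly_act_scale_right resolvent_right)
  have B: "poly_act b (\<lambda>t. 1) \<in> signals" by auto
  have "poly_act m y = poly_act a (\<lambda>t. 1)"
    using factor l by (simp add: reflect_factor poly_act_mult y_def m_def del: mult_pCons_left)
  also have "\<dots> = (\<lambda>t. poly_act m (poly_act b (\<lambda>t. 1)) t + poly_act m v t)"
    unfolding 1 by (simp add: a poly_act_add poly_act_mult)
  finally have "poly_act m (\<lambda>t. y t - (poly_act b (\<lambda>t. 1) t + v t)) = (\<lambda>t. 0)"
    using y B v by (simp add: poly_act_diff_right poly_act_add_right signals_add)
  moreover have "(\<lambda>t. y t - (poly_act b (\<lambda>t. 1) t + v t)) \<in> signals"
    using y B v by (intro signals_diff signals_add)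
  ultimately have "(\<lambda>t. y t - (poly_act b (\<lambda>t. 1) t + v t)) = (\<lambda>t. 0)"
    unfolding m_def using resolvent_inj by blast
  then have yb: "y = (\<lambda>t. poly_act b (\<lambda>t. 1) t + v t)" by (simp add: fun_eq_iff)
  \<comment> \<open>\<open>w2\<close> absorbs the exponential part of \<open>y\<close>; the rest of
    \<open>w\<close> is driven by the forcing \<open>b\<close> alone, so that the induction
    applies.\<close>
  obtain w2 where w2: "w2 \<in> signals" "poly_act (reflect_poly q) w2 = v"
    using hurwitz_solve[OF factor(2) v] by auto
  have "stable w2" using hurwitz_response[OF factor(2) w2(1)] w2 sv by simp
  moreover have "stable (\<lambda>t. w t - w2 t)"
  proof (rule factor(3))
    show "(\<lambda>t. w t - w2 t) \<in> signals" using factor w2 by (intro signals_diff)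
    show "poly_act (reflect_poly q) (\<lambda>t. w t - w2 t) = poly_act b (\<lambda>t. 1)"
      using factor w2 yb by (simp add: poly_act_diff_right y_def)
  qed (use b in auto)
  ultimately have "stable (\<lambda>t. (w t - w2 t) + w2 t)"
    using factor w2 by (intro stable_add signals_diff)
  then show ?case by simp
qed

text \<open>Every integral vanishes at 0, so the constant coefficient of \<open>a\<close> is 0, and
  injectivity of \<open>primitive\<close> then removes one integration. This undoes surplus
  integrations of an equation.\<close>

lemma primitive_pow_cancel:
  assumes "f \<in> signals" "(primitive ^^ m) f = poly_act a (\<lambda>t. 1)"
    and "\<And>k. k \<ge> m + n \<Longrightarrow> coeff a k = 0"
  shows "\<exists>b. f = poly_act b (\<lambda>t. 1) \<and> (\<forall>k\<ge>n. coeff b k = 0)"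
  using assms(2,3)
proof (induction m arbitrary: a)
  case (Suc m)
  obtain c b where a: "a = pCons c b" by (rule pCons_cases)
  have eq: "primitive ((primitive ^^ m) f) t = c + primitive (poly_act b (\<lambda>t. 1)) t" for t
    using Suc(2) by (simp add: a poly_act_pCons)
  from this[of 0] have "c = 0" by (simp add: primitive_neg)
  then have "primitive ((primitive ^^ m) f) = primitive (poly_act b (\<lambda>t. 1))"
    unfolding fun_eq_iff using eq by simp
  then have "(primitive ^^ m) f = poly_act b (\<lambda>t. 1)"
    by (rule primitive_inj[OF primitive_pow_in[OF assms(1)] poly_act_in[OF signals_const]])
  moreover have "coeff b k = 0" if "k \<ge> m + n" for k
    using Suc(3)[of "Suc k"] that by (simp add: a)
  ultimately show ?case using Suc(1) by blast
qed (use assms in auto)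

section \<open>Energy gain of a stable filter\<close>

text \<open>The para-conjugate takes the conjugate values on the imaginary axis.\<close>

definition para :: "complex poly \<Rightarrow> complex poly" where
  "para p = map_poly cnj p \<circ>\<^sub>p [:0, -1:]"

lemma poly_para: "poly (para p) s = cnj (poly p (- cnj s))"
proof -
  have "poly (map_poly cnj p) (cnj s) = cnj (poly p s)" for s
    by (induction p) (auto simp: map_poly_pCons)
  from this[of "- cnj s"] show ?thesis by (simp add: para_def poly_pcompose)
qed

lemma coeff_para: "coeff (para p) k = (-1) ^ k * cnj (coeff p k)"
  unfolding para_def by (subst coeff_pcompose_linear) (simp add: coeff_map_poly)

lemma para_mult: "para (p * q) = para p * para q"
  unfolding poly_eq_poly_eq_iff[symmetric] by (simp add: fun_eq_iff poly_para)

lemma para_para [simp]: "para (para p) = p"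
  unfolding poly_eq_poly_eq_iff[symmetric] by (simp add: fun_eq_iff poly_para)

lemma degree_para [simp]: "degree (para p) = degree p"
proof -
  have "degree (para p) \<le> degree p" for p
    by (rule degree_le) (simp add: coeff_para coeff_eq_0)
  from this[of p] this[of "para p"] show ?thesis by simp
qed

text \<open>The zeros of a para-symmetric \<open>F\<close> pair up as a and -cnj a. Positivity keeps
  them off the imaginary axis, so the two differ and one of each pair goes to \<open>r\<close>;
  dividing by a pair preserves both hypotheses. \<open>r\<close> is not asked to be Hurwitz.\<close>

lemma spectral_factorization:
  assumes "para F = F" "\<And>x. Re (poly F (\<i> * complex_of_real x)) > 0"
  shows "\<exists>r. F = r * para r \<and> degree F = 2 * degree r"
  using assms
proof (induction "degree F" arbitrary: F rule: less_induct)
  case less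
  have pos: "F \<noteq> 0" using less(3)[of 0] by auto
  show ?case
  proof (cases "degree F = 0")
    case True
    then obtain c where c: "F = [:c:]" by (metis degree_eq_zeroE)
    have "Re c > 0" using less(3)[of 0] by (simp add: c)
    moreover have "cnj c = c" using less(2) by (simp add: c para_def map_poly_pCons)
    ultimately have "F = [:complex_of_real (sqrt (Re c)):] * para [:complex_of_real (sqrt (Re c)):]"
      by (simp add: c para_def map_poly_pCons complex_eq_iff flip: of_real_mult)
    then show ?thesis using True by (intro exI[of _ "[:complex_of_real (sqrt (Re c)):]"]) simp
  next
    case False
    then have "\<not> constant (poly F)" by (simp add: constant_degree)
    then obtain a where a: "poly F a = 0" using fundamental_theorem_of_algebra by blast
    have Re: "Re a \<noteq> 0"
    proof
      assume "Re a = 0"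
      then have "a = \<i> * complex_of_real (Im a)" by (simp add: complex_eq_iff)
      with a less(3)[of "Im a"] show False by simp
    qed
    obtain G where G: "F = [:-a, 1:] * G" using a unfolding poly_eq_0_iff_dvd dvd_def by blast
    have "poly F (- cnj a) = 0" using poly_para[of F "- cnj a"] less(2) a by simp
    moreover have "- cnj a \<noteq> a" using Re by (auto simp: complex_eq_iff)
    moreover have "poly F (- cnj a) = (- cnj a - a) * poly G (- cnj a)"
      by (simp add: G algebra_simps)
    ultimately have "poly G (- cnj a) = 0" by simp
    then obtain H where H: "G = [:cnj a, 1:] * H" unfolding poly_eq_0_iff_dvd dvd_def by auto
    define l where "l = [:-a, 1:]"
    define m where "m = l * para l"
    have pl: "para l = [:-cnj a, -1:]" by (simp add: l_def para_def map_poly_pCons pcompose_pCons)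
    \<comment> \<open>\<open>para l\<close> is -(s + cnj a), hence the minus sign. It makes
      \<open>m\<close> equal to |s - a|^2 on the axis, so that \<open>- H\<close> inherits
      positivity.\<close>
    have F: "F = m * (- H)"
      unfolding m_def pl unfolding G H l_def
      by (simp add: algebra_simps smult_diff_left)
    have "m \<noteq> 0" unfolding m_def pl by (simp add: l_def)
    have "para m = m" by (simp add: m_def para_mult mult.commute)
    then have 1: "para (- H) = - H"
      using less(2) \<open>m \<noteq> 0\<close> unfolding F para_mult by (metis mult_left_cancel)
    have 2: "Re (poly (- H) (\<i> * complex_of_real x)) > 0" for x
    proof -
      let ?s = "\<i> * complex_of_real x"
      have "poly m ?s = poly l ?s * cnj (poly l ?s)"
        by (simp add: m_def poly_para)
      also have "\<dots> = complex_of_real ((cmod (poly l ?s))\<^sup>2)"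
        by (rule complex_norm_square[symmetric])
      finally have "poly F ?s = complex_of_real ((cmod (poly l ?s))\<^sup>2) * poly (- H) ?s"
        by (simp add: F)
      then have "Re (poly F ?s) = (cmod (poly l ?s))\<^sup>2 * Re (poly (- H) ?s)"
        by (simp only: Re_complex_of_real Im_complex_of_real times_complex.simps mult_zero_left diff_zero)
      then show ?thesis using less(3)[of x] by (metis mult_nonneg_nonpos not_le zero_le_power2)
    qed
    have "H \<noteq> 0" using pos F by auto
    have dm: "degree m = 2" unfolding m_def pl by (subst degree_mult_eq) (auto simp: l_def)
    have dF: "degree F = 2 + degree H"
      unfolding F using \<open>m \<noteq> 0\<close> \<open>H \<noteq> 0\<close> dm by (subst degree_mult_eq) auto
    then have "degree (- H) < degree F" by simp
    from less(1)[OF this 1 2] obtain r where r: "- H = r * para r" "degree (- H) = 2 * degree r"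
      by blast
    have "r \<noteq> 0" using r \<open>H \<noteq> 0\<close> by auto
    then have "degree (l * r) = Suc (degree r)" by (subst degree_mult_eq) (auto simp: l_def)
    moreover have "F = (l * r) * para (l * r)"
      unfolding F r(1) m_def para_mult by (simp add: ac_simps)
    ultimately show ?thesis using dF r(2) by (intro exI[of _ "l * r"]) simp
  qed
qed

text \<open>Reversing coefficients turns a polynomial in the differentiation operator into a
  polynomial in its right inverse \<^const>\<open>primitive\<close>.\<close>

definition rev_poly :: "nat \<Rightarrow> complex poly \<Rightarrow> complex poly" where
  "rev_poly n p = (\<Sum>k\<le>n. monom (coeff p k) (n - k))"

lemma poly_act_rev_poly:
  assumes "f \<in> signals"
  shows "poly_act (rev_poly n p) f = (\<lambda>t. \<Sum>k\<le>n. coeff p k * (primitive ^^ (n - k)) f t)"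
  unfolding rev_poly_def by (simp add: poly_act_sum assms poly_act_monom)

lemma coeff_rev_poly: "coeff (rev_poly n p) k = (if k \<le> n then coeff p (n - k) else 0)"
proof -
  have "coeff (rev_poly n p) k = (\<Sum>i\<le>n. if i = n - k \<and> k \<le> n then coeff p i else 0)"
    unfolding rev_poly_def coeff_sum by (intro sum.cong) auto
  also have "\<dots> = (if k \<le> n then coeff p (n - k) else 0)"
    by (cases "k \<le> n") (simp_all add: sum.delta')
  finally show ?thesis .
qed

lemma rev_poly_degree: "rev_poly (degree p) p = reflect_poly p"
  by (intro poly_eqI) (simp add: coeff_rev_poly coeff_reflect_poly)

lemma rev_poly_shift:
  assumes "degree p \<le> n" "n \<le> m"
  shows "rev_poly m p = monom 1 (m - n) * rev_poly n p"
  by (intro poly_eqI)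
    (use assms in \<open>auto simp: coeff_rev_poly coeff_monom_mult coeff_eq_0\<close>)

text \<open>Weights that depend on j + k only see nothing but the product of the polynomials. With
  \<open>q = para p\<close> this makes an energy a function of \<open>p * para p\<close>.\<close>

lemma sum_coeff_mult:
  fixes p q :: "complex poly"
  assumes "degree p \<le> n" "degree q \<le> n"
  shows "(\<Sum>j\<le>n. \<Sum>k\<le>n. coeff p j * coeff q k * x (j + k)) = (\<Sum>m\<le>2*n. coeff (p * q) m * x m)"
proof -
  have "p * q = (\<Sum>j\<le>n. monom (coeff p j) j) * (\<Sum>k\<le>n. monom (coeff q k) k)"
    using assms by (simp add: poly_as_sum_of_monoms')
  also have "\<dots> = (\<Sum>j\<le>n. \<Sum>k\<le>n. monom (coeff p j * coeff q k) (j + k))"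
    by (simp add: sum_product mult_monom)
  finally have "(\<Sum>m\<le>2*n. coeff (p * q) m * x m) =
     (\<Sum>m\<le>2*n. \<Sum>j\<le>n. \<Sum>k\<le>n. if m = j + k then coeff p j * coeff q k * x m else 0)"
    by (simp add: coeff_sum sum_distrib_right if_distrib[of "\<lambda>y. y * _"] eq_commute cong: if_cong)
  also have "\<dots> = (\<Sum>j\<le>n. \<Sum>k\<le>n. \<Sum>m\<le>2*n. if m = j + k then coeff p j * coeff q k * x m else 0)"
    by (subst sum.swap, rule sum.cong[OF refl], subst sum.swap) simp
  also have "\<dots> = (\<Sum>j\<le>n. \<Sum>k\<le>n. coeff p j * coeff q k * x (j + k))"
    by (intro sum.cong refl) (simp add: sum.delta')
  finally show ?thesis by simp
qed

section \<open>Energies of a tower of derivatives\<close>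

context
  fixes z :: "real \<Rightarrow> complex" and n :: nat
  assumes z: "z \<in> signals" and st: "\<And>j. j \<le> n \<Longrightarrow> stable ((primitive ^^ j) z)"
begin

text \<open>For j <= n, the j-th derivative of x = J^n z; in particular \<open>tower n\<close> is
  \<open>z\<close>.\<close>

definition tower :: "nat \<Rightarrow> real \<Rightarrow> complex" where
  "tower j = (primitive ^^ (n - j)) z"

text \<open>The sign is that of the coefficients of \<open>para\<close>, so integration by parts
  becomes a shift of indices without a sign.\<close>

definition gram :: "nat \<Rightarrow> nat \<Rightarrow> real \<Rightarrow> complex" where
  "gram j k T = (-1) ^ k * integral {0..T} (\<lambda>t. tower j t * cnj (tower k t))"

lemma tower_in: "tower j \<in> signals"
  unfolding tower_def using z by auto

lemma tower_deriv:
  assumes "j < n" "t > 0"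
  shows "(tower j has_vector_derivative tower (Suc j) t) (at t)"
proof -
  have "tower j = primitive (tower (Suc j))"
    using assms by (simp add: tower_def Suc_diff_Suc flip: funpow.simps(2)[THEN fun_cong, unfolded comp_def])
  then show ?thesis
    using primitive_vector_derivative[OF signals_cont_UNIV[OF tower_in] assms(2)] by metis
qed

text \<open>Integration by parts moves a derivative from one factor to the other and flips the sign.
  Up to vanishing terms \<open>gram j k\<close> thus depends on \<open>j + k\<close> only, which is what makes a polynomial
  identity between para-conjugates an energy balance in the time domain (without Parseval).\<close>

lemma gram_shift:
  assumes "j < n" "k < n"
  shows "((\<lambda>T. gram (Suc j) k T - gram j (Suc k) T) \<longlongrightarrow> 0) at_top"
proof -
  have tj: "(tower j \<longlongrightarrow> 0) at_top" "(tower k \<longlongrightarrow> 0) at_top"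
    using st by (auto simp: tower_def stable_def)
  have "gram (Suc j) k T - gram j (Suc k) T = (-1) ^ k * (tower j T * cnj (tower k T))" if T: "T > 0" for T
  proof -
    have "((\<lambda>t. tower j t * cnj (tower (Suc k) t) + tower (Suc j) t * cnj (tower k t)) has_integral
        tower j T * cnj (tower k T) - tower j 0 * cnj (tower k 0)) {0..T}"
    proof (rule fundamental_theorem_of_calculus_interior)
      show "continuous_on {0..T} (\<lambda>t. tower j t * cnj (tower k t))"
        by (intro continuous_intros signals_cont tower_in)
      fix t assume t: "t \<in> {0<..<T}"
      show "((\<lambda>t. tower j t * cnj (tower k t)) has_vector_derivative
          tower j t * cnj (tower (Suc k) t) + tower (Suc j) t * cnj (tower k t)) (at t)"
        by (intro has_vector_derivative_mult tower_deriv assms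
            bounded_linear.has_vector_derivative[OF bounded_linear_cnj]) (use t in auto)
    qed (use T in simp)
    moreover have "tower j 0 = 0"
      using assms by (simp add: tower_def Suc_diff_Suc[symmetric] primitive_neg)
    moreover have int: "(\<lambda>t. tower a t * cnj (tower b t)) integrable_on {0..T}" for a b
      by (intro integrable_continuous_real continuous_intros signals_cont tower_in)
    ultimately have "integral {0..T} (\<lambda>t. tower j t * cnj (tower (Suc k) t)) +
        integral {0..T} (\<lambda>t. tower (Suc j) t * cnj (tower k t)) = tower j T * cnj (tower k T)"
      by (subst integral_add[symmetric]) (simp_all add: integral_unique)
    then show ?thesis by (simp add: gram_def algebra_simps flip: distrib_left)
  qed
  moreover have "((\<lambda>T. (-1) ^ k * (tower j T * cnj (tower k T))) \<longlongrightarrow> (-1) ^ k * (0 * cnj 0)) at_top"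
    by (intro tendsto_intros tj)
  ultimately show ?thesis
    by (auto elim!: Lim_transform_eventually intro!: eventually_mono[OF eventually_gt_at_top[of 0]])
qed

lemma gram_shift_add:
  "j + d \<le> n \<Longrightarrow> k + d \<le> n \<Longrightarrow> ((\<lambda>T. gram (j + d) k T - gram j (k + d) T) \<longlongrightarrow> 0) at_top"
proof (induction d arbitrary: k)
  case (Suc d)
  have "((\<lambda>T. (gram (Suc (j + d)) k T - gram (j + d) (Suc k) T) +
      (gram (j + d) (Suc k) T - gram j (Suc k + d) T)) \<longlongrightarrow> 0 + 0) at_top"
    using Suc by (intro tendsto_add gram_shift Suc.IH) auto
  then show ?case by simp
qed simp

text \<open>A normal form on each antidiagonal: (j + k, 0) if j + k <= n, and (n, j + k - n)
  beyond.\<close>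

lemma gram_antidiagonal:
  assumes "j \<le> n" "k \<le> n"
  shows "((\<lambda>T. gram j k T - gram (min (j + k) n) (j + k - min (j + k) n) T) \<longlongrightarrow> 0) at_top"
proof -
  define d where "d = min (j + k) n - j"
  define k' where "k' = j + k - min (j + k) n"
  have *: "j + d = min (j + k) n" "k' + d = k" using assms by (auto simp: d_def k'_def)
  have "((\<lambda>T. gram (j + d) k' T - gram j (k' + d) T) \<longlongrightarrow> 0) at_top"
    using assms * by (intro gram_shift_add) auto
  from tendsto_minus[OF this] show ?thesis unfolding * by (simp add: k'_def)
qed

lemma integral_norm2_tower:
  assumes "degree p \<le> n"
  shows "complex_of_real (integral {0..T} (\<lambda>t. (cmod (poly_act (rev_poly n p) z t))\<^sup>2)) =
    (\<Sum>j\<le>n. \<Sum>k\<le>n. coeff p j * coeff (para p) k * gram j k T)"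
proof -
  have int: "(\<lambda>t. tower a t * cnj (tower b t)) integrable_on {0..T}" for a b
    by (intro integrable_continuous_real continuous_intros signals_cont tower_in)
  have "complex_of_real (integral {0..T} (\<lambda>t. (cmod (poly_act (rev_poly n p) z t))\<^sup>2)) =
     integral {0..T} (\<lambda>t. complex_of_real ((cmod (poly_act (rev_poly n p) z t))\<^sup>2))"
    using integral_linear[OF signals_norm2_integrable[OF poly_act_in[OF z]] bounded_linear_of_real[where 'a = complex]]
    by (simp add: o_def del: of_real_power)
  also have "(\<lambda>t. complex_of_real ((cmod (poly_act (rev_poly n p) z t))\<^sup>2)) =
     (\<lambda>t. \<Sum>j\<le>n. \<Sum>k\<le>n. coeff p j * cnj (coeff p k) * (tower j t * cnj (tower k t)))"
    unfolding complex_norm_square poly_act_rev_poly[OF z] cnj_sum sum_product tower_def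
    by (simp add: ac_simps)
  also have "integral {0..T} \<dots> = (\<Sum>j\<le>n. \<Sum>k\<le>n. coeff p j * cnj (coeff p k) *
      integral {0..T} (\<lambda>t. tower j t * cnj (tower k t)))"
    by (subst integral_sum; (subst integral_sum)?) (auto intro!: integrable_sum integrable_on_mult_right int sum.cong integral_sum)
  also have "\<dots> = (\<Sum>j\<le>n. \<Sum>k\<le>n. coeff p j * coeff (para p) k * gram j k T)"
  proof (intro sum.cong refl)
    fix j k
    have "(-1::complex) ^ k * (-1) ^ k = 1" by (simp flip: power_mult_distrib)
    then show "coeff p j * cnj (coeff p k) * integral {0..T} (\<lambda>t. tower j t * cnj (tower k t)) =
      coeff p j * coeff (para p) k * gram j k T"
      by (simp add: coeff_para gram_def)
  qed
  finally show ?thesis .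
qed

text \<open>With every \<open>gram j k\<close> replaced by its normal form, an energy is linear in
  the coefficients of \<open>p * para p\<close>, up to an error that vanishes for large times;
  \<open>eq\<close> is then applied coefficient by coefficient.\<close>

lemma energy_balance:
  assumes deg: "degree p \<le> n" "degree q \<le> n" "degree r \<le> n"
    and eq: "smult (complex_of_real a) (p * para p) = q * para q + r * para r"
  defines "E \<equiv> \<lambda>p T. integral {0..T} (\<lambda>t. (cmod (poly_act (rev_poly n p) z t))\<^sup>2)"
  shows "((\<lambda>T. a * E p T - E q T - E r T) \<longlongrightarrow> 0) at_top"
proof -
  define x where "x T m = gram (min m n) (m - min m n) T" for T m
  define D where "D p T = (\<Sum>j\<le>n. \<Sum>k\<le>n. coeff p j * coeff (para p) k * (gram j k T - x T (j + k)))" for p T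
  have D0: "(D p \<longlongrightarrow> 0) at_top" for p
  proof -
    have "(D p \<longlongrightarrow> (\<Sum>j\<le>n. \<Sum>k\<le>n. coeff p j * coeff (para p) k * 0)) at_top"
      unfolding D_def x_def by (intro tendsto_sum tendsto_mult tendsto_const gram_antidiagonal) auto
    then show ?thesis by simp
  qed
  have E: "complex_of_real (E p T) = D p T + (\<Sum>m\<le>2*n. coeff (p * para p) m * x T m)"
    if "degree p \<le> n" for p T
    unfolding E_def integral_norm2_tower[OF that] D_def
    using sum_coeff_mult[of p n "para p" "x T"] that
    by (simp add: algebra_simps sum_subtractf)
  have "complex_of_real (a * E p T - E q T - E r T) = a * D p T - D q T - D r T" for T
  proof -
    have "complex_of_real a * (\<Sum>m\<le>2*n. coeff (p * para p) m * x T m) =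
      (\<Sum>m\<le>2*n. coeff (smult (complex_of_real a) (p * para p)) m * x T m)"
      by (simp add: sum_distrib_left mult.assoc)
    also have "\<dots> = (\<Sum>m\<le>2*n. coeff (q * para q) m * x T m) + (\<Sum>m\<le>2*n. coeff (r * para r) m * x T m)"
      unfolding eq by (simp add: sum.distrib distrib_right)
    finally show ?thesis by (simp add: E deg algebra_simps)
  qed
  moreover have "((\<lambda>T. a * D p T - D q T - D r T) \<longlongrightarrow> complex_of_real a * 0 - 0 - 0) at_top"
    by (intro tendsto_intros D0)
  ultimately have "((\<lambda>T. complex_of_real (a * E p T - E q T - E r T)) \<longlongrightarrow> complex_of_real 0) at_top"
    by simp
  then show ?thesis using tendsto_of_real_iff by blast
qed

end

section \<open>Causality and the energy gain\<close>

lemma primitive_vanishes: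
  "(\<And>t. t \<le> T \<Longrightarrow> f t = 0) \<Longrightarrow> t \<le> T \<Longrightarrow> primitive f t = 0"
  unfolding primitive_def by (subst integral_cong[where g = "\<lambda>_. 0"]) auto

lemma primitive_pow_vanishes:
  "(\<And>t. t \<le> T \<Longrightarrow> f t = 0) \<Longrightarrow> t \<le> T \<Longrightarrow> (primitive ^^ k) f t = 0"
  by (induction k arbitrary: t) (auto intro: primitive_vanishes)

lemma lag_vanishes:
  "(\<And>t. t \<le> T \<Longrightarrow> f t = 0) \<Longrightarrow> t \<le> T \<Longrightarrow> lag l f t = 0"
  unfolding lag_def using primitive_vanishes[of T "\<lambda>s. exp (- l * complex_of_real s) * f s" t] by simp

lemma hurwitz_vanishes:
  assumes "hurwitz p" "z \<in> signals" "\<And>t. t \<le> T \<Longrightarrow> poly_act (reflect_poly p) z t = 0" "t \<le> T"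
  shows "z t = 0"
  using assms
proof (induction arbitrary: t rule: hurwitz_induct)
  case (factor l q)
  define y where "y = poly_act (reflect_poly q) z"
  define u where "u = poly_act (reflect_poly ([:-l, 1:] * q)) z"
  have y: "y \<in> signals" "u \<in> signals" using factor by (auto simp: y_def u_def)
  have "l \<noteq> 0" using factor by auto
  then have "poly_act [:1, -l:] y = u"
    using factor by (simp add: reflect_factor poly_act_mult y_def u_def del: mult_pCons_left)
  then have yu: "y = (\<lambda>t. l * lag l u t + u t)" using resolvent y by blast
  have u0: "u t = 0" if "t \<le> T" for t
    using factor.prems(2)[OF that] by (simp add: u_def)
  have "y t = 0" if "t \<le> T" for t
    using u0 lag_vanishes[OF u0 that] that by (simp add: yu)
  then show ?case using factor.IH factor.prems unfolding y_def by blast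
qed auto

text \<open>\<open>y\<close> is the output of q/p for the input \<open>u\<close>. The strict gain
  makes \<gamma>^2 |p|^2 - |q|^2 positive on the axis, hence a spectral factor r exists, and the
  difference of the two energies is asymptotically the energy of the output of r/p.\<close>

lemma gain_bound:
  assumes p: "hurwitz p" and deg: "degree q \<le> degree p"
    and gain: "\<And>x::real. cmod (poly q (\<i> * x)) < \<gamma> * cmod (poly p (\<i> * x))"
    and z: "z \<in> signals" and T: "T \<ge> 0"
  defines "u \<equiv> poly_act (reflect_poly p) z" and "y \<equiv> poly_act (rev_poly (degree p) q) z"
  shows "energy y 0 T \<le> \<gamma>\<^sup>2 * energy u 0 T"
proof -
  define n where "n = degree p"
  have u: "u \<in> signals" using z by (auto simp: u_def)
  have "0 < \<gamma> * cmod (poly p (\<i> * complex_of_real 0))"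
    using gain[of 0] norm_ge_zero by (rule le_less_trans[rotated])
  then have \<gamma>: "\<gamma> > 0" by (simp add: zero_less_mult_iff)
  define F where "F = smult (complex_of_real (\<gamma>\<^sup>2)) (p * para p) - q * para q"
  have F: "poly F (\<i> * x) = complex_of_real (\<gamma>\<^sup>2 * (cmod (poly p (\<i> * x)))\<^sup>2 - (cmod (poly q (\<i> * x)))\<^sup>2)" for x :: real
    unfolding F_def of_real_diff of_real_mult complex_norm_square
    by (simp add: poly_para)
  have "para F = F"
    unfolding poly_eq_poly_eq_iff[symmetric]
    by (simp add: fun_eq_iff poly_para F_def mult.commute)
  moreover have "Re (poly F (\<i> * complex_of_real x)) > 0" for x
  proof -
    have "(cmod (poly q (\<i> * x)))\<^sup>2 < (\<gamma> * cmod (poly p (\<i> * x)))\<^sup>2"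
      by (rule power_strict_mono[OF gain]) auto
    then show ?thesis unfolding F by (simp add: power_mult_distrib)
  qed
  ultimately obtain r where r: "F = r * para r" "degree F = 2 * degree r"
    using spectral_factorization by blast
  have "degree F \<le> 2 * n"
    unfolding F_def
    by (intro degree_diff_le order.trans[OF degree_smult_le] order.trans[OF degree_mult_le])
      (use deg in \<open>auto simp: n_def\<close>)
  then have degr: "degree r \<le> n" using r by simp
  have eq: "smult (complex_of_real (\<gamma>\<^sup>2)) (p * para p) = q * para q + r * para r"
    using r by (simp add: F_def algebra_simps)

  \<comment> \<open>Ramp the input down to zero shortly after \<open>T\<close>, so that the energy balance applies; by
    causality the output up to \<open>T\<close> is not affected.\<close>
  obtain B where B: "\<And>t. t \<in> {0..T+1} \<Longrightarrow> (cmod (u t))\<^sup>2 \<le> B"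
  proof -
    have "compact ((\<lambda>t. (cmod (u t))\<^sup>2) ` {0..T+1})"
      by (intro compact_continuous_image continuous_intros signals_cont u) auto
    then show ?thesis using that compact_imp_bounded bounded_real
      by (metis (no_types, lifting) abs_le_D1 imageI)
  qed
  have B0: "B \<ge> 0" using B[of 0] T by (intro order.trans[OF zero_le_power2]) auto
  define I where "I = energy u 0 T"
  have main: "energy y 0 T \<le> \<gamma>\<^sup>2 * (I + e * B)" if e: "0 < e" "e < 1" for e
  proof -
    define cut where "cut t = max 0 (min 1 ((T + e - t) / e))" for t :: real
    have cut: "cut t = 1" if "t \<le> T" for t
      using that e by (simp add: cut_def pos_le_divide_eq min_def)
    have cut0: "cut t = 0" if "t \<ge> T + e" for t
    proof -
      have "(T + e - t) / e \<le> 0" using that e by (intro divide_nonpos_pos) auto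
      then show ?thesis by (simp add: cut_def)
    qed
    have cutb: "0 \<le> cut t" "cut t \<le> 1" for t by (auto simp: cut_def)
    define u' where "u' = (\<lambda>t. complex_of_real (cut t) * u t)"
    have cont: "continuous_on UNIV cut" unfolding cut_def using e by (intro continuous_intros) auto
    have u': "u' \<in> signals"
    proof (rule signalsI)
      show "continuous_on UNIV u'"
        unfolding u'_def by (intro continuous_intros cont signals_cont u)
      fix t :: real assume "t < 0"
      then show "u' t = u' 0" using T signals_neg[OF u, of t] by (simp add: u'_def cut)
    qed
    have bound: "energy u' 0 S \<le> I + e * B" for S
    proof -
      have "energy u' 0 S \<le> energy u' 0 (max S (T + e))"
        by (intro integral_subset_le signals_norm2_integrable u') auto
      also have "\<dots> = energy u' 0 T + energy u' T (T+e)
          + energy u' (T+e) (max S (T + e))"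
        using T e integral_combine[of 0 T "T + e" "\<lambda>t. (cmod (u' t))\<^sup>2"]
          integral_combine[of 0 "T + e" "max S (T + e)" "\<lambda>t. (cmod (u' t))\<^sup>2"]
        by (simp add: signals_norm2_integrable u')
      also have "energy u' (T+e) (max S (T + e)) = 0"
        by (subst integral_cong[where g = "\<lambda>_. 0"]) (auto simp: u'_def cut0)
      also have "energy u' 0 T = I"
        unfolding I_def by (rule integral_cong) (simp add: u'_def cut)
      also have "energy u' T (T+e) \<le> integral {T..T+e} (\<lambda>t. B)"
      proof (rule integral_le)
        fix t assume t: "t \<in> {T..T+e}"
        have "(cmod (u' t))\<^sup>2 = (cut t)\<^sup>2 * (cmod (u t))\<^sup>2"
          by (simp add: u'_def norm_mult power_mult_distrib)
        also have "\<dots> \<le> 1 * (cmod (u t))\<^sup>2"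
          using cutb[of t] by (intro mult_right_mono power_le_one) auto
        also have "\<dots> \<le> B" using B[of t] t T e by simp
        finally show "(cmod (u' t))\<^sup>2 \<le> B" .
      qed (auto intro: signals_norm2_integrable u')
      also have "integral {T..T+e} (\<lambda>t. B) = e * B" using e by simp
      finally show ?thesis by simp
    qed
    have "stable u'"
      unfolding stable_def
    proof
      show "square_integrable u'" by (rule square_integrableI[OF bound])
      show "(u' \<longlongrightarrow> 0) at_top"
        by (rule tendsto_eventually)
          (auto simp: u'_def cut0 intro!: eventually_mono[OF eventually_ge_at_top[of "T + e"]])
    qed
    obtain z' where z': "z' \<in> signals" "poly_act (reflect_poly p) z' = u'"
      using hurwitz_solve[OF p u'] by auto
    have st: "stable ((primitive ^^ j) z')" if "j \<le> n" for j
      using hurwitz_response[OF p z'(1)] \<open>stable u'\<close> that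
      by (cases j) (auto simp: z' stable_def n_def simp del: funpow.simps(2))
    define y' where "y' = poly_act (rev_poly n q) z'"
    have y': "y' \<in> signals" using z' by (auto simp: y'_def)
    have "y t = y' t" if t: "t \<le> T" for t
    proof -
      define w where "w = (\<lambda>t. z t - z' t)"
      have w: "w \<in> signals" unfolding w_def by (intro signals_diff z z')
      have "w t = 0" if "t \<le> T" for t
        by (rule hurwitz_vanishes[OF p w _ that])
          (simp add: w_def poly_act_diff_right z z' u'_def cut flip: u_def)
      then have "poly_act (rev_poly n q) w t = 0"
        using t by (simp add: poly_act_rev_poly w primitive_pow_vanishes[of T])
      then show ?thesis
        by (simp add: w_def poly_act_diff_right z z' y_def y'_def n_def)
    qed
    then have yy: "energy y 0 T = energy y' 0 T"
      by (intro integral_cong) simp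
    define E where "E p T = integral {0..T} (\<lambda>t. (cmod (poly_act (rev_poly n p) z' t))\<^sup>2)" for p T
    have "((\<lambda>S. \<gamma>\<^sup>2 * E p S - E q S - E r S) \<longlongrightarrow> 0) at_top"
      unfolding E_def
      by (rule energy_balance[OF z'(1) st _ _ _ eq]) (use deg degr in \<open>auto simp: n_def\<close>)
    moreover have "\<gamma>\<^sup>2 * E p S - E q S - E r S \<le> \<gamma>\<^sup>2 * (I + e * B) - energy y 0 T"
      if "S \<ge> T" for S
    proof -
      have "E p S \<le> I + e * B" using bound[of S] by (simp add: E_def n_def rev_poly_degree z')
      moreover have "E r S \<ge> 0"
        unfolding E_def by (intro integral_nonneg signals_norm2_integrable poly_act_in z') auto
      moreover have "E q S \<ge> energy y 0 T"
        unfolding yy E_def y'_def using that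
        by (intro integral_subset_le signals_norm2_integrable poly_act_in z') auto
      moreover have "\<gamma>\<^sup>2 * E p S \<le> \<gamma>\<^sup>2 * (I + e * B)"
        using calculation(1) by (rule mult_left_mono) simp
      ultimately show ?thesis by linarith
    qed
    then have "\<forall>\<^sub>F S in at_top. \<gamma>\<^sup>2 * E p S - E q S - E r S \<le> \<gamma>\<^sup>2 * (I + e * B) - energy y 0 T"
      by (intro eventually_mono[OF eventually_ge_at_top[of T]])
    ultimately have "0 \<le> \<gamma>\<^sup>2 * (I + e * B) - energy y 0 T"
      by (rule tendsto_upperbound) simp
    then show ?thesis by simp
  qed
  \<comment> \<open>Letting the length of the ramp tend to 0 removes its extra energy, which is at
    most \<open>e * B\<close>.\<close>
  have "((\<lambda>e. \<gamma>\<^sup>2 * (I + e * B)) \<longlongrightarrow> \<gamma>\<^sup>2 * (I + 0 * B)) (at_right 0)"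
    by (intro tendsto_intros)
  moreover have "\<forall>\<^sub>F e in at_right 0. energy y 0 T \<le> \<gamma>\<^sup>2 * (I + e * B)"
    unfolding eventually_at_right_field using main by (auto intro!: exI[of _ 1])
  ultimately have "energy y 0 T \<le> \<gamma>\<^sup>2 * (I + 0 * B)"
    by (rule tendsto_lowerbound) simp
  then show ?thesis by (simp add: I_def)
qed

section \<open>The limit of infinite frequency and the small-gain argument\<close>

lemma poly_imaginary_asymptotics:
  assumes "degree p \<le> N"
  shows "((\<lambda>x. poly p (\<i> * complex_of_real x) / complex_of_real (x ^ N)) \<longlongrightarrow> coeff p N * \<i> ^ N) at_top"
proof -
  have lim: "((\<lambda>x. x ^ k / x ^ N) \<longlongrightarrow> (if k = N then 1 else 0 :: real)) at_top" if "k \<le> N" for k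
  proof (cases "k = N")
    case True
    then show ?thesis
      by (intro tendsto_eventually eventually_mono[OF eventually_gt_at_top[of 0]]) auto
  next
    case False
    then have "N - k > 0" using that by simp
    then have "filterlim (\<lambda>x::real. x ^ (N - k)) at_top at_top"
      by (intro filterlim_pow_at_top filterlim_ident)
    from tendsto_inverse_0_at_top[OF this]
    have "((\<lambda>x. x ^ k / x ^ N) \<longlongrightarrow> (0::real)) at_top"
    proof (rule Lim_transform_eventually)
      show "\<forall>\<^sub>F x in at_top. inverse (x ^ (N - k)) = x ^ k / (x::real) ^ N"
        using eventually_gt_at_top[of 0]
        by eventually_elim (use that in \<open>simp add: power_diff field_simps\<close>)
    qed
    then show ?thesis using False by simp
  qed
  have expand: "poly p s = (\<Sum>k\<le>N. coeff p k * s ^ k)" for s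
    using arg_cong[OF poly_as_sum_of_monoms'[OF assms], of "\<lambda>p. poly p s"]
    by (simp add: poly_sum poly_monom)
  have "((\<lambda>x. \<Sum>k\<le>N. coeff p k * \<i> ^ k * complex_of_real (x ^ k / x ^ N)) \<longlongrightarrow>
      (\<Sum>k\<le>N. coeff p k * \<i> ^ k * complex_of_real (if k = N then 1 else 0))) at_top"
    by (intro tendsto_sum tendsto_mult tendsto_const tendsto_of_real lim) auto
  also have "(\<Sum>k\<le>N. coeff p k * \<i> ^ k * complex_of_real (if k = N then 1 else 0)) =
      (\<Sum>k\<le>N. if k = N then coeff p k * \<i> ^ k else 0)"
    by (intro sum.cong) auto
  also have "\<dots> = coeff p N * \<i> ^ N" by simp
  also have "(\<lambda>x. \<Sum>k\<le>N. coeff p k * \<i> ^ k * complex_of_real (x ^ k / x ^ N)) =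
      (\<lambda>x. poly p (\<i> * complex_of_real x) / complex_of_real (x ^ N))"
    unfolding expand sum_divide_distrib
    by (simp add: power_mult_distrib ac_simps)
  finally show ?thesis .
qed

text \<open>Dividing by x^N and letting the frequency x grow leaves only the coefficients at N,
  either of which may be 0.\<close>

lemma leading_coeff_gain:
  assumes "\<And>x::real. cmod (poly q (\<i> * x)) \<le> \<gamma> * cmod (poly p (\<i> * x))"
    and "degree p \<le> N" "degree q \<le> N"
  shows "cmod (coeff q N) \<le> \<gamma> * cmod (coeff p N)"
proof -
  have "cmod (coeff q N * \<i> ^ N) \<le> \<gamma> * cmod (coeff p N * \<i> ^ N)"
  proof (rule tendsto_le[OF trivial_limit_at_top_linorder])
    show "((\<lambda>x. \<gamma> * cmod (poly p (\<i> * complex_of_real x) / complex_of_real (x ^ N))) \<longlongrightarrow>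
        \<gamma> * cmod (coeff p N * \<i> ^ N)) at_top"
      by (intro tendsto_intros poly_imaginary_asymptotics assms)
    show "((\<lambda>x. cmod (poly q (\<i> * complex_of_real x) / complex_of_real (x ^ N))) \<longlongrightarrow>
        cmod (coeff q N * \<i> ^ N)) at_top"
      by (intro tendsto_intros poly_imaginary_asymptotics assms)
    show "\<forall>\<^sub>F x in at_top. cmod (poly q (\<i> * complex_of_real x) / complex_of_real (x ^ N))
        \<le> \<gamma> * cmod (poly p (\<i> * complex_of_real x) / complex_of_real (x ^ N))"
      using assms(1) by (auto simp: norm_divide intro!: always_eventually divide_right_mono)
  qed
  then show ?thesis by (simp add: norm_mult norm_power)
qed

text \<open>Otherwise \<open>q\<close> would outgrow \<open>p\<close> along the axis. This is
  properness of q/p.\<close>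

lemma degree_le_of_gain:
  assumes "\<And>x::real. cmod (poly q (\<i> * x)) \<le> \<gamma> * cmod (poly p (\<i> * x))"
  shows "degree q \<le> degree p"
proof (rule ccontr)
  assume "\<not> ?thesis"
  then have "degree p < degree q" by simp
  then have "cmod (coeff q (degree q)) \<le> \<gamma> * cmod (coeff p (degree q))" "coeff p (degree q) = 0"
    using leading_coeff_gain[OF assms, of "degree q"] by (auto intro: coeff_eq_0)
  then have "q = 0" by simp
  then show False using \<open>degree p < degree q\<close> by simp
qed

text \<open>\<open>eq\<close> is p(D) \<delta> = q(D) u after K integrations, with \<open>a\<close>
  holding the initial data. Up to a transient, \<delta> is the output of q/p. The condition \<gamma>
  \<sigma> < 1 is used twice: on energies, and then pointwise on the direct feedthrough.\<close>

theorem small_gain: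
  assumes p: "hurwitz p"
    and gain: "\<And>x::real. cmod (poly q (\<i> * x)) < \<gamma> * cmod (poly p (\<i> * x))"
    and \<delta>: "\<delta> \<in> signals" and u: "u \<in> signals"
    and le: "\<And>t. cmod (u t) \<le> \<sigma> * cmod (\<delta> t)" and \<sigma>: "\<sigma> \<ge> 0" "\<gamma> * \<sigma> < 1"
    and eq: "poly_act (rev_poly K p) \<delta> = (\<lambda>t. poly_act (rev_poly K q) u t + poly_act a (\<lambda>t. 1) t)"
    and a: "\<And>k. k \<ge> K \<Longrightarrow> coeff a k = 0" and K: "degree p \<le> K"
  shows "(\<delta> \<longlongrightarrow> 0) at_top"
proof -
  define n where "n = degree p"
  have deg: "degree q \<le> n" unfolding n_def
    using degree_le_of_gain[of q \<gamma> p] gain by (simp add: less_imp_le)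
  have "0 < \<gamma> * cmod (poly p (\<i> * complex_of_real 0))"
    using gain[of 0] norm_ge_zero by (rule le_less_trans[rotated])
  then have \<gamma>: "\<gamma> > 0" by (simp add: zero_less_mult_iff)
  obtain z where z: "z \<in> signals" "poly_act (reflect_poly p) z = u"
    using hurwitz_solve[OF p u] by auto
  define y where "y = poly_act (rev_poly n q) z"
  define w where "w = (\<lambda>t. \<delta> t - y t)"
  have y: "y \<in> signals" and w: "w \<in> signals" using z \<delta> by (auto simp: y_def w_def intro: signals_diff)
  have "stable w"
  proof -
    have "poly_act (rev_poly K p) y = poly_act (rev_poly K q) u"
    proof -
      have "poly_act (rev_poly K p) y = poly_act (rev_poly K p * rev_poly n q) z"
        unfolding y_def by (simp add: poly_act_mult z)
      also have "rev_poly K p * rev_poly n q = rev_poly K q * reflect_poly p"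
        using rev_poly_shift[of p n K] rev_poly_shift[of q n K] K deg
        by (simp add: n_def rev_poly_degree ac_simps)
      also have "poly_act (\<dots>) z = poly_act (rev_poly K q) u"
        by (simp add: poly_act_mult z)
      finally show ?thesis .
    qed
    then have "poly_act (rev_poly K p) w = poly_act a (\<lambda>t. 1)"
      unfolding w_def using \<delta> y by (simp add: poly_act_diff_right eq)
    moreover have "rev_poly K p = monom 1 (K - n) * reflect_poly p"
      using rev_poly_shift[of p n K] K by (simp add: n_def rev_poly_degree)
    \<comment> \<open>Cancelling the K - n surplus integrations lowers the degree bound of the
      forcing from K to n, as \<open>hurwitz_polynomial_forcing\<close> requires.\<close>
    ultimately have "(primitive ^^ (K - n)) (poly_act (reflect_poly p) w) = poly_act a (\<lambda>t. 1)"
      by (simp add: poly_act_mult w poly_act_monom)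
    moreover have "coeff a k = 0" if "k \<ge> K - n + n" for k
      using that K a by (simp add: n_def)
    ultimately obtain b where "poly_act (reflect_poly p) w = poly_act b (\<lambda>t. 1)" "\<forall>k\<ge>n. coeff b k = 0"
      using primitive_pow_cancel[OF poly_act_in[OF w]] by blast
    then show ?thesis using hurwitz_polynomial_forcing[OF p w] by (auto simp: n_def)
  qed
  then obtain M where M: "M \<ge> 0" "\<And>T. energy w 0 T \<le> M"
    using square_integrableD unfolding stable_def by metis
  have dyw: "\<delta> t = y t + w t" for t by (simp add: w_def)

  define \<kappa> where "\<kappa> = (\<gamma> * \<sigma>)\<^sup>2"
  have \<kappa>: "0 \<le> \<kappa>" "\<kappa> < 1"
    using \<sigma> \<gamma> by (auto simp: \<kappa>_def power_less_one_iff)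
  \<comment> \<open>The weight for splitting |y + w|^2: it gives (1 + e) \<kappa> <= \<kappa> + e =
    (1 + \<kappa>) / 2 < 1.\<close>
  define e where "e = (1 - \<kappa>) / 2"
  have e: "e > 0" using \<kappa> by (simp add: e_def)
  define \<theta> where "\<theta> = (1 + e) * \<kappa>"
  have \<theta>: "\<theta> < 1"
  proof -
    have "e * \<kappa> \<le> e * 1" using e \<kappa> by (intro mult_left_mono) auto
    then have "\<theta> \<le> \<kappa> + e" by (simp add: \<theta>_def algebra_simps)
    moreover have "\<kappa> + e < 1" using \<kappa> by (simp add: e_def field_simps)
    ultimately show ?thesis by simp
  qed
  have sq\<delta>: "square_integrable \<delta>"
  proof (rule square_integrableI)
    fix T :: real assume T: "T > 0"
    define I where "I f = energy f 0 T" for f :: "real \<Rightarrow> complex"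
    have "I \<delta> \<le> integral {0..T} (\<lambda>t. (1 + e) * (cmod (y t))\<^sup>2 + (1 + 1 / e) * (cmod (w t))\<^sup>2)"
      unfolding I_def
      by (intro integral_le integrable_add integrable_on_mult_right signals_norm2_integrable \<delta> y w)
        (unfold dyw, rule cmod_add_squared_weighted[OF e])
    also have "\<dots> = (1 + e) * I y + (1 + 1 / e) * I w"
      unfolding I_def
      by (subst integral_add) (auto intro!: integrable_on_mult_right signals_norm2_integrable y w)
    finally have "I \<delta> \<le> (1 + e) * I y + (1 + 1 / e) * I w" .
    moreover have "I y \<le> \<gamma>\<^sup>2 * I u"
      using gain_bound[OF p deg[unfolded n_def] gain z(1), of T] T by (simp add: I_def y_def n_def z)
    moreover have "I u \<le> \<sigma>\<^sup>2 * I \<delta>"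
    proof -
      have "I u \<le> integral {0..T} (\<lambda>t. \<sigma>\<^sup>2 * (cmod (\<delta> t))\<^sup>2)"
        unfolding I_def
        by (intro integral_le integrable_on_mult_right signals_norm2_integrable \<delta> u)
          (use power_mono[OF le norm_ge_zero] in \<open>auto simp: power_mult_distrib\<close>)
      then show ?thesis by (simp add: I_def)
    qed
    then have "\<gamma>\<^sup>2 * I u \<le> \<gamma>\<^sup>2 * (\<sigma>\<^sup>2 * I \<delta>)" by (rule mult_left_mono) simp
    ultimately have "I y \<le> \<kappa> * I \<delta>" by (simp add: \<kappa>_def power_mult_distrib)
    then have "(1 + e) * I y \<le> (1 + e) * (\<kappa> * I \<delta>)" using e by (intro mult_left_mono) auto
    moreover have "(1 + 1 / e) * I w \<le> (1 + 1 / e) * M"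
      using M e by (intro mult_left_mono) (auto simp: I_def)
    ultimately have "I \<delta> \<le> \<theta> * I \<delta> + (1 + 1 / e) * M"
      using \<open>I \<delta> \<le> (1 + e) * I y + (1 + 1 / e) * I w\<close> unfolding \<theta>_def by (simp add: mult.assoc)
    \<comment> \<open>\<open>I \<delta>\<close> is an energy on a bounded interval and thus finite,
      so it may be moved to the left before anything is known for all times.\<close>
    then have "I \<delta> * (1 - \<theta>) \<le> (1 + 1 / e) * M" by (simp add: algebra_simps)
    then show "energy \<delta> 0 T \<le> (1 + 1 / e) * M / (1 - \<theta>)"
      using \<theta> by (simp add: I_def pos_le_divide_eq)
  qed
  have squ: "square_integrable u"
    by (rule square_integrable_le[OF \<delta> sq\<delta> sq\<delta> \<delta> u, where a = "\<sigma>\<^sup>2" and b = 0])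
      (use power_mono[OF le norm_ge_zero] in \<open>auto simp: power_mult_distrib\<close>)
  have lower: "((primitive ^^ j) z \<longlongrightarrow> 0) at_top" if "j \<in> {1..n}" for j
    using hurwitz_response[OF p z(1)] squ that by (auto simp: z n_def stable_def)
  \<comment> \<open>All terms except the one without integration, which carries the feedthrough.
    They tend to 0 because \<open>u\<close> is square integrable.\<close>
  define tail where "tail r t = (\<Sum>k<n. coeff r k * (primitive ^^ (n - k)) z t)" for r t
  have tail: "(tail r \<longlongrightarrow> 0) at_top" for r
  proof -
    have "((\<lambda>t. \<Sum>k<n. coeff r k * (primitive ^^ (n - k)) z t) \<longlongrightarrow> (\<Sum>k<n. coeff r k * 0)) at_top"
      by (intro tendsto_sum tendsto_mult tendsto_const lower) auto
    then show ?thesis by (simp add: tail_def[abs_def])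
  qed
  have split: "poly_act (rev_poly n r) z t = coeff r n * z t + tail r t" for r t
    unfolding poly_act_rev_poly[OF z(1)] tail_def by (simp add: lessThan_Suc_atMost[symmetric])
  have pn: "coeff p n \<noteq> 0" using p by (auto simp: n_def hurwitz_def)
  \<comment> \<open>The direct feedthrough, i.e. the limit of q/p at infinite frequency; hence its
    modulus is at most \<gamma>.\<close>
  define c where "c = coeff q n / coeff p n"
  have c: "cmod c \<le> \<gamma>"
    using leading_coeff_gain[of q \<gamma> p n] gain deg pn
    by (simp add: c_def norm_divide pos_divide_le_eq less_imp_le n_def)
  define s where "s t = tail q t - c * tail p t + w t" for t
  have "(s \<longlongrightarrow> 0 - c * 0 + 0) at_top"
    unfolding s_def using \<open>stable w\<close> by (intro tendsto_intros tail) (simp add: stable_def)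
  then have s: "(s \<longlongrightarrow> 0) at_top" by simp
  \<comment> \<open>Closing the loop pointwise: \<delta> = c u + s with |c u| <= \<gamma> \<sigma>
    |\<delta>|.\<close>
  have "cmod (\<delta> t) \<le> cmod (s t) / (1 - \<gamma> * \<sigma>)" for t
  proof -
    have "u t = coeff p n * z t + tail p t"
      using split[of p t] by (simp add: n_def rev_poly_degree z)
    then have "\<delta> t = c * u t + s t"
      using split[of q t] pn by (simp add: dyw y_def s_def c_def field_simps)
    then have "cmod (\<delta> t) \<le> cmod c * cmod (u t) + cmod (s t)"
      by (metis norm_mult norm_triangle_ineq)
    also have "\<dots> \<le> \<gamma> * (\<sigma> * cmod (\<delta> t)) + cmod (s t)"
      using c le[of t] \<gamma> by (intro add_mono mult_mono) auto
    finally have "cmod (\<delta> t) * (1 - \<gamma> * \<sigma>) \<le> cmod (s t)" by (simp add: algebra_simps)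
    then show ?thesis using \<sigma> by (simp add: pos_le_divide_eq)
  qed
  then have "\<forall>\<^sub>F t in at_top. cmod (\<delta> t) \<le> cmod (s t) / (1 - \<gamma> * \<sigma>)"
    by (simp add: always_eventually)
  then show ?thesis
    by (rule Lim_null_comparison) (rule tendsto_divide_zero[OF tendsto_norm_zero[OF s]])
qed

section \<open>Node equations of a network\<close>

fun node_value :: "(nat \<Rightarrow> 'a::zero) \<Rightarrow> rlc_node \<Rightarrow> 'a" where
  "node_value E Ground = 0"
| "node_value E (Vertex m) = E m"

text \<open>Polymorphic, as drops are taken of rational functions, polynomials, their coefficients
  and their values.\<close>

definition branch_drop :: "(nat \<Rightarrow> 'a::ab_group_add) \<Rightarrow> rlc_node \<times> rlc_node \<times> rlc_element \<Rightarrow> 'a" where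
  "branch_drop E br = node_value E (fst br) - node_value E (fst (snd br))"

definition branch_sign :: "rlc_node \<times> rlc_node \<times> rlc_element \<Rightarrow> nat \<Rightarrow> 'a::comm_ring_1" where
  "branch_sign br m = of_bool (fst br = Vertex m) - of_bool (fst (snd br) = Vertex m)"

abbreviation branch_element :: "rlc_network \<Rightarrow> nat \<Rightarrow> rlc_element" where
  "branch_element net k \<equiv> snd (snd (branches net ! k))"

abbreviation n_branches :: "rlc_network \<Rightarrow> nat" where
  "n_branches net \<equiv> length (branches net)"

lemma passive_branch:
  assumes "passive_network net" "k < n_branches net"
  shows "fst (branches net ! k) \<in> node_set net" "fst (snd (branches net ! k)) \<in> node_set net"
    "fst (branches net ! k) \<noteq> fst (snd (branches net ! k))" "passive_element (branch_element net k)"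
  using assms nth_mem[OF assms(2)] unfolding passive_network_def by fastforce+

lemma node_value_sum:
  fixes E :: "nat \<Rightarrow> 'a::comm_ring_1"
  assumes "a \<in> node_set net"
  shows "node_value E a = (\<Sum>m<n_nodes net. of_bool (a = Vertex m) * E m)"
proof (cases a)
  case (Vertex i)
  then have "i < n_nodes net" using assms by (auto simp: node_set_def)
  moreover have "(\<Sum>m<n_nodes net. of_bool (a = Vertex m) * E m) = (\<Sum>m<n_nodes net. if m = i then E m else 0)"
    by (intro sum.cong) (auto simp: Vertex)
  ultimately show ?thesis by (simp add: Vertex)
qed simp

lemma branch_drop_sum:
  fixes E :: "nat \<Rightarrow> 'a::comm_ring_1"
  assumes "passive_network net" "k < n_branches net"
  shows "branch_drop E (branches net ! k) = (\<Sum>m<n_nodes net. branch_sign (branches net ! k) m * E m)"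
  unfolding branch_drop_def branch_sign_def left_diff_distrib sum_subtractf
  by (intro arg_cong2[where f = minus] node_value_sum passive_branch assms)

text \<open>Drops are the transposed incidence matrix applied to the potentials. No element law
  enters, so \<open>E\<close> and \<open>J\<close> may come from different solutions, one from a
  trajectory and one from a response.\<close>

lemma tellegen:
  fixes E J :: "nat \<Rightarrow> 'a::comm_ring_1"
  assumes "passive_network net"
  shows "(\<Sum>k<n_branches net. branch_drop E (branches net ! k) * J k) =
    (\<Sum>m<n_nodes net. E m * (\<Sum>k<n_branches net. branch_sign (branches net ! k) m * J k))"
proof -
  have "(\<Sum>k<n_branches net. branch_drop E (branches net ! k) * J k) =
      (\<Sum>k<n_branches net. \<Sum>m<n_nodes net. branch_sign (branches net ! k) m * E m * J k)"
    by (intro sum.cong) (auto simp: branch_drop_sum assms sum_distrib_right)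
  also have "\<dots> = (\<Sum>m<n_nodes net. E m * (\<Sum>k<n_branches net. branch_sign (branches net ! k) m * J k))"
    by (subst sum.swap) (simp add: sum_distrib_left mult_ac)
  finally show ?thesis .
qed

lemma sum_nodes_boundary:
  fixes f :: "nat \<Rightarrow> 'a::comm_monoid_add"
  shows "(\<Sum>m<n_nodes net. if m < n_boundary net then f m else 0) = (\<Sum>m<n_boundary net. f m)"
proof -
  have "(\<Sum>m<n_nodes net. if m < n_boundary net then f m else 0) =
      (\<Sum>m<n_nodes net. if m \<in> {..<n_boundary net} then f m else 0)"
    by simp
  also have "\<dots> = (\<Sum>m\<in>{..<n_nodes net} \<inter> {..<n_boundary net}. f m)"
    by (rule sum.inter_restrict[symmetric]) simp
  also have "{..<n_nodes net} \<inter> {..<n_boundary net} = {..<n_boundary net}"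
    by (auto simp: n_nodes_def)
  finally show ?thesis .
qed

lemma branch_admittance_sum:
  "branch_admittance net a b = (\<Sum>k<n_branches net.
    if {fst (branches net ! k), fst (snd (branches net ! k))} = {a, b} then element_admittance (branch_element net k) else 0)"
  unfolding branch_admittance_def sum_list_sum_nth
  by (auto simp: atLeast0LessThan case_prod_beta intro!: sum.cong)

lemma branch_admittance_commute: "branch_admittance net a b = branch_admittance net b a"
  unfolding branch_admittance_def by (simp add: insert_commute)

text \<open>The nodal matrix is incidence times branch admittances times transposed incidence. The
  proof regroups the neighbours of \<open>m\<close>, ground included, by branches.\<close>

lemma admittance_matrix_row:
  assumes net: "passive_network net" and m: "m < n_nodes net"
  shows "(\<Sum>l<n_nodes net. admittance_matrix net $$ (m, l) * E l) =
    (\<Sum>k<n_branches net. branch_sign (branches net ! k) m *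
      (element_admittance (branch_element net k) * branch_drop E (branches net ! k)))"
proof -
  let ?B = "branch_admittance net (Vertex m)"
  let ?n = "n_nodes net"
  have "(\<Sum>l<?n. admittance_matrix net $$ (m, l) * E l) =
      admittance_matrix net $$ (m, m) * E m + (\<Sum>l\<in>{..<?n} - {m}. admittance_matrix net $$ (m, l) * E l)"
    using m by (simp add: sum.remove)
  also have "(\<Sum>l\<in>{..<?n} - {m}. admittance_matrix net $$ (m, l) * E l) = - (\<Sum>l\<in>{..<?n} - {m}. ?B (Vertex l) * E l)"
    unfolding sum_negf[symmetric] by (intro sum.cong) (use m in \<open>auto simp: admittance_matrix_def\<close>)
  also have "admittance_matrix net $$ (m, m) = ?B Ground + (\<Sum>l\<in>{..<?n} - {m}. ?B (Vertex l))"
    using m by (simp add: admittance_matrix_def)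
  also have "(?B Ground + (\<Sum>l\<in>{..<?n} - {m}. ?B (Vertex l))) * E m + - (\<Sum>l\<in>{..<?n} - {m}. ?B (Vertex l) * E l) =
      ?B Ground * (E m - node_value E Ground) + (\<Sum>l\<in>{..<?n} - {m}. ?B (Vertex l) * (E m - node_value E (Vertex l)))"
    by (simp add: algebra_simps sum_distrib_left sum_subtractf)
  also have "\<dots> = (\<Sum>a\<in>insert Ground (Vertex ` ({..<?n} - {m})). ?B a * (E m - node_value E a))"
    by (subst sum.insert) (auto simp: sum.reindex inj_on_def)
  also have "insert Ground (Vertex ` ({..<?n} - {m})) = node_set net - {Vertex m}"
    by (auto simp: node_set_def)
  also have "(\<Sum>a\<in>node_set net - {Vertex m}. ?B a * (E m - node_value E a)) =
     (\<Sum>k<n_branches net. \<Sum>a\<in>node_set net - {Vertex m}.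
       (if {fst (branches net ! k), fst (snd (branches net ! k))} = {Vertex m, a}
        then element_admittance (branch_element net k) else 0) * (E m - node_value E a))"
    unfolding branch_admittance_sum sum_distrib_right by (rule sum.swap)
  also have "\<dots> = (\<Sum>k<n_branches net. branch_sign (branches net ! k) m *
      (element_admittance (branch_element net k) * branch_drop E (branches net ! k)))"
  proof (intro sum.cong refl)
    fix k assume "k \<in> {..<n_branches net}"
    then have k: "k < n_branches net" by simp
    obtain p q x where br: "branches net ! k = (p, q, x)" using prod_cases3 by blast
    have pq: "p \<in> node_set net" "q \<in> node_set net" "p \<noteq> q"
      using passive_branch[OF net k] br by auto
    have fin: "finite (node_set net)" by (simp add: node_set_def)
    have one: "(\<Sum>a\<in>node_set net - {Vertex m}. (if {p, q} = {Vertex m, a} then y else 0) * (E m - node_value E a)) =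
        y * (E m - node_value E b)" if "b \<in> node_set net" "b \<noteq> Vertex m" "{p, q} = {Vertex m, b}" for b y
    proof -
      have "(\<Sum>a\<in>node_set net - {Vertex m}. (if {p, q} = {Vertex m, a} then y else 0) * (E m - node_value E a)) =
          (\<Sum>a\<in>node_set net - {Vertex m}. if a = b then y * (E m - node_value E a) else 0)"
        by (intro sum.cong refl) (use that in \<open>auto simp: doubleton_eq_iff\<close>)
      then show ?thesis using that fin by simp
    qed
    show "(\<Sum>a\<in>node_set net - {Vertex m}.
       (if {fst (branches net ! k), fst (snd (branches net ! k))} = {Vertex m, a}
        then element_admittance (branch_element net k) else 0) * (E m - node_value E a)) =
      branch_sign (branches net ! k) m *
      (element_admittance (branch_element net k) * branch_drop E (branches net ! k))"
    proof (cases "p = Vertex m \<or> q = Vertex m")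
      case True
      then show ?thesis
      proof
        assume p: "p = Vertex m"
        show ?thesis using one[of q "element_admittance x"] pq p
          unfolding br fst_conv snd_conv by (simp add: branch_sign_def branch_drop_def)
      next
        assume q: "q = Vertex m"
        show ?thesis using one[of p "element_admittance x"] pq q
          unfolding br fst_conv snd_conv by (simp add: branch_sign_def branch_drop_def insert_commute algebra_simps)
      qed
    next
      case False
      then show ?thesis
        by (auto simp: br branch_sign_def doubleton_eq_iff intro!: sum.neutral)
    qed
  qed
  finally show ?thesis .
qed

lemma admittance_matrix_sym:
  "m < n_nodes net \<Longrightarrow> l < n_nodes net \<Longrightarrow> admittance_matrix net $$ (m, l) = admittance_matrix net $$ (l, m)"
  by (auto simp: admittance_matrix_def branch_admittance_commute)

section \<open>Elimination of the interior nodes\<close>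

lemma mat_inverse_invertible:
  fixes A :: "'a::field mat"
  assumes "A \<in> carrier_mat n n" "invertible_mat A"
  shows "the (mat_inverse A) \<in> carrier_mat n n" "A * the (mat_inverse A) = 1\<^sub>m n" "the (mat_inverse A) * A = 1\<^sub>m n"
proof -
  obtain B where B: "A * B = 1\<^sub>m n" "B * A = 1\<^sub>m (dim_row B)"
    using assms by (auto simp: invertible_mat_def inverts_mat_def)
  have "dim_row B = n"
    using arg_cong[OF B(2), of dim_col] assms by simp
  moreover have "dim_col B = n"
    using arg_cong[OF B(1), of dim_col] by simp
  ultimately have "B \<in> carrier_mat n n" by auto
  then have "A \<in> Units (ring_mat TYPE('a) n ())"
    using B assms unfolding Units_def ring_mat_def by auto
  then obtain C where "mat_inverse A = Some C"
    using mat_inverse(1)[OF assms(1), of "()"] by (cases "mat_inverse A") auto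
  then show "the (mat_inverse A) \<in> carrier_mat n n" "A * the (mat_inverse A) = 1\<^sub>m n" "the (mat_inverse A) * A = 1\<^sub>m n"
    using mat_inverse(2)[OF assms(1)] by auto
qed

lemma interior_admittance_dim: "interior_admittance net \<in> carrier_mat (n_interior net) (n_interior net)"
  by (auto simp: interior_admittance_def split_block_def admittance_matrix_def n_nodes_def Let_def)

lemma interior_admittance_index:
  "i < n_interior net \<Longrightarrow> j < n_interior net \<Longrightarrow>
    interior_admittance net $$ (i, j) = admittance_matrix net $$ (i + n_boundary net, j + n_boundary net)"
  by (auto simp: interior_admittance_def split_block_def admittance_matrix_def n_nodes_def Let_def)

lemma mult_mat_vec_index:
  assumes "A \<in> carrier_mat r c" "v \<in> carrier_vec c" "i < r"
  shows "(A *\<^sub>v v) $ i = (\<Sum>j<c. A $$ (i, j) * v $ j)"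
  using assms by (auto simp: scalar_prod_def atLeast0LessThan intro!: sum.cong)

lemma sum_nodes_split:
  "(\<Sum>l<n_nodes net. f l) = (\<Sum>l<n_boundary net. f l) + (\<Sum>l<n_interior net. f (l + n_boundary net))"
  for f :: "nat \<Rightarrow> 'a::comm_monoid_add"
  using sum.atLeastLessThan_concat[of 0 "n_boundary net" "n_nodes net" f]
    sum.shift_bounds_nat_ivl[of f 0 "n_boundary net" "n_interior net"]
  by (simp add: n_nodes_def atLeast0LessThan add.commute)

text \<open>The interior potentials -Y_II^-1 Y_NI^T V make the interior rows vanish; inserted into
  the boundary rows they give the Kron-reduced matrix.\<close>

lemma rational_solution:
  fixes V :: "nat \<Rightarrow> transfer_function"
  assumes inv: "invertible_mat (interior_admittance net)"
  shows "\<exists>E. (\<forall>m<n_boundary net. E m = V m) \<and>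
    (\<forall>m<n_nodes net. (\<Sum>l<n_nodes net. admittance_matrix net $$ (m, l) * E l) =
      (if m < n_boundary net then (\<Sum>l<n_boundary net. kron_reduction net $$ (m, l) * V l) else 0))"
proof -
  let ?Y = "admittance_matrix net"
  define nb where "nb = n_boundary net"
  define ni where "ni = n_interior net"
  define A where "A = mat nb nb (\<lambda>(i, j). ?Y $$ (i, j))"
  define B where "B = mat nb ni (\<lambda>(i, j). ?Y $$ (i, j + nb))"
  define D where "D = interior_admittance net"
  define W where "W = the (mat_inverse D)"
  have dims: "A \<in> carrier_mat nb nb" "B \<in> carrier_mat nb ni" "D \<in> carrier_mat ni ni"
    using interior_admittance_dim by (auto simp: A_def B_def D_def ni_def)
  note W = mat_inverse_invertible[OF dims(3) inv[folded D_def], folded W_def]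
  have split: "split_block ?Y nb nb = (A, B, mat ni nb (\<lambda>(i, j). ?Y $$ (i + nb, j)), D)"
  proof -
    have "dim_row ?Y = nb + ni" "dim_col ?Y = nb + ni"
      by (auto simp: admittance_matrix_def n_nodes_def nb_def ni_def)
    then show ?thesis
      unfolding D_def interior_admittance_def by (simp add: split_block_def A_def B_def Let_def nb_def)
  qed
  have kron: "kron_reduction net = A - B * W * transpose_mat B"
    using split by (simp add: kron_reduction_def nb_def W_def)
  define v where "v = vec nb V"
  have v: "v \<in> carrier_vec nb" by (simp add: v_def)
  define e where "e = W *\<^sub>v (transpose_mat B *\<^sub>v v)"
  have Bv: "transpose_mat B *\<^sub>v v \<in> carrier_vec ni" using dims v by auto
  have e: "e \<in> carrier_vec ni" using W Bv by (auto simp: e_def)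
  define E where "E m = (if m < nb then V m else - (e $ (m - nb)))" for m
  have row: "(\<Sum>l<n_nodes net. ?Y $$ (m, l) * E l) =
      (\<Sum>l<nb. ?Y $$ (m, l) * v $ l) - (\<Sum>l<ni. ?Y $$ (m, l + nb) * e $ l)" for m
    unfolding sum_nodes_split nb_def[symmetric] ni_def[symmetric] by (simp add: E_def v_def sum_negf)
  have "(\<Sum>l<n_nodes net. ?Y $$ (m, l) * E l) =
      (if m < nb then (\<Sum>l<nb. kron_reduction net $$ (m, l) * V l) else 0)" if m: "m < n_nodes net" for m
  proof (cases "m < nb")
    case True
    have BW: "B * W \<in> carrier_mat nb ni" using dims W by auto
    have "(kron_reduction net *\<^sub>v v) $ m = (\<Sum>l<nb. kron_reduction net $$ (m, l) * v $ l)"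
    proof (rule mult_mat_vec_index[OF _ v True])
      show "kron_reduction net \<in> carrier_mat nb nb" unfolding kron
        by (intro minus_carrier_mat mult_carrier_mat[OF BW]) (use dims in simp)
    qed
    moreover have "kron_reduction net *\<^sub>v v = A *\<^sub>v v - B *\<^sub>v e"
    proof -
      have "kron_reduction net *\<^sub>v v = A *\<^sub>v v - (B * W * transpose_mat B) *\<^sub>v v"
        unfolding kron by (rule minus_mult_distrib_mat_vec[of _ nb nb]) (use dims BW v in auto)
      also have "(B * W * transpose_mat B) *\<^sub>v v = (B * W) *\<^sub>v (transpose_mat B *\<^sub>v v)"
        by (rule assoc_mult_mat_vec[of _ nb ni _ nb]) (use dims BW v in auto)
      also have "\<dots> = B *\<^sub>v (W *\<^sub>v (transpose_mat B *\<^sub>v v))"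
        by (rule assoc_mult_mat_vec[of _ nb ni _ ni]) (use dims W Bv in auto)
      finally show ?thesis unfolding e_def .
    qed
    moreover have "(A *\<^sub>v v - B *\<^sub>v e) $ m = (A *\<^sub>v v) $ m - (B *\<^sub>v e) $ m"
      using dims True by (intro index_minus_vec(1)) auto
    moreover have "(A *\<^sub>v v) $ m = (\<Sum>l<nb. ?Y $$ (m, l) * v $ l)"
      unfolding mult_mat_vec_index[OF dims(1) v True] by (rule sum.cong) (use True in \<open>auto simp: A_def\<close>)
    moreover have "(B *\<^sub>v e) $ m = (\<Sum>l<ni. ?Y $$ (m, l + nb) * e $ l)"
      unfolding mult_mat_vec_index[OF dims(2) e True] by (rule sum.cong) (use True in \<open>auto simp: B_def\<close>)
    ultimately show ?thesis using True row by (simp add: v_def)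
  next
    case False
    define i where "i = m - nb"
    have i: "m = i + nb" "i < ni" using False m by (auto simp: i_def n_nodes_def nb_def ni_def)
    have "D *\<^sub>v e = (D * W) *\<^sub>v (transpose_mat B *\<^sub>v v)"
      unfolding e_def by (rule assoc_mult_mat_vec[symmetric, of _ ni ni _ ni]) (use dims W Bv in auto)
    also have "\<dots> = transpose_mat B *\<^sub>v v" unfolding W(2) using Bv by simp
    finally have "(D *\<^sub>v e) $ i = (transpose_mat B *\<^sub>v v) $ i" by simp
    moreover have "(D *\<^sub>v e) $ i = (\<Sum>l<ni. ?Y $$ (m, l + nb) * e $ l)"
      unfolding mult_mat_vec_index[OF dims(3) e i(2)]
      by (rule sum.cong) (use i in \<open>auto simp: D_def interior_admittance_index nb_def ni_def\<close>)
    moreover have "(transpose_mat B *\<^sub>v v) $ i = (\<Sum>l<nb. ?Y $$ (m, l) * v $ l)"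
    proof -
      have "transpose_mat B \<in> carrier_mat ni nb" using dims by simp
      from mult_mat_vec_index[OF this v i(2)] show ?thesis
        using i m dims by (auto simp: B_def admittance_matrix_sym[of "i + n_boundary net" net] n_nodes_def nb_def intro!: sum.cong)
    qed
    ultimately show ?thesis using False row by simp
  qed
  then show ?thesis by (intro exI[of _ E]) (auto simp: E_def nb_def)
qed

text \<open>Rules out floating interior parts: without drops no current flows, so the interior
  admittance matrix annihilates the interior potentials.\<close>

lemma interior_injective:
  fixes E :: "nat \<Rightarrow> transfer_function"
  assumes net: "passive_network net" and inv: "invertible_mat (interior_admittance net)"
    and bdry: "\<And>m. m < n_boundary net \<Longrightarrow> E m = 0"
    and drop: "\<And>k. k < n_branches net \<Longrightarrow> branch_drop E (branches net ! k) = 0"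
    and m: "m < n_nodes net"
  shows "E m = 0"
proof (cases "m < n_boundary net")
  case False
  define D where "D = interior_admittance net"
  define ni where "ni = n_interior net"
  define e where "e = vec ni (\<lambda>i. E (i + n_boundary net))"
  have D: "D \<in> carrier_mat ni ni" and e: "e \<in> carrier_vec ni"
    using interior_admittance_dim by (auto simp: D_def ni_def e_def)
  note W = mat_inverse_invertible[OF D inv[folded D_def]]
  have "(D *\<^sub>v e) $ i = 0" if i: "i < ni" for i
  proof -
    have "(\<Sum>l<n_nodes net. admittance_matrix net $$ (i + n_boundary net, l) * E l) = 0"
      by (subst admittance_matrix_row[OF net]) (use i drop in \<open>auto simp: n_nodes_def ni_def\<close>)
    then have "(\<Sum>l<ni. admittance_matrix net $$ (i + n_boundary net, l + n_boundary net) * E (l + n_boundary net)) = 0"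
      unfolding sum_nodes_split ni_def using bdry by simp
    then show ?thesis
      unfolding mult_mat_vec_index[OF D e i] using i
      by (simp add: D_def interior_admittance_index ni_def e_def)
  qed
  then have "D *\<^sub>v e = 0\<^sub>v ni" using D by (intro eq_vecI) auto
  moreover have "the (mat_inverse D) *\<^sub>v (D *\<^sub>v e) = e"
    using W D e by (simp add: assoc_mult_mat_vec[symmetric, of _ ni ni _ ni])
  ultimately have "e = 0\<^sub>v ni" using W(1) by auto
  moreover have "m - n_boundary net < ni" using False m by (auto simp: n_nodes_def ni_def)
  ultimately have "e $ (m - n_boundary net) = 0" by simp
  then show ?thesis using \<open>m - n_boundary net < ni\<close> False by (simp add: e_def)
qed (use bdry in simp)

section \<open>Polynomial network responses\<close>

text \<open>\<open>P\<close> is the voltage and \<open>Q\<close> the current of the element in the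
  Laplace domain, up to a common factor; \<open>pCons 0\<close> multiplies by s. Without divisions
  the law can be evaluated at every s, including 0.\<close>

fun poly_law :: "rlc_element \<Rightarrow> complex poly \<Rightarrow> complex poly \<Rightarrow> bool" where
  "poly_law (Resistor R) P Q \<longleftrightarrow> P = smult (of_real R) Q"
| "poly_law (Inductor L) P Q \<longleftrightarrow> P = pCons 0 (smult (of_real L) Q)"
| "poly_law (Capacitor C) P Q \<longleftrightarrow> Q = pCons 0 (smult (of_real C) P)"

definition poly_solution ::
  "rlc_network \<Rightarrow> (nat \<Rightarrow> complex poly) \<Rightarrow> (nat \<Rightarrow> complex poly) \<Rightarrow> (nat \<Rightarrow> complex poly) \<Rightarrow> bool" where
  "poly_solution net P Q I \<longleftrightarrow>
     (\<forall>k<n_branches net. poly_law (branch_element net k) (branch_drop P (branches net ! k)) (Q k)) \<and>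
     (\<forall>m<n_nodes net. (\<Sum>k<n_branches net. branch_sign (branches net ! k) m * Q k) =
        (if m < n_boundary net then I m else 0))"

lemma common_denominator:
  fixes A :: "'a::idom fract set"
  assumes "finite A"
  shows "\<exists>d. d \<noteq> 0 \<and> (\<forall>x\<in>A. \<exists>p. x * to_fract d = to_fract p)"
  using assms
proof (induction A rule: finite_induct)
  case (insert x A)
  then obtain d where d: "d \<noteq> 0" "\<forall>x\<in>A. \<exists>p. x * to_fract d = to_fract p" by blast
  obtain a b where x: "x = Fraction_Field.Fract a b" "b \<noteq> 0" by (cases x) auto
  then have x: "x * to_fract b = to_fract a" by (simp add: Fract_conv_to_fract)
  show ?case
  proof (rule exI[of _ "b * d"], intro conjI ballI)
    fix y assume "y \<in> insert x A"
    then show "\<exists>p. y * to_fract (b * d) = to_fract p"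
    proof
      assume "y = x"
      then have "y * to_fract (b * d) = to_fract (a * d)"
        using x by (simp flip: mult.assoc)
      then show ?thesis by blast
    next
      assume "y \<in> A"
      then obtain p where "y * to_fract d = to_fract p" using d by blast
      then have "y * to_fract (b * d) = to_fract (b * p)" by (simp add: mult.left_commute)
      then show ?thesis by blast
    qed
  qed (use d \<open>b \<noteq> 0\<close> in simp)
qed (auto intro: exI[of _ 1])

lemma to_fract_branch_drop:
  fixes E :: "nat \<Rightarrow> 'a::idom fract"
  assumes "passive_network net" "k < n_branches net"
    and "\<And>m. m < n_nodes net \<Longrightarrow> to_fract (P m) = E m * e"
  shows "to_fract (branch_drop P (branches net ! k)) = branch_drop E (branches net ! k) * e"
proof -
  have "to_fract (node_value P a) = node_value E a * e" if "a \<in> node_set net" for a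
    using that assms(3) by (cases a) (auto simp: node_set_def)
  from this[OF passive_branch(1)[OF assms(1,2)]] this[OF passive_branch(2)[OF assms(1,2)]]
  show ?thesis by (simp add: branch_drop_def algebra_simps)
qed

lemma poly_solution_exists:
  fixes V :: "nat \<Rightarrow> transfer_function"
  assumes net: "passive_network net" and inv: "invertible_mat (interior_admittance net)"
  shows "\<exists>d. d \<noteq> 0 \<and> (\<forall>e. d dvd e \<longrightarrow> (\<exists>P Q I. poly_solution net P Q I \<and>
    (\<forall>m<n_boundary net. to_fract (P m) = V m * to_fract e \<and>
      to_fract (I m) = (\<Sum>l<n_boundary net. kron_reduction net $$ (m, l) * V l) * to_fract e)))"
proof -
  obtain E where E: "\<And>m. m < n_boundary net \<Longrightarrow> E m = V m"
    "\<And>m. m < n_nodes net \<Longrightarrow> (\<Sum>l<n_nodes net. admittance_matrix net $$ (m, l) * E l) =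
      (if m < n_boundary net then (\<Sum>l<n_boundary net. kron_reduction net $$ (m, l) * V l) else 0)"
    using rational_solution[OF inv, of V] by blast
  define J where "J k = element_admittance (branch_element net k) * branch_drop E (branches net ! k)" for k
  define i where "i m = (\<Sum>l<n_boundary net. kron_reduction net $$ (m, l) * V l)" for m
  have KCL: "(\<Sum>k<n_branches net. branch_sign (branches net ! k) m * J k) = (if m < n_boundary net then i m else 0)"
    if "m < n_nodes net" for m
    using E(2)[OF that] admittance_matrix_row[OF net that, of E] by (simp add: J_def i_def)
  obtain d where d: "d \<noteq> 0"
    "\<forall>x \<in> E ` {..<n_nodes net} \<union> J ` {..<n_branches net} \<union> i ` {..<n_boundary net}. \<exists>p. x * to_fract d = to_fract p"
    using common_denominator[of "E ` {..<n_nodes net} \<union> J ` {..<n_branches net} \<union> i ` {..<n_boundary net}"]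
    by auto
  have "\<exists>P. \<forall>m<n_nodes net. E m * to_fract d = to_fract (P m)"
    "\<exists>Q. \<forall>k<n_branches net. J k * to_fract d = to_fract (Q k)"
    "\<exists>I. \<forall>m<n_boundary net. i m * to_fract d = to_fract (I m)"
    using d(2) by (auto intro!: choice simp: imp_ex ball_Un)
  then obtain P Q I where P: "\<And>m. m < n_nodes net \<Longrightarrow> to_fract (P m) = E m * to_fract d"
    and Q: "\<And>k. k < n_branches net \<Longrightarrow> to_fract (Q k) = J k * to_fract d"
    and I: "\<And>m. m < n_boundary net \<Longrightarrow> to_fract (I m) = i m * to_fract d" by metis
  show ?thesis
  proof (intro exI[of _ d] conjI allI impI)
    fix e assume "d dvd e"
    then obtain f where f: "e = d * f" by (auto elim: dvdE)
    define P' where "P' m = P m * f" for m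
    define Q' where "Q' k = Q k * f" for k
    define I' where "I' m = I m * f" for m
    have P': "to_fract (P' m) = E m * to_fract e" if "m < n_nodes net" for m
      using P[OF that] by (simp add: P'_def f mult.assoc)
    have Q': "to_fract (Q' k) = J k * to_fract e" if "k < n_branches net" for k
      using Q[OF that] by (simp add: Q'_def f mult.assoc)
    have I': "to_fract (I' m) = i m * to_fract e" if "m < n_boundary net" for m
      using I[OF that] by (simp add: I'_def f mult.assoc)
    have "poly_law (branch_element net k) (branch_drop P' (branches net ! k)) (Q' k)" if k: "k < n_branches net" for k
    proof -
      define D where "D = branch_drop P' (branches net ! k)"
      have D: "to_fract D = branch_drop E (branches net ! k) * to_fract e"
        unfolding D_def by (rule to_fract_branch_drop[OF net k P'])
      have Q: "to_fract (Q' k) = element_admittance (branch_element net k) * to_fract D"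
        unfolding Q'[OF k] D J_def by (simp add: mult.assoc)
      show ?thesis
        unfolding D_def[symmetric]
      proof (cases "branch_element net k")
        case (Resistor R)
        then have "R > 0" using passive_branch(4)[OF net k] by simp
        then have "to_fract ([:of_real R:] * Q' k) = to_fract D"
          unfolding to_fract_mult Q Resistor by (simp add: Fract_conv_to_fract)
        then show "poly_law (branch_element net k) D (Q' k)" using Resistor by simp
      next
        case (Inductor R)
        then have "R > 0" using passive_branch(4)[OF net k] by simp
        then have "to_fract ([:0, of_real R:] * Q' k) = to_fract D"
          unfolding to_fract_mult Q Inductor by (simp add: Fract_conv_to_fract)
        then show "poly_law (branch_element net k) D (Q' k)" using Inductor by simp
      next
        case (Capacitor R)
        then have "to_fract (Q' k) = to_fract ([:0, of_real R:] * D)"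
          unfolding to_fract_mult Q by (simp add: Fract_conv_to_fract)
        then show "poly_law (branch_element net k) D (Q' k)" using Capacitor by simp
      qed
    qed
    moreover have "(\<Sum>k<n_branches net. branch_sign (branches net ! k) m * Q' k) = (if m < n_boundary net then I' m else 0)"
      if m: "m < n_nodes net" for m
    proof -
      have sign: "to_fract (branch_sign br m :: complex poly) = branch_sign br m" for br
        by (simp add: branch_sign_def)
      have "to_fract (\<Sum>k<n_branches net. branch_sign (branches net ! k) m * Q' k) =
          (\<Sum>k<n_branches net. branch_sign (branches net ! k) m * J k) * to_fract e"
        unfolding to_fract_sum sum_distrib_right
        by (intro sum.cong) (auto simp: sign Q' mult.assoc)
      also have "\<dots> = to_fract (if m < n_boundary net then I' m else 0)"
        unfolding KCL[OF m] using I' by simp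
      finally show ?thesis by (simp only: to_fract_eq_iff)
    qed
    ultimately have "poly_solution net P' Q' I'" by (simp add: poly_solution_def)
    moreover have "\<forall>m<n_boundary net. to_fract (P' m) = V m * to_fract e \<and> to_fract (I' m) = i m * to_fract e"
      using P' I' E(1) by (simp add: n_nodes_def)
    ultimately show "\<exists>P Q I. poly_solution net P Q I \<and>
      (\<forall>m<n_boundary net. to_fract (P m) = V m * to_fract e \<and>
        to_fract (I m) = (\<Sum>l<n_boundary net. kron_reduction net $$ (m, l) * V l) * to_fract e)"
      unfolding i_def by blast
  qed (rule d)
qed

lemma poly_branch_drop:
  fixes P :: "nat \<Rightarrow> complex poly"
  shows "poly (branch_drop P br) s = branch_drop (\<lambda>m. poly (P m) s) br"
  by (cases "fst br"; cases "fst (snd br)") (auto simp: branch_drop_def)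

lemma cnj_branch_drop: "cnj (branch_drop E br :: complex) = branch_drop (\<lambda>m. cnj (E m)) br"
  by (cases "fst br"; cases "fst (snd br)") (auto simp: branch_drop_def)

lemma poly_branch_sign: "poly (branch_sign br m :: complex poly) s = branch_sign br m"
  by (simp add: branch_sign_def)

section \<open>Absorbed power and passivity\<close>

abbreviation branch_power ::
  "rlc_network \<Rightarrow> (nat \<Rightarrow> complex poly) \<Rightarrow> (nat \<Rightarrow> complex poly) \<Rightarrow> complex \<Rightarrow> nat \<Rightarrow> complex" where
  "branch_power net P Q s k \<equiv> cnj (poly (branch_drop P (branches net ! k)) s) * poly (Q k) s"

text \<open>Tellegen's theorem with conjugated potentials: the complex power absorbed by the
  branches enters through the ports.\<close>

lemma power_balance:
  assumes "passive_network net" "poly_solution net P Q I"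
  shows "(\<Sum>k<n_branches net. branch_power net P Q s k) =
    (\<Sum>m<n_boundary net. cnj (poly (P m) s) * poly (I m) s)"
proof -
  have "(\<Sum>k<n_branches net. branch_power net P Q s k) =
      (\<Sum>m<n_nodes net. cnj (poly (P m) s) * (\<Sum>k<n_branches net. branch_sign (branches net ! k) m * poly (Q k) s))"
    unfolding poly_branch_drop cnj_branch_drop by (rule tellegen[OF assms(1)])
  also have "\<dots> = (\<Sum>m<n_nodes net. if m < n_boundary net then cnj (poly (P m) s) * poly (I m) s else 0)"
  proof (intro sum.cong refl)
    fix m assume "m \<in> {..<n_nodes net}"
    then have "poly (\<Sum>k<n_branches net. branch_sign (branches net ! k) m * Q k) s =
        poly (if m < n_boundary net then I m else 0) s"
      using assms(2) by (simp add: poly_solution_def)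
    then show "cnj (poly (P m) s) * (\<Sum>k<n_branches net. branch_sign (branches net ! k) m * poly (Q k) s) =
        (if m < n_boundary net then cnj (poly (P m) s) * poly (I m) s else 0)"
      by (simp add: poly_sum poly_branch_sign split: if_splits)
  qed
  also have "\<dots> = (\<Sum>m<n_boundary net. cnj (poly (P m) s) * poly (I m) s)"
    by (rule sum_nodes_boundary)
  finally show ?thesis .
qed

lemma poly_law_power:
  assumes "poly_law x P Q"
  shows "Re (cnj (poly P s) * poly Q s) =
    (case x of Resistor R \<Rightarrow> R * (cmod (poly Q s))\<^sup>2
      | Inductor L \<Rightarrow> L * Re s * (cmod (poly Q s))\<^sup>2
      | Capacitor C \<Rightarrow> C * Re s * (cmod (poly P s))\<^sup>2)"
  using assms unfolding cmod_power2
  by (cases x) (auto simp: power2_eq_square algebra_simps)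

lemma poly_law_power_nonneg:
  "poly_law x P Q \<Longrightarrow> passive_element x \<Longrightarrow> Re s \<ge> 0 \<Longrightarrow> Re (cnj (poly P s) * poly Q s) \<ge> 0"
  by (subst poly_law_power, assumption) (cases x; simp)

lemma poly_law_power_zero:
  "poly_law x P Q \<Longrightarrow> passive_element x \<Longrightarrow> Re s > 0 \<Longrightarrow> Re (cnj (poly P s) * poly Q s) = 0 \<Longrightarrow>
    poly Q s = 0"
  by (subst (asm) poly_law_power, assumption) (cases x; auto)

text \<open>Dividing by \<epsilon> leaves a right-hand side that tends to 0.\<close>

lemma poly_root_limit:
  assumes "\<kappa> > 0" "\<And>\<epsilon>. 0 < \<epsilon> \<Longrightarrow> \<epsilon> < 1 \<Longrightarrow> \<epsilon> * (\<kappa> * (cmod (poly p (s + of_real \<epsilon>)))\<^sup>2) \<le> M * \<epsilon>\<^sup>2"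
  shows "poly p s = 0"
proof -
  have "((\<lambda>\<epsilon>. \<kappa> * (cmod (poly p (s + complex_of_real \<epsilon>)))\<^sup>2) \<longlongrightarrow> \<kappa> * (cmod (poly p (s + complex_of_real 0)))\<^sup>2) (at_right 0)"
    by (intro tendsto_intros)
  moreover have "((\<lambda>\<epsilon>. M * \<epsilon>) \<longlongrightarrow> M * 0) (at_right 0)"
    by (intro tendsto_intros)
  moreover have "\<forall>\<^sub>F \<epsilon> in at_right 0. \<kappa> * (cmod (poly p (s + complex_of_real \<epsilon>)))\<^sup>2 \<le> M * \<epsilon>"
    unfolding eventually_at_right_field
  proof (intro exI[of _ 1] conjI allI impI)
    fix \<epsilon> :: real assume e: "0 < \<epsilon>" "\<epsilon> < 1"
    then have "\<epsilon> * (\<kappa> * (cmod (poly p (s + of_real \<epsilon>)))\<^sup>2) \<le> \<epsilon> * (M * \<epsilon>)"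
      using assms(2)[OF e] by (simp add: power2_eq_square mult_ac)
    then show "\<kappa> * (cmod (poly p (s + complex_of_real \<epsilon>)))\<^sup>2 \<le> M * \<epsilon>"
      using e by simp
  qed simp
  ultimately have "\<kappa> * (cmod (poly p (s + complex_of_real 0)))\<^sup>2 \<le> M * 0"
    using tendsto_le[OF trivial_limit_at_right_real] by blast
  then show ?thesis using assms(1) by (simp add: mult_le_0_iff)
qed

text \<open>At s + \<epsilon> inductors and capacitors absorb power even if s lies on the imaginary
  axis: every element absorbs at least \<epsilon> times a squared modulus, up to a constant, which
  the quadratic bound forces to vanish at s.\<close>

lemma poly_law_root:
  assumes law: "poly_law x P Q" "passive_element x" and s: "Re s \<ge> 0"
    and le: "\<And>\<epsilon>. 0 < \<epsilon> \<Longrightarrow> \<epsilon> < 1 \<Longrightarrow>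
      Re (cnj (poly P (s + of_real \<epsilon>)) * poly Q (s + of_real \<epsilon>)) \<le> M * \<epsilon>\<^sup>2"
  shows "poly P s = 0 \<and> poly Q s = 0"
proof -
  define p where "p = (case x of Capacitor C \<Rightarrow> P | _ \<Rightarrow> Q)"
  define \<kappa> where "\<kappa> = (case x of Resistor R \<Rightarrow> R | Inductor L \<Rightarrow> L | Capacitor C \<Rightarrow> C)"
  have \<kappa>: "\<kappa> > 0" using law(2) by (cases x) (auto simp: \<kappa>_def)
  have "poly p s = 0"
  proof (rule poly_root_limit[OF \<kappa>])
    fix \<epsilon> :: real assume e: "0 < \<epsilon>" "\<epsilon> < 1"
    let ?n = "\<kappa> * (cmod (poly p (s + of_real \<epsilon>)))\<^sup>2"
    \<comment> \<open>The factor is 1 for a resistor and Re s + \<epsilon> for the other elements;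
      both are at least \<epsilon>.\<close>
    have "\<epsilon> * ?n \<le> (if x = Resistor \<kappa> then 1 else Re s + \<epsilon>) * ?n"
      using e s \<kappa> by (intro mult_right_mono) auto
    also have "\<dots> \<le> M * \<epsilon>\<^sup>2"
      using le[OF e] unfolding poly_law_power[OF law(1)] by (cases x) (auto simp: p_def \<kappa>_def mult_ac)
    finally show "\<epsilon> * ?n \<le> M * \<epsilon>\<^sup>2" .
  qed
  then show ?thesis using law by (cases x) (auto simp: p_def)
qed

lemma poly_solution_power_nonneg:
  assumes "passive_network net" "poly_solution net P Q I" "k < n_branches net" "Re s \<ge> 0"
  shows "Re (branch_power net P Q s k) \<ge> 0"
  using assms poly_law_power_nonneg passive_branch(4) unfolding poly_solution_def by blast

lemma port_power_nonneg:
  assumes "passive_network net" "poly_solution net P Q I" "Re s \<ge> 0"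
  shows "Re (\<Sum>m<n_boundary net. cnj (poly (P m) s) * poly (I m) s) \<ge> 0"
  unfolding power_balance[OF assms(1,2), symmetric] Re_sum
  by (intro sum_nonneg poly_solution_power_nonneg[OF assms(1,2)]) (use assms in auto)

text \<open>Nonnegative branch powers with sum 0 are all 0, which for Re s > 0 leaves no branch
  current.\<close>

lemma port_power_zero:
  assumes net: "passive_network net" and sol: "poly_solution net P Q I" and s: "Re s > 0"
    and zero: "Re (\<Sum>m<n_boundary net. cnj (poly (P m) s) * poly (I m) s) = 0" and m: "m < n_boundary net"
  shows "poly (I m) s = 0"
proof -
  have "(\<Sum>k<n_branches net. Re (branch_power net P Q s k)) = 0"
    using zero unfolding power_balance[OF net sol, symmetric] Re_sum .
  then have "\<forall>k<n_branches net. Re (branch_power net P Q s k) = 0"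
    by (subst (asm) sum_nonneg_eq_0_iff) (use poly_solution_power_nonneg[OF net sol] s in auto)
  then have "poly (Q k) s = 0" if "k < n_branches net" for k
    using that poly_law_power_zero[OF _ passive_branch(4)[OF net that] s] sol
    unfolding poly_solution_def by blast
  moreover have "I m = (\<Sum>k<n_branches net. branch_sign (branches net ! k) m * Q k)"
    using sol m by (simp add: poly_solution_def n_nodes_def)
  ultimately show ?thesis by (simp add: poly_sum)
qed

lemma poly_solution_branch_root:
  assumes net: "passive_network net" and sol: "poly_solution net P Q I" and s: "Re s \<ge> 0"
    and le: "\<And>\<epsilon>. 0 < \<epsilon> \<Longrightarrow> \<epsilon> < 1 \<Longrightarrow>
      Re (\<Sum>m<n_boundary net. cnj (poly (P m) (s + of_real \<epsilon>)) * poly (I m) (s + of_real \<epsilon>)) \<le> M * \<epsilon>\<^sup>2"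
    and k: "k < n_branches net"
  shows "poly (branch_drop P (branches net ! k)) s = 0 \<and> poly (Q k) s = 0"
proof (rule poly_law_root[OF _ passive_branch(4)[OF net k] s])
  show "poly_law (branch_element net k) (branch_drop P (branches net ! k)) (Q k)"
    using sol k by (simp add: poly_solution_def)
  fix \<epsilon> :: real assume e: "0 < \<epsilon>" "\<epsilon> < 1"
  have "Re (branch_power net P Q (s + of_real \<epsilon>) k) \<le> (\<Sum>k<n_branches net. Re (branch_power net P Q (s + of_real \<epsilon>) k))"
    by (rule member_le_sum) (use poly_solution_power_nonneg[OF net sol] s k e in auto)
  also have "\<dots> \<le> M * \<epsilon>\<^sup>2"
    using le[OF e] unfolding power_balance[OF net sol, symmetric] Re_sum .
  finally show "Re (branch_power net P Q (s + of_real \<epsilon>) k) \<le> M * \<epsilon>\<^sup>2" .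
qed

text \<open>The interior matrix is invertible over the rational functions but may be singular at the
  given s. Vanishing drops are a topological condition, however, so the values at s can be treated
  as constant rational functions.\<close>

lemma poly_solution_node_root:
  fixes P :: "nat \<Rightarrow> complex poly"
  assumes net: "passive_network net" and inv: "invertible_mat (interior_admittance net)"
    and bdry: "\<And>m. m < n_boundary net \<Longrightarrow> poly (P m) s = 0"
    and drop: "\<And>k. k < n_branches net \<Longrightarrow> poly (branch_drop P (branches net ! k)) s = 0"
    and m: "m < n_nodes net"
  shows "poly (P m) s = 0"
proof -
  define E where "E m = to_fract [:poly (P m) s:]" for m
  have "E m = 0"
  proof (rule interior_injective[OF net inv _ _ m])
    fix k assume k: "k < n_branches net"
    have "to_fract [:branch_drop (\<lambda>m. poly (P m) s) br:] = branch_drop E br" for br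
      by (cases "fst br"; cases "fst (snd br)") (auto simp: branch_drop_def E_def simp flip: to_fract_diff to_fract_uminus)
    then show "branch_drop E (branches net ! k) = 0"
      using drop[OF k] by (metis poly_branch_drop pCons_0_0 to_fract_0)
  qed (use bdry in \<open>simp add: E_def\<close>)
  then show ?thesis by (simp add: E_def)
qed

lemma poly_solution_divide:
  assumes net: "passive_network net" and sol: "poly_solution net P Q I" and r: "r \<noteq> 0"
    and P: "\<And>m. m < n_nodes net \<Longrightarrow> r dvd P m" and Q: "\<And>k. k < n_branches net \<Longrightarrow> r dvd Q k"
    and I: "\<And>m. m < n_boundary net \<Longrightarrow> r dvd I m"
  shows "poly_solution net (\<lambda>m. P m div r) (\<lambda>k. Q k div r) (\<lambda>m. I m div r)"
  unfolding poly_solution_def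
proof (intro conjI allI impI)
  fix k assume k: "k < n_branches net"
  have "P m = r * (P m div r)" if "m < n_nodes net" for m using P[OF that] by simp
  then have "node_value P a = r * node_value (\<lambda>m. P m div r) a" if "a \<in> node_set net" for a
    using that by (cases a) (auto simp: node_set_def)
  from this[OF passive_branch(1)[OF net k]] this[OF passive_branch(2)[OF net k]]
  have D: "branch_drop P (branches net ! k) = r * branch_drop (\<lambda>m. P m div r) (branches net ! k)"
    by (simp add: branch_drop_def algebra_simps)
  have Q: "Q k = r * (Q k div r)" using Q[OF k] by simp
  have "poly_law (branch_element net k) (branch_drop P (branches net ! k)) (Q k)"
    using sol k by (simp add: poly_solution_def)
  then have "poly_law (branch_element net k) (r * branch_drop (\<lambda>m. P m div r) (branches net ! k)) (r * (Q k div r))"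
    using D Q by simp
  moreover have cancel: "r * a = pCons 0 (smult c (r * b)) \<longleftrightarrow> a = pCons 0 (smult c b)"
    "r * a = smult c (r * b) \<longleftrightarrow> a = smult c b" for a b c
    using r mult_left_cancel[OF r, of a "pCons 0 (smult c b)"] mult_left_cancel[OF r, of a "smult c b"] by simp_all
  ultimately show "poly_law (branch_element net k) (branch_drop (\<lambda>m. P m div r) (branches net ! k)) (Q k div r)"
    by (cases "branch_element net k") (simp_all only: poly_law.simps cancel)
next
  fix m assume m: "m < n_nodes net"
  have "r * (\<Sum>k<n_branches net. branch_sign (branches net ! k) m * (Q k div r)) =
      (\<Sum>k<n_branches net. branch_sign (branches net ! k) m * Q k)"
    unfolding sum_distrib_left
  proof (intro sum.cong refl)
    fix k assume "k \<in> {..<n_branches net}"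
    then have "r * (Q k div r) = Q k" using Q by simp
    then show "r * (branch_sign (branches net ! k) m * (Q k div r)) = branch_sign (branches net ! k) m * Q k"
      by (metis mult.left_commute)
  qed
  also have "\<dots> = r * (if m < n_boundary net then I m div r else 0)"
    using sol m I by (simp add: poly_solution_def)
  finally show "(\<Sum>k<n_branches net. branch_sign (branches net ! k) m * (Q k div r)) = (if m < n_boundary net then I m div r else 0)"
    by (rule mult_left_cancel[OF r, THEN iffD1])
qed

text \<open>The vector e_j - e_k. Its entries sum to 0, so \<Gamma> multiplies it by N.\<close>

definition differential_sign :: "nat \<Rightarrow> nat \<Rightarrow> nat \<Rightarrow> 'a::comm_ring_1" where
  "differential_sign j k m = of_bool (m = j) - of_bool (m = k)"

text \<open>The response to unit currents injected at terminal \<open>j\<close> and extracted at terminal \<open>k\<close>, with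
  the common denominator \<open>d\<close> cleared: \<open>P, Q\<close> are the potentials and currents in the network,
  \<open>P', Q'\<close> those in the one-port at terminal \<open>j\<close>, and the one-port at terminal \<open>k\<close> sees \<open>-P', -Q'\<close>.\<close>

definition differential_response where
  "differential_response osc net j k h P Q P' Q' n o' q d \<longleftrightarrow>
     poly_solution net P Q (\<lambda>m. n * differential_sign j k m) \<and>
     (\<forall>m<n_boundary net. P m = q * differential_sign j k m) \<and>
     poly_solution osc P' Q' (\<lambda>_. o') \<and> P' 0 = q \<and> n + o' = d \<and> d \<noteq> 0 \<and>
     to_fract q = h * to_fract d"

lemma sum_differential_sign:
  fixes f :: "nat \<Rightarrow> 'a::comm_ring_1"
  assumes "j < N" "k < N" "j \<noteq> k"
  shows "(\<Sum>m<N. differential_sign j k m * f m) = f j - f k"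
proof -
  have "(\<Sum>m<N. differential_sign j k m * f m) = (\<Sum>m<N. (if m = j then f m else 0) - (if m = k then f m else 0))"
    by (intro sum.cong) (auto simp: differential_sign_def)
  also have "\<dots> = f j - f k" using assms by (simp add: sum_subtractf)
  finally show ?thesis .
qed

text \<open>The one-ports at \<open>j\<close> and \<open>k\<close> carry opposite voltages and
  currents, hence equal power: this is the factor 2 on the left. The right side is the power of the
  currents d and -d at the voltages q and -q.\<close>

lemma differential_response_power:
  assumes osc: "passive_network osc" "n_boundary osc = 1" and net: "passive_network net"
    and jk: "j < n_boundary net" "k < n_boundary net" "j \<noteq> k"
    and r: "differential_response osc net j k h P Q P' Q' n o' q d"
  shows "(\<Sum>m<n_boundary net. cnj (poly (P m) s) * poly (n * differential_sign j k m) s) +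
    2 * (\<Sum>m<n_boundary osc. cnj (poly (P' m) s) * poly o' s) = 2 * (cnj (poly q s) * poly d s)"
proof -
  have "(\<Sum>m<n_boundary net. cnj (poly (P m) s) * poly (n * differential_sign j k m) s) =
      (\<Sum>m<n_boundary net. differential_sign j k m * (cnj (poly (q * differential_sign j k m) s) * poly n s))"
    using r by (intro sum.cong) (auto simp: differential_response_def differential_sign_def)
  also have "\<dots> = 2 * (cnj (poly q s) * poly n s)"
    unfolding sum_differential_sign[OF jk] using jk by (simp add: differential_sign_def)
  moreover have "(\<Sum>m<n_boundary osc. cnj (poly (P' m) s) * poly o' s) = cnj (poly q s) * poly o' s"
    using r osc by (simp add: differential_response_def)
  moreover have "poly d s = poly n s + poly o' s" using r by (auto simp: differential_response_def)
  ultimately show ?thesis by (simp add: algebra_simps)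
qed

lemma transfer_function_cross_mult:
  assumes "to_fract q = h * to_fract d"
  shows "snd (quot_of_fract h) * q = fst (quot_of_fract h) * d"
proof -
  define a b where "a = fst (quot_of_fract h)" and "b = snd (quot_of_fract h)"
  have "b \<noteq> 0" by (simp add: b_def)
  have "h = to_fract a / to_fract b"
    unfolding a_def b_def by (simp flip: Fract_conv_to_fract)
  then have "to_fract (b * q) = to_fract (a * d)" using assms \<open>b \<noteq> 0\<close> by simp
  then show ?thesis by (simp only: to_fract_eq_iff a_def b_def)
qed

text \<open>At \<open>s + \<epsilon>\<close> the absorbed power is \<open>O(\<epsilon>\<^sup>2)\<close> if \<open>s\<close> is a root of \<open>d\<close>, while passive elements with
  nonzero voltage or current at \<open>s\<close> absorb at least a multiple of \<open>\<epsilon>\<close>. So the whole response vanishes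
  at \<open>s\<close> and a factor can be cancelled: undamped modes hidden inside a passive network are
  not visible at the terminals.\<close>

lemma differential_response_reduce:
  assumes osc: "passive_network osc" "n_boundary osc = 1" "invertible_mat (interior_admittance osc)"
    and net: "passive_network net" "invertible_mat (interior_admittance net)"
    and jk: "j < n_boundary net" "k < n_boundary net" "j \<noteq> k"
    and r: "differential_response osc net j k h P Q P' Q' n o' q d"
    and s: "Re s \<ge> 0" "poly d s = 0" "s \<notin> tf_poles h"
  shows "\<exists>P Q P' Q' n o' q d'. differential_response osc net j k h P Q P' Q' n o' q d' \<and> degree d' < degree d"
proof -
  define a b where "a = fst (quot_of_fract h)" and "b = snd (quot_of_fract h)"
  have bq: "b * q = a * d"
    unfolding a_def b_def using r by (intro transfer_function_cross_mult) (simp add: differential_response_def)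
  \<comment> \<open>Since \<open>s\<close> is no pole of \<open>h\<close>, the root of
    \<open>d\<close> must cancel against one of \<open>q\<close>.\<close>
  have "poly b s \<noteq> 0" using s(3) by (simp add: tf_poles_def b_def)
  moreover have "poly b s * poly q s = 0" using arg_cong[OF bq, of "\<lambda>p. poly p s"] s(2) by simp
  ultimately have q0: "poly q s = 0" by simp
  define l where "l = [:-s, 1:]"
  have l: "l \<noteq> 0" "degree l = 1" by (auto simp: l_def)
  have dvd: "l dvd p \<longleftrightarrow> poly p s = 0" for p by (simp add: l_def poly_eq_0_iff_dvd)
  define q1 where "q1 = q div l"
  define d1 where "d1 = d div l"
  have q1: "q = l * q1" and d1: "d = l * d1"
    using q0 s(2) by (simp_all add: q1_def d1_def flip: dvd)
  \<comment> \<open>Both \<open>q\<close> and \<open>d\<close> contain the factor \<open>l\<close>,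
    whose value at s + \<epsilon> is \<epsilon>; \<open>w\<close> is the cofactor of \<epsilon>^2 in
    |q d|.\<close>
  define w where "w \<epsilon> = cmod (poly q1 (s + complex_of_real \<epsilon>) * poly d1 (s + complex_of_real \<epsilon>))" for \<epsilon>
  have "compact (w ` {0..1})"
    unfolding w_def by (intro compact_continuous_image continuous_intros) auto
  then obtain M where M: "\<And>\<epsilon>. \<epsilon> \<in> {0..1} \<Longrightarrow> w \<epsilon> \<le> M"
    using compact_imp_bounded bounded_real by (metis (no_types, lifting) abs_le_D1 imageI)
  have bound: "Re (2 * (cnj (poly q (s + of_real \<epsilon>)) * poly d (s + of_real \<epsilon>))) \<le> 2 * M * \<epsilon>\<^sup>2"
    if "0 < \<epsilon>" "\<epsilon> < 1" for \<epsilon> :: real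
  proof -
    have "poly l (s + of_real \<epsilon>) = of_real \<epsilon>" by (simp add: l_def)
    then have "cmod (cnj (poly q (s + of_real \<epsilon>)) * poly d (s + of_real \<epsilon>)) = \<epsilon>\<^sup>2 * w \<epsilon>"
      by (simp add: q1 d1 norm_mult w_def power2_eq_square)
    moreover have "\<epsilon>\<^sup>2 * w \<epsilon> \<le> \<epsilon>\<^sup>2 * M" using M that by (intro mult_left_mono) auto
    ultimately have "Re (cnj (poly q (s + of_real \<epsilon>)) * poly d (s + of_real \<epsilon>)) \<le> \<epsilon>\<^sup>2 * M"
      using complex_Re_le_cmod order_trans by metis
    moreover have "Re (2 * w) = 2 * Re w" for w by simp
    ultimately show ?thesis by (simp only: mult.assoc) (simp add: mult.commute)
  qed
  have solN: "poly_solution net P Q (\<lambda>m. n * differential_sign j k m)" and solO: "poly_solution osc P' Q' (\<lambda>_. o')"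
    using r by (auto simp: differential_response_def)
  define RN where "RN t = Re (\<Sum>m<n_boundary net. cnj (poly (P m) t) * poly (n * differential_sign j k m) t)" for t
  define RO where "RO t = Re (\<Sum>m<n_boundary osc. cnj (poly (P' m) t) * poly o' t)" for t
  have pos: "RN t \<ge> 0" "RO t \<ge> 0" if "Re t \<ge> 0" for t
    unfolding RN_def RO_def
    using port_power_nonneg[OF net(1) solN that] port_power_nonneg[OF osc(1) solO that] by simp_all
  have total: "RN t + 2 * RO t = Re (2 * (cnj (poly q t) * poly d t))" for t
    using arg_cong[OF differential_response_power[OF osc(1,2) net(1) jk r, of t], of Re]
    unfolding RN_def RO_def by simp
  have bounds: "RN (s + of_real \<epsilon>) \<le> 2 * M * \<epsilon>\<^sup>2" "RO (s + of_real \<epsilon>) \<le> 2 * M * \<epsilon>\<^sup>2"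
    if "0 < \<epsilon>" "\<epsilon> < 1" for \<epsilon> :: real
  proof -
    have "RN (s + of_real \<epsilon>) \<ge> 0" "RO (s + of_real \<epsilon>) \<ge> 0"
      by (rule pos; use s(1) that in simp)+
    with bound[OF that] total[of "s + of_real \<epsilon>"]
    show "RN (s + of_real \<epsilon>) \<le> 2 * M * \<epsilon>\<^sup>2" "RO (s + of_real \<epsilon>) \<le> 2 * M * \<epsilon>\<^sup>2"
      by linarith+
  qed
  note rootN = poly_solution_branch_root[OF net(1) solN s(1) bounds(1)[unfolded RN_def]]
  note rootO = poly_solution_branch_root[OF osc(1) solO s(1) bounds(2)[unfolded RO_def]]
  have QN: "l dvd Q m" if "m < n_branches net" for m using rootN that by (simp add: dvd)
  have QO: "l dvd Q' m" if "m < n_branches osc" for m using rootO that by (simp add: dvd)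
  have PN: "l dvd P m" if "m < n_nodes net" for m
    unfolding dvd
  proof (rule poly_solution_node_root[OF net _ _ that])
    fix m assume "m < n_boundary net"
    then show "poly (P m) s = 0" using r q0 by (simp add: differential_response_def)
  qed (use rootN in blast)
  have PO: "l dvd P' m" if "m < n_nodes osc" for m
    unfolding dvd
  proof (rule poly_solution_node_root[OF osc(1,3) _ _ that])
    fix m assume "m < n_boundary osc"
    then show "poly (P' m) s = 0" using r q0 osc(2) by (simp add: differential_response_def)
  qed (use rootO in blast)
  have "o' = (\<Sum>k<n_branches osc. branch_sign (branches osc ! k) 0 * Q' k)"
    using solO osc(2) by (simp add: poly_solution_def n_nodes_def)
  then have IO: "l dvd o'" using QO by (auto intro!: dvd_sum)
  have "n = d - o'" using r by (auto simp: differential_response_def)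
  then have IN: "l dvd n" using IO d1 by simp
  have "differential_response osc net j k h (\<lambda>m. P m div l) (\<lambda>m. Q m div l)
      (\<lambda>m. P' m div l) (\<lambda>m. Q' m div l) (n div l) (o' div l) q1 d1"
    unfolding differential_response_def
  proof (intro conjI allI impI)
    have "(n * differential_sign j k m) div l = n div l * differential_sign j k m" for m
      using IN l by (auto elim!: dvdE)
    then show "poly_solution net (\<lambda>m. P m div l) (\<lambda>m. Q m div l) (\<lambda>m. n div l * differential_sign j k m)"
      using poly_solution_divide[OF net(1) solN l(1) PN QN] IN by simp
    show "poly_solution osc (\<lambda>m. P' m div l) (\<lambda>m. Q' m div l) (\<lambda>m. o' div l)"
      by (rule poly_solution_divide[OF osc(1) solO l(1) PO QO IO])
    show "P m div l = q1 * differential_sign j k m" if "m < n_boundary net" for m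
      using r that l by (simp add: differential_response_def q1 mult.assoc)
    show "P' 0 div l = q1" using r by (simp add: differential_response_def q1_def)
    show "n div l + o' div l = d1"
      using r IN IO by (auto simp: differential_response_def d1_def div_plus_div_distrib_dvd_left)
    show "d1 \<noteq> 0" using r d1 by (auto simp: differential_response_def)
    have "to_fract (l * q1) = h * to_fract (l * d1)"
      using r unfolding differential_response_def q1[symmetric] d1[symmetric] by blast
    then have "to_fract l * to_fract q1 = to_fract l * (h * to_fract d1)"
      unfolding to_fract_mult by (metis mult.left_commute)
    then show "to_fract q1 = h * to_fract d1"
      using l by (metis mult_left_cancel to_fract_eq_0_iff)
  qed
  moreover have "degree d1 < degree d"
    using r l unfolding d1 by (subst degree_mult_eq) (auto simp: differential_response_def d1)
  ultimately show ?thesis by blast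
qed

text \<open>As \<open>h\<close> has no pole with Re s >= 0, every such root of \<open>d\<close> can
  be cancelled, and the degree of \<open>d\<close> drops each time.\<close>

lemma differential_response_hurwitz:
  assumes osc: "passive_network osc" "n_boundary osc = 1" "invertible_mat (interior_admittance osc)"
    and net: "passive_network net" "invertible_mat (interior_admittance net)"
    and jk: "j < n_boundary net" "k < n_boundary net" "j \<noteq> k"
    and poles: "\<forall>s\<in>tf_poles h. Re s < 0"
    and r: "differential_response osc net j k h P Q P' Q' n o' q d"
  shows "\<exists>P Q P' Q' n o' q d. differential_response osc net j k h P Q P' Q' n o' q d \<and> hurwitz d"
  using r
proof (induction "degree d" arbitrary: P Q P' Q' n o' q d rule: less_induct)
  case less
  show ?case
  proof (cases "hurwitz d")
    case False
    then obtain s where s: "poly d s = 0" "Re s \<ge> 0"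
      using less(2) by (auto simp: hurwitz_def differential_response_def not_less)
    then have "s \<notin> tf_poles h" using poles by (auto simp: not_less[symmetric])
    from differential_response_reduce[OF osc net jk less(2) s(2,1) this] less(1) show ?thesis by blast
  qed (use less in blast)
qed

text \<open>Serves to exclude that a denominator in \<^const>\<open>lft\<close> or \<^const>\<open>equivalent_impedance\<close> vanishes
  identically, where division by zero would give a spurious zero gain.\<close>

definition power_numerator :: "transfer_function \<Rightarrow> complex poly \<Rightarrow> complex poly \<Rightarrow> bool" where
  "power_numerator y f n \<longleftrightarrow> to_fract n = y * to_fract f \<and>
     (\<forall>s. Re s > 0 \<longrightarrow> Re (cnj (poly f s) * poly n s) \<ge> 0 \<and>
        (Re (cnj (poly f s) * poly n s) = 0 \<longrightarrow> poly n s = 0))"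

definition positive_real_sign :: "transfer_function \<Rightarrow> bool" where
  "positive_real_sign y \<longleftrightarrow> (\<exists>e. e \<noteq> 0 \<and> (\<forall>f. e dvd f \<longrightarrow> (\<exists>n. power_numerator y f n)))"

text \<open>If y = -z, the power form of \<open>y\<close> is both nonnegative and nonpositive on the
  open right half plane, so the numerator of \<open>y\<close> vanishes there.\<close>

lemma positive_real_sign_add_nonzero:
  assumes "positive_real_sign y" "positive_real_sign z" "y \<noteq> 0"
  shows "y + z \<noteq> 0"
proof
  assume sum: "y + z = 0"
  obtain e e' where e: "e \<noteq> 0" "e' \<noteq> 0"
    and "\<And>f. e dvd f \<Longrightarrow> \<exists>n. power_numerator y f n"
    and "\<And>f. e' dvd f \<Longrightarrow> \<exists>n. power_numerator z f n"
    using assms(1,2) unfolding positive_real_sign_def by blast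
  then obtain n m where "power_numerator y (e * e') n" "power_numerator z (e * e') m"
    by (meson dvd_triv_left dvd_triv_right)
  then have n: "to_fract n = y * to_fract (e * e')"
    "\<And>s. Re s > 0 \<Longrightarrow> Re (cnj (poly (e * e') s) * poly n s) \<ge> 0"
    "\<And>s. Re s > 0 \<Longrightarrow> Re (cnj (poly (e * e') s) * poly n s) = 0 \<Longrightarrow> poly n s = 0"
    and m: "to_fract m = z * to_fract (e * e')"
    "\<And>s. Re s > 0 \<Longrightarrow> Re (cnj (poly (e * e') s) * poly m s) \<ge> 0"
    unfolding power_numerator_def by blast+
  have "to_fract (n + m) = (y + z) * to_fract (e * e')"
    unfolding to_fract_add n m by (simp add: distrib_right)
  then have "n + m = 0" using sum by (simp del: to_fract_add)
  then have m': "m = - n" by (simp add: eq_neg_iff_add_eq_0 add.commute)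
  have "poly n s = 0" if "Re s > 0" for s
  proof (rule n(3)[OF that])
    have "Re (cnj (poly (e * e') s) * poly (- n) s) \<ge> 0" using m(2)[OF that] unfolding m' .
    moreover have "Re (cnj (poly (e * e') s) * poly (- n) s) = - Re (cnj (poly (e * e') s) * poly n s)"
      by simp
    ultimately show "Re (cnj (poly (e * e') s) * poly n s) = 0" using n(2)[OF that] by simp
  qed
  \<comment> \<open>The positive integers supply infinitely many roots.\<close>
  then have "range (\<lambda>i. of_nat (Suc i)) \<subseteq> {s. poly n s = 0}" by auto
  moreover have "infinite (range (\<lambda>i. of_nat (Suc i) :: complex))"
    by (rule range_inj_infinite) (auto intro: injI)
  ultimately have "n = 0" using poly_roots_finite finite_subset by blast
  then show False using n(1) e assms(3) by simp
qed

text \<open>\<open>\<kappa>\<close> is an eigenvector of the Kron-reduced matrix with eigenvalue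
  \<open>y\<close>. Terminal voltages along it turn the port power into a positive multiple of the
  power form of \<open>y\<close>, which passivity controls.\<close>

lemma positive_real_sign_port:
  fixes c :: "nat \<Rightarrow> transfer_function" and \<kappa> :: "nat \<Rightarrow> int"
  assumes net: "passive_network net" "invertible_mat (interior_admittance net)"
    and V: "\<And>m. m < n_boundary net \<Longrightarrow>
      (\<Sum>l<n_boundary net. kron_reduction net $$ (m, l) * of_int (\<kappa> l)) = y * of_int (\<kappa> m)"
    and j: "j < n_boundary net" "\<kappa> j \<noteq> 0"
  shows "positive_real_sign y"
proof -
  obtain d where d: "d \<noteq> 0" "\<And>e. d dvd e \<Longrightarrow> \<exists>P Q I. poly_solution net P Q I \<and>
    (\<forall>m<n_boundary net. to_fract (P m) = of_int (\<kappa> m) * to_fract e \<and>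
      to_fract (I m) = (\<Sum>l<n_boundary net. kron_reduction net $$ (m, l) * of_int (\<kappa> l)) * to_fract e)"
    using poly_solution_exists[OF net, of "\<lambda>m. of_int (\<kappa> m)"] by auto
  have "to_fract (of_nat i) = (of_nat i :: transfer_function)" for i
    by (induction i) simp_all
  then have of_int: "to_fract (of_int i) = (of_int i :: transfer_function)" for i
    by (cases i rule: int_cases2) simp_all
  show ?thesis
    unfolding positive_real_sign_def
  proof (rule exI[of _ d], intro conjI allI impI d(1))
    fix f assume "d dvd f"
    from d(2)[OF this] obtain P Q I where sol: "poly_solution net P Q I"
      and P: "\<And>m. m < n_boundary net \<Longrightarrow> to_fract (P m) = of_int (\<kappa> m) * to_fract f"
      and I: "\<And>m. m < n_boundary net \<Longrightarrow> to_fract (I m) = y * of_int (\<kappa> m) * to_fract f"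
      using V by auto
    define n where "n = smult (1 / of_int (\<kappa> j)) (I j)"
    have \<kappa>j: "of_int (\<kappa> j) * n = I j"
      using j by (simp add: n_def of_int_poly)
    have nz: "(of_int (\<kappa> j) :: transfer_function) \<noteq> 0"
      using j unfolding of_int[symmetric] by (simp add: of_int_poly)
    have "of_int (\<kappa> j) * to_fract n = of_int (\<kappa> j) * (y * to_fract f)"
      using I[OF j(1)] by (simp flip: \<kappa>j add: of_int mult_ac)
    then have n: "to_fract n = y * to_fract f" using nz by simp
    have P': "P m = of_int (\<kappa> m) * f" if "m < n_boundary net" for m
    proof -
      have "to_fract (P m) = to_fract (of_int (\<kappa> m) * f)" using P[OF that] by (simp add: of_int)
      then show ?thesis by (simp only: to_fract_eq_iff)
    qed
    have I': "I m = of_int (\<kappa> m) * n" if "m < n_boundary net" for m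
    proof -
      have "to_fract (I m) = to_fract (of_int (\<kappa> m) * n)" using I[OF that] by (simp add: of_int n mult_ac)
      then show ?thesis by (simp only: to_fract_eq_iff)
    qed
    define K where "K = (\<Sum>m<n_boundary net. (\<kappa> m)\<^sup>2)"
    have "K \<ge> (\<kappa> j)\<^sup>2" unfolding K_def by (rule member_le_sum) (use j in auto)
    then have K: "K > 0" using j(2) by (meson less_le_trans zero_less_power2)
    have power: "(\<Sum>m<n_boundary net. cnj (poly (P m) s) * poly (I m) s) = of_int K * (cnj (poly f s) * poly n s)" for s
      unfolding K_def of_int_sum sum_distrib_right
      by (intro sum.cong) (auto simp: P' I' of_int_poly power2_eq_square)
    have Re: "Re (\<Sum>m<n_boundary net. cnj (poly (P m) s) * poly (I m) s) = of_int K * Re (cnj (poly f s) * poly n s)" for s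
      unfolding power by simp
    have "Re (cnj (poly f s) * poly n s) \<ge> 0 \<and> (Re (cnj (poly f s) * poly n s) = 0 \<longrightarrow> poly n s = 0)"
      if s: "Re s > 0" for s
    proof
      show "Re (cnj (poly f s) * poly n s) \<ge> 0"
        using port_power_nonneg[OF net(1) sol, of s] s K unfolding Re by (simp add: zero_le_mult_iff)
      show "Re (cnj (poly f s) * poly n s) = 0 \<longrightarrow> poly n s = 0"
      proof
        assume "Re (cnj (poly f s) * poly n s) = 0"
        then have "poly (I j) s = 0"
          by (intro port_power_zero[OF net(1) sol s _ j(1)]) (simp only: Re mult_zero_right)
        then show "poly n s = 0" by (simp add: n_def j)
      qed
    qed
    then have "power_numerator y f n" using n by (simp add: power_numerator_def del: times_complex.simps)
    then show "\<exists>n. power_numerator y f n" by blast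
  qed
qed

text \<open>Terminal voltages h (e_j - e_k) draw the total current 1 at \<open>j\<close>, by the
  hypothesis on \<open>h\<close>. Over a common denominator this current becomes the denominator
  itself, whence n + o' = d.\<close>

lemma differential_response_exists:
  assumes osc: "passive_network osc" "n_boundary osc = 1" "invertible_mat (interior_admittance osc)"
    and net: "passive_network net" "invertible_mat (interior_admittance net)"
    and jk: "j < n_boundary net" "k < n_boundary net" "j \<noteq> k"
    and kron: "\<And>V m. m < n_boundary net \<Longrightarrow> (\<Sum>l<n_boundary net. V l) = 0 \<Longrightarrow>
      (\<Sum>l<n_boundary net. kron_reduction net $$ (m, l) * V l) = y * V m"
    and h: "(kron_reduction osc $$ (0, 0) + y) * h = 1"
  shows "\<exists>P Q P' Q' n o' q d. differential_response osc net j k h P Q P' Q' n o' q d"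
proof -
  define \<chi>' :: "nat \<Rightarrow> transfer_function" where "\<chi>' = differential_sign j k"
  have \<chi>': "to_fract (differential_sign j k m) = \<chi>' m" for m
    by (simp add: \<chi>'_def differential_sign_def)
  have zero: "(\<Sum>l<n_boundary net. h * \<chi>' l) = 0"
    unfolding sum_distrib_left[symmetric] using sum_differential_sign[OF jk, of "\<lambda>_. 1 :: transfer_function"]
    by (simp add: \<chi>'_def)
  obtain d1 where d1: "d1 \<noteq> 0" "\<And>e. d1 dvd e \<Longrightarrow> \<exists>P Q I. poly_solution net P Q I \<and>
    (\<forall>m<n_boundary net. to_fract (P m) = h * \<chi>' m * to_fract e \<and>
      to_fract (I m) = (\<Sum>l<n_boundary net. kron_reduction net $$ (m, l) * (h * \<chi>' l)) * to_fract e)"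
    using poly_solution_exists[OF net, of "\<lambda>m. h * \<chi>' m"] by auto
  obtain d2 where d2: "d2 \<noteq> 0" "\<And>e. d2 dvd e \<Longrightarrow> \<exists>P Q I. poly_solution osc P Q I \<and>
    (\<forall>m<n_boundary osc. to_fract (P m) = h * to_fract e \<and>
      to_fract (I m) = (\<Sum>l<n_boundary osc. kron_reduction osc $$ (m, l) * h) * to_fract e)"
    using poly_solution_exists[OF osc(1,3), of "\<lambda>m. h"] by auto
  define e where "e = d1 * d2"
  have e: "e \<noteq> 0" using d1 d2 by (simp add: e_def)
  obtain P Q I where sol: "poly_solution net P Q I"
    and P: "\<And>m. m < n_boundary net \<Longrightarrow> to_fract (P m) = h * \<chi>' m * to_fract e"
    and I: "\<And>m. m < n_boundary net \<Longrightarrow> to_fract (I m) = y * (h * \<chi>' m) * to_fract e"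
    using d1(2)[of e] kron[OF _ zero] by (auto simp: e_def)
  obtain P' Q' I' where sol': "poly_solution osc P' Q' I'"
    and P': "to_fract (P' 0) = h * to_fract e"
    and I': "to_fract (I' 0) = kron_reduction osc $$ (0, 0) * h * to_fract e"
    using d2(2)[of e] osc(2) by (auto simp: e_def)
  have \<chi>j: "\<chi>' j = 1" using jk by (simp add: \<chi>'_def differential_sign_def)
  have Pm: "P m = P' 0 * differential_sign j k m" if "m < n_boundary net" for m
  proof -
    have "to_fract (P m) = to_fract (P' 0 * differential_sign j k m)"
      using P[OF that] P' by (simp add: \<chi>' mult_ac)
    then show ?thesis by (simp only: to_fract_eq_iff)
  qed
  have Im: "I m = I j * differential_sign j k m" if "m < n_boundary net" for m
  proof -
    have "to_fract (I m) = to_fract (I j * differential_sign j k m)"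
      using I[OF that] I[OF jk(1)] by (simp add: \<chi>' \<chi>j mult_ac)
    then show ?thesis by (simp only: to_fract_eq_iff)
  qed
  have "to_fract (I j + I' 0) = (kron_reduction osc $$ (0, 0) + y) * h * to_fract e"
    using I[OF jk(1)] I' by (simp add: \<chi>j algebra_simps)
  then have "I j + I' 0 = e" unfolding h by (simp only: mult_1 to_fract_eq_iff)
  moreover have "poly_solution net P Q (\<lambda>m. I j * differential_sign j k m)"
    using sol Im unfolding poly_solution_def by auto
  moreover have "poly_solution osc P' Q' (\<lambda>_. I' 0)"
    using sol' osc(2) unfolding poly_solution_def by auto
  ultimately show ?thesis
    unfolding differential_response_def using Pm e P' by blast
qed

section \<open>Pairing trajectories with polynomial responses\<close>

text \<open>Trajectories are sampled from time 1 on, since nothing is required of them at time 0.\<close>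

definition shifted :: "(real \<Rightarrow> real) \<Rightarrow> real \<Rightarrow> complex" where
  "shifted f t = complex_of_real (f (1 + max 0 t))"

lemma shifted_in: "continuous_on {0<..} f \<Longrightarrow> shifted f \<in> signals"
  by (rule signalsI)
    (auto simp: shifted_def[abs_def] intro!: continuous_intros elim: continuous_on_compose2)

lemma shifted_primitive:
  assumes "continuous_on {0<..} f" "continuous_on {0<..} g"
    and "\<And>t. t > 0 \<Longrightarrow> (f has_real_derivative g t / c) (at t)"
  shows "shifted f = (\<lambda>t. shifted f 0 + primitive (shifted g) t / of_real c)"
proof -
  have g: "(\<lambda>t. 1 / of_real c * shifted g t) \<in> signals" by (intro signals_scale shifted_in assms)
  have "shifted f = (\<lambda>t. shifted f 0 + primitive (\<lambda>t. 1 / of_real c * shifted g t) t)"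
  proof (rule primitive_unique[OF shifted_in[OF assms(1)] signals_cont_UNIV[OF g]])
    fix t :: real assume t: "t > 0"
    have "((\<lambda>t. f (1 + t)) has_real_derivative g (1 + t) / c) (at t)"
      using DERIV_shift[of f "g (1 + t) / c" t 1] assms(3)[of "1 + t"] t by (simp add: add.commute)
    then have "((\<lambda>t. complex_of_real (f (1 + t))) has_vector_derivative complex_of_real (g (1 + t) / c)) (at t)"
      by (intro has_vector_derivative_of_real) (simp add: has_real_derivative_iff_has_vector_derivative)
    moreover have eq: "complex_of_real (g (1 + t) / c) = 1 / of_real c * shifted g t"
      using t by (simp add: shifted_def)
    ultimately have D: "((\<lambda>t. complex_of_real (f (1 + t))) has_vector_derivative 1 / of_real c * shifted g t) (at t)"
      unfolding eq by blast
    show "(shifted f has_vector_derivative 1 / of_real c * shifted g t) (at t)"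
      by (rule has_vector_derivative_transform_within[OF D, where d = t])
        (use t in \<open>auto simp: shifted_def dist_real_def\<close>)
  qed
  then show ?thesis unfolding primitive_scale by simp
qed

text \<open>The factor s cancels one of the K + 1 integrations.\<close>

lemma rev_poly_pCons: "rev_poly (Suc K) (pCons 0 p) = rev_poly K p"
  by (intro poly_eqI) (auto simp: coeff_rev_poly Suc_diff_le coeff_pCons split: nat.splits)

lemma rev_poly_Suc: "degree p \<le> K \<Longrightarrow> rev_poly (Suc K) p = pCons 0 (rev_poly K p)"
  by (intro poly_eqI) (auto simp: coeff_rev_poly coeff_pCons coeff_eq_0 split: nat.splits)

lemma rev_poly_smult: "rev_poly K (smult c p) = smult c (rev_poly K p)"
  by (intro poly_eqI) (simp add: coeff_rev_poly)

lemma rev_poly_add: "rev_poly K (p + q) = rev_poly K p + rev_poly K q"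
  by (intro poly_eqI) (simp add: coeff_rev_poly)

text \<open>\<open>f\<close> satisfies c f' = g. Multiplication by s differentiates \<open>f\<close>
  and loses only \<open>f0\<close>, which leaves c f0 times the reversed \<open>p\<close> as
  forcing; its degree is below K because one of the K integrations is used up.\<close>

lemma dynamic_branch_pairing:
  assumes f: "f = (\<lambda>t. f0 + primitive g t / c)" and g: "g \<in> signals" and fs: "f \<in> signals"
    and c: "c \<noteq> 0" and deg: "degree p < K"
  shows "\<exists>a. (\<forall>i\<ge>K. coeff a i = 0) \<and>
    (\<forall>t. poly_act (rev_poly K (pCons 0 (smult c p))) f t - poly_act (rev_poly K p) g t = poly_act a (\<lambda>t. 1) t)"
proof -
  obtain K' where K: "K = Suc K'" using deg by (cases K) auto
  let ?r = "rev_poly K' p"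
  have pg: "primitive g \<in> signals" using g by auto
  have "f = (\<lambda>t. f0 + 1 / c * primitive g t)" by (subst f) simp
  then have 1: "poly_act ?r f = (\<lambda>t. poly_act ?r (\<lambda>t. f0) t + 1 / c * poly_act ?r (primitive g) t)"
    by (simp only: poly_act_add_right[OF signals_const signals_scale[OF pg]] poly_act_scale_right)
  have 2: "poly_act ?r (\<lambda>t. f0) = (\<lambda>t. f0 * poly_act ?r (\<lambda>t. 1) t)"
    using poly_act_scale_right[of ?r f0 "\<lambda>t. 1"] by simp
  have 3: "poly_act (rev_poly K p) g = poly_act ?r (primitive g)"
    using deg by (simp add: K rev_poly_Suc poly_act_pCons primitive_poly_act g)
  have 4: "poly_act (rev_poly K (pCons 0 (smult c p))) f = (\<lambda>t. c * poly_act ?r f t)"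
    by (simp only: K rev_poly_pCons rev_poly_smult poly_act_smult[OF fs])
  have "poly_act (rev_poly K (pCons 0 (smult c p))) f t - poly_act (rev_poly K p) g t =
      poly_act (smult (c * f0) ?r) (\<lambda>t. 1) t" for t
    unfolding 4 3 1 2 poly_act_smult[OF signals_const] using c by (simp add: distrib_left)
  moreover have "\<forall>i\<ge>K. coeff (smult (c * f0) ?r) i = 0"
    by (simp add: K coeff_rev_poly)
  ultimately show ?thesis by blast
qed

text \<open>Reciprocity of a single element: response and trajectory obey the same law, so pairing
  voltage with current either way gives the same result up to initial data.\<close>

lemma branch_pairing:
  assumes law: "poly_law x P Q" and x: "passive_element x" and deg: "degree P < K" "degree Q < K"
    and cont: "continuous_on {0<..} e" "continuous_on {0<..} c"
    and el: "\<And>t. t > 0 \<Longrightarrow> element_law x e c t"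
  shows "\<exists>a. (\<forall>i\<ge>K. coeff a i = 0) \<and>
    (\<forall>t. poly_act (rev_poly K P) (shifted c) t - poly_act (rev_poly K Q) (shifted e) t = poly_act a (\<lambda>t. 1) t)"
proof (cases x)
  case (Resistor R)
  have "shifted e = (\<lambda>t. of_real R * shifted c t)"
    using el by (auto simp: Resistor shifted_def fun_eq_iff)
  then have "poly_act (rev_poly K Q) (shifted e) = (\<lambda>t. of_real R * poly_act (rev_poly K Q) (shifted c) t)"
    by (simp only: poly_act_scale_right)
  moreover have "poly_act (rev_poly K P) (shifted c) = (\<lambda>t. of_real R * poly_act (rev_poly K Q) (shifted c) t)"
    using law by (simp add: Resistor rev_poly_smult poly_act_smult shifted_in cont)
  ultimately show ?thesis by (intro exI[of _ 0]) simp
next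
  case (Inductor L)
  have "shifted c = (\<lambda>t. shifted c 0 + primitive (shifted e) t / of_real L)"
    using el by (intro shifted_primitive cont) (simp add: Inductor)
  from dynamic_branch_pairing[OF this shifted_in[OF cont(1)] shifted_in[OF cont(2)] _ deg(2)]
  show ?thesis using law x by (simp add: Inductor)
next
  case (Capacitor C)
  have "shifted e = (\<lambda>t. shifted e 0 + primitive (shifted c) t / of_real C)"
    using el by (intro shifted_primitive cont) (simp add: Capacitor)
  from dynamic_branch_pairing[OF this shifted_in[OF cont(2)] shifted_in[OF cont(1)] _ deg(1)]
  obtain a where "\<forall>i\<ge>K. coeff a i = 0"
    "\<And>t. poly_act (rev_poly K Q) (shifted e) t - poly_act (rev_poly K P) (shifted c) t = poly_act a (\<lambda>t. 1) t"
    using law x by (auto simp: Capacitor)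
  then show ?thesis
    by (intro exI[of _ "smult (-1) a"]) (simp add: poly_act_smult[OF signals_const] del: smult_minus_left, metis minus_diff_eq)
qed

lemma node_value_signals:
  assumes "a \<in> node_set net" "\<And>m. m < n_nodes net \<Longrightarrow> continuous_on {0<..} (e m)"
  shows "continuous_on {0<..} (potential e a)"
  using assms by (cases a) (auto simp: node_set_def)

text \<open>Tellegen's theorem for each power of s separately, with coefficients of \<open>P\<close>
  as potentials and repeated integrals of \<open>f\<close> as currents.\<close>

lemma tellegen_act:
  fixes P :: "nat \<Rightarrow> complex poly"
  assumes net: "passive_network net" and f: "\<And>k. k < n_branches net \<Longrightarrow> f k \<in> signals"
  shows "(\<Sum>k<n_branches net. poly_act (rev_poly K (branch_drop P (branches net ! k))) (f k) t) =
    (\<Sum>m<n_nodes net. poly_act (rev_poly K (P m))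
       (\<lambda>t. \<Sum>k<n_branches net. branch_sign (branches net ! k) m * f k t) t)"
proof -
  have coeff: "coeff (branch_drop P br) i = branch_drop (\<lambda>m. coeff (P m) i) br" for br i
    by (cases "fst br"; cases "fst (snd br)") (auto simp: branch_drop_def)
  have pow: "(primitive ^^ l) (\<lambda>t. \<Sum>k<n_branches net. branch_sign (branches net ! k) m * f k t) =
      (\<lambda>t. \<Sum>k<n_branches net. branch_sign (branches net ! k) m * (primitive ^^ l) (f k) t)" for l m
  proof -
    have "poly_act (monom 1 l) (\<lambda>t. \<Sum>k<n_branches net. branch_sign (branches net ! k) m * f k t) =
      (\<lambda>t. \<Sum>k<n_branches net. branch_sign (branches net ! k) m * poly_act (monom 1 l) (f k) t)"
      by (subst poly_act_sum_right) (auto intro: signals_scale f simp: poly_act_scale_right)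
    then show ?thesis by (simp add: poly_act_monom)
  qed
  have "(\<Sum>k<n_branches net. poly_act (rev_poly K (branch_drop P (branches net ! k))) (f k) t) =
      (\<Sum>i\<le>K. \<Sum>k<n_branches net. branch_drop (\<lambda>m. coeff (P m) i) (branches net ! k) * (primitive ^^ (K - i)) (f k) t)"
    by (subst sum.swap, intro sum.cong) (auto simp: poly_act_rev_poly f coeff)
  also have "\<dots> = (\<Sum>i\<le>K. \<Sum>m<n_nodes net. coeff (P m) i *
      (\<Sum>k<n_branches net. branch_sign (branches net ! k) m * (primitive ^^ (K - i)) (f k) t))"
    by (intro sum.cong refl tellegen[OF net])
  also have "\<dots> = (\<Sum>m<n_nodes net. poly_act (rev_poly K (P m))
       (\<lambda>t. \<Sum>k<n_branches net. branch_sign (branches net ! k) m * f k t) t)"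
    by (subst sum.swap, intro sum.cong refl, subst poly_act_rev_poly)
      (auto intro!: signals_sum signals_scale f simp: pow)
  finally show ?thesis .
qed

lemma network_trajectoryE:
  assumes "network_trajectory net v i"
  obtains e c where
    "\<forall>m<n_nodes net. continuous_on {0<..} (e m)"
    "\<forall>k<n_branches net. continuous_on {0<..} (c k)"
    "\<forall>m<n_boundary net. \<forall>t>0. e m t = v m t"
    "\<forall>k<n_branches net. \<forall>t>0. case branches net ! k of (p, q, x) \<Rightarrow>
       element_law x (\<lambda>t. potential e p t - potential e q t) (c k) t"
    "\<forall>m<n_nodes net. \<forall>t>0. (\<Sum>k<n_branches net. incidence (branches net ! k) (Vertex m) * c k t) =
       (if m < n_boundary net then i m t else 0)"
  using assms unfolding network_trajectory_def by (elim exE conjE) (rule that)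

lemma network_trajectory_signals:
  assumes "network_trajectory net v i" "m < n_boundary net"
  shows "shifted (v m) \<in> signals" "shifted (i m) \<in> signals"
proof -
  obtain e c where e: "\<forall>m<n_nodes net. continuous_on {0<..} (e m)"
    and c: "\<forall>k<n_branches net. continuous_on {0<..} (c k)"
    and ev: "\<forall>m<n_boundary net. \<forall>t>0. e m t = v m t"
    and KCL: "\<forall>m<n_nodes net. \<forall>t>0. (\<Sum>k<n_branches net. incidence (branches net ! k) (Vertex m) * c k t) =
       (if m < n_boundary net then i m t else 0)"
    using network_trajectoryE[OF assms(1)] .
  note e = e[rule_format] and c = c[rule_format] and KCL = KCL[rule_format]
  have m: "m < n_nodes net" using assms by (simp add: n_nodes_def)
  have "continuous_on {0<..} (v m)"
    by (rule continuous_on_eq[OF e[OF m]]) (use ev assms in auto)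
  then show "shifted (v m) \<in> signals" by (rule shifted_in)
  have "continuous_on {0<..} (\<lambda>t. \<Sum>k<n_branches net. incidence (branches net ! k) (Vertex m) * c k t)"
    by (intro continuous_intros c) auto
  then have "continuous_on {0<..} (i m)"
    by (rule continuous_on_eq) (use KCL[OF m] assms(2) in auto)
  then show "shifted (i m) \<in> signals" by (rule shifted_in)
qed

text \<open>Reciprocity: pairing a trajectory with a polynomial response through Tellegen's theorem
  leaves only the port quantities. The remainder accounts for the initial data.\<close>

lemma trajectory_pairing:
  assumes net: "passive_network net" and sol: "poly_solution net P Q I"
    and traj: "network_trajectory net v i"
    and degP: "\<And>m. m < n_nodes net \<Longrightarrow> degree (P m) < K"
    and degQ: "\<And>k. k < n_branches net \<Longrightarrow> degree (Q k) < K"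
  shows "\<exists>a. (\<forall>i\<ge>K. coeff a i = 0) \<and> (\<forall>t.
    (\<Sum>m<n_boundary net. poly_act (rev_poly K (P m)) (shifted (i m)) t -
       poly_act (rev_poly K (I m)) (shifted (v m)) t) = poly_act a (\<lambda>t. 1) t)"
proof -
  obtain e c where e: "\<forall>m<n_nodes net. continuous_on {0<..} (e m)"
    and c: "\<forall>k<n_branches net. continuous_on {0<..} (c k)"
    and ev: "\<forall>m<n_boundary net. \<forall>t>0. e m t = v m t"
    and law: "\<forall>k<n_branches net. \<forall>t>0. case branches net ! k of (p, q, x) \<Rightarrow>
       element_law x (\<lambda>t. potential e p t - potential e q t) (c k) t"
    and KCL: "\<forall>m<n_nodes net. \<forall>t>0. (\<Sum>k<n_branches net. incidence (branches net ! k) (Vertex m) * c k t) =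
       (if m < n_boundary net then i m t else 0)"
    using network_trajectoryE[OF traj] .
  note e = e[rule_format] and c = c[rule_format] and ev = ev[rule_format] and law = law[rule_format]
    and KCL = KCL[rule_format]
  define u where "u k t = potential e (fst (branches net ! k)) t - potential e (fst (snd (branches net ! k))) t" for k t
  have u: "continuous_on {0<..} (u k)" if "k < n_branches net" for k
    unfolding u_def[abs_def]
    by (intro continuous_intros node_value_signals[OF passive_branch(1)[OF net that] e]
        node_value_signals[OF passive_branch(2)[OF net that] e])
  have law': "element_law (branch_element net k) (u k) (c k) t" if "k < n_branches net" "t > 0" for k t
    using law[OF that] by (simp add: u_def[abs_def] case_prod_beta)
  have deg: "degree (branch_drop P (branches net ! k)) < K" if k: "k < n_branches net" for k
  proof -
    have "K > 0" using degQ[OF k] by simp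
    then have "degree (node_value P a) < K" if "a \<in> node_set net" for a
      using that degP by (cases a) (auto simp: node_set_def)
    from this[OF passive_branch(1)[OF net k]] this[OF passive_branch(2)[OF net k]] show ?thesis
      unfolding branch_drop_def by (rule degree_diff_less)
  qed
  define D where "D k t = poly_act (rev_poly K (branch_drop P (branches net ! k))) (shifted (c k)) t -
      poly_act (rev_poly K (Q k)) (shifted (u k)) t" for k t
  have "\<forall>k<n_branches net. \<exists>a. (\<forall>i\<ge>K. coeff a i = 0) \<and> (\<forall>t. D k t = poly_act a (\<lambda>t. 1) t)"
    unfolding D_def
  proof (intro allI impI)
    fix k assume k: "k < n_branches net"
    have "poly_law (branch_element net k) (branch_drop P (branches net ! k)) (Q k)"
      using sol k by (simp add: poly_solution_def)
    from branch_pairing[OF this passive_branch(4)[OF net k] deg[OF k] degQ[OF k] u[OF k] c[OF k] law'[OF k]]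
    show "\<exists>a. (\<forall>i\<ge>K. coeff a i = 0) \<and>
        (\<forall>t. poly_act (rev_poly K (branch_drop P (branches net ! k))) (shifted (c k)) t -
          poly_act (rev_poly K (Q k)) (shifted (u k)) t = poly_act a (\<lambda>t. 1) t)" .
  qed
  then obtain a where a: "\<And>k i. k < n_branches net \<Longrightarrow> i \<ge> K \<Longrightarrow> coeff (a k) i = 0"
    "\<And>k t. k < n_branches net \<Longrightarrow> D k t = poly_act (a k) (\<lambda>t. 1) t"
    by metis
  have sc: "shifted (c k) \<in> signals" "shifted (u k) \<in> signals" if "k < n_branches net" for k
    using that by (auto intro: shifted_in c u)
  have cur: "(\<lambda>t. \<Sum>k<n_branches net. branch_sign (branches net ! k) m * shifted (c k) t) =
      (if m < n_boundary net then shifted (i m) else (\<lambda>t. 0))" if m: "m < n_nodes net" for m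
  proof
    fix t
    have "incidence br (Vertex m) = branch_sign br m" for br
      by (auto simp: incidence_def branch_sign_def split: prod.split)
    moreover have "complex_of_real (branch_sign br m) = branch_sign br m" for br
      by (simp add: branch_sign_def)
    ultimately have "(\<Sum>k<n_branches net. branch_sign (branches net ! k) m * shifted (c k) t) =
       complex_of_real (\<Sum>k<n_branches net. incidence (branches net ! k) (Vertex m) * c k (1 + max 0 t))"
      by (simp add: shifted_def)
    also have "\<dots> = (if m < n_boundary net then shifted (i m) else (\<lambda>t. 0)) t"
      by (subst KCL[OF m]) (auto simp: shifted_def)
    finally show "(\<Sum>k<n_branches net. branch_sign (branches net ! k) m * shifted (c k) t) =
      (if m < n_boundary net then shifted (i m) else (\<lambda>t. 0)) t" .
  qed
  \<comment> \<open>Response potentials against trajectory currents: the current law of the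
    trajectory removes the interior nodes.\<close>
  have 1: "(\<Sum>k<n_branches net. poly_act (rev_poly K (branch_drop P (branches net ! k))) (shifted (c k)) t) =
      (\<Sum>m<n_boundary net. poly_act (rev_poly K (P m)) (shifted (i m)) t)" for t
  proof -
    have "(\<Sum>k<n_branches net. poly_act (rev_poly K (branch_drop P (branches net ! k))) (shifted (c k)) t) =
        (\<Sum>m<n_nodes net. poly_act (rev_poly K (P m)) (\<lambda>t. \<Sum>k<n_branches net. branch_sign (branches net ! k) m * shifted (c k) t) t)"
      by (rule tellegen_act[OF net sc(1)])
    also have "\<dots> = (\<Sum>m<n_nodes net. if m < n_boundary net then poly_act (rev_poly K (P m)) (shifted (i m)) t else 0)"
      by (intro sum.cong) (auto simp: cur)
    finally show ?thesis by (simp only: sum_nodes_boundary)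
  qed
  \<comment> \<open>Trajectory potentials against response currents: here the current law of the
    response does so.\<close>
  have 2: "(\<Sum>k<n_branches net. poly_act (rev_poly K (Q k)) (shifted (u k)) t) =
      (\<Sum>m<n_boundary net. poly_act (rev_poly K (I m)) (shifted (v m)) t)" for t
  proof -
    have su: "shifted (u k) = (\<lambda>t. \<Sum>m<n_nodes net. branch_sign (branches net ! k) m * shifted (e m) t)"
      if k: "k < n_branches net" for k
    proof
      fix t
      define E where "E m = shifted (e m) t" for m
      have "complex_of_real (potential e a (1 + max 0 t)) = node_value E a" for a
        by (cases a) (auto simp: E_def shifted_def)
      then have "shifted (u k) t = branch_drop E (branches net ! k)"
        by (simp add: shifted_def u_def branch_drop_def)
      then show "shifted (u k) t = (\<Sum>m<n_nodes net. branch_sign (branches net ! k) m * shifted (e m) t)"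
        using branch_drop_sum[OF net k, of E] by (simp add: E_def)
    qed
    have se: "shifted (e m) \<in> signals" if "m < n_nodes net" for m using that by (auto intro: shifted_in e)
    have sgn: "poly_act (rev_poly K (Q k)) (shifted (u k)) t =
        (\<Sum>m<n_nodes net. poly_act (rev_poly K (branch_sign (branches net ! k) m * Q k)) (shifted (e m)) t)"
      if k: "k < n_branches net" for k
    proof -
      have "branch_sign br m * p = smult (branch_sign br m) p" for br m and p :: "complex poly"
        by (simp add: branch_sign_def)
      then have "poly_act (rev_poly K (branch_sign (branches net ! k) m * Q k)) (shifted (e m)) t =
          branch_sign (branches net ! k) m * poly_act (rev_poly K (Q k)) (shifted (e m)) t" if "m < n_nodes net" for m
        using that by (simp add: rev_poly_smult poly_act_smult se)
      then show ?thesis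
        unfolding su[OF k] by (subst poly_act_sum_right) (auto intro: signals_scale se simp: poly_act_scale_right)
    qed
    have rsum: "rev_poly K (\<Sum>i\<in>A. p i) = (\<Sum>i\<in>A. rev_poly K (p i))" for p and A :: "nat set"
      by (intro poly_eqI) (simp add: coeff_rev_poly coeff_sum)
    have "(\<Sum>k<n_branches net. poly_act (rev_poly K (Q k)) (shifted (u k)) t) =
        (\<Sum>m<n_nodes net. poly_act (rev_poly K (\<Sum>k<n_branches net. branch_sign (branches net ! k) m * Q k)) (shifted (e m)) t)"
      by (simp add: sgn) (subst sum.swap, intro sum.cong refl, simp add: rsum poly_act_sum se)
    also have "\<dots> = (\<Sum>m<n_nodes net. if m < n_boundary net then poly_act (rev_poly K (I m)) (shifted (v m)) t else 0)"
    proof (intro sum.cong refl)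
      fix m assume "m \<in> {..<n_nodes net}"
      then have "(\<Sum>k<n_branches net. branch_sign (branches net ! k) m * Q k) = (if m < n_boundary net then I m else 0)"
        using sol by (simp add: poly_solution_def)
      moreover have "shifted (e m) = shifted (v m)" if "m < n_boundary net"
        using ev[OF that] by (auto simp: shifted_def)
      moreover have "rev_poly K 0 = 0" by (intro poly_eqI) (simp add: coeff_rev_poly)
      ultimately show "poly_act (rev_poly K (\<Sum>k<n_branches net. branch_sign (branches net ! k) m * Q k)) (shifted (e m)) t =
        (if m < n_boundary net then poly_act (rev_poly K (I m)) (shifted (v m)) t else 0)" by simp
    qed
    finally show ?thesis by (simp only: sum_nodes_boundary)
  qed
  have "(\<Sum>m<n_boundary net. poly_act (rev_poly K (P m)) (shifted (i m)) t -
       poly_act (rev_poly K (I m)) (shifted (v m)) t) = poly_act (\<Sum>k<n_branches net. a k) (\<lambda>t. 1) t" for t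
  proof -
    have "(\<Sum>k<n_branches net. D k t) = poly_act (\<Sum>k<n_branches net. a k) (\<lambda>t. 1) t"
      using a(2) by (simp add: poly_act_sum[OF signals_const])
    then show ?thesis unfolding D_def sum_subtractf 1 2 .
  qed
  moreover have "\<forall>i\<ge>K. coeff (\<Sum>k<n_branches net. a k) i = 0"
    using a(1) by (simp add: coeff_sum)
  ultimately show ?thesis by blast
qed

section \<open>Lipschitz bound of the source and conclusion\<close>

lemma piecewise_differentiable_lipschitz:
  assumes g: "piecewise_differentiable g" and bdd: "bdd_above (abs_slopes g)"
  defines "\<sigma> \<equiv> Sup (abs_slopes g)"
  shows "\<sigma> \<ge> 0" "\<bar>g a - g b\<bar> \<le> \<sigma> * \<bar>a - b\<bar>"
proof -
  define S where "S a b = {v\<in>{a..b}. \<not> g differentiable (at v)}" for a b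
  have fin: "finite (S a b)" for a b
    using g by (simp add: piecewise_differentiable_def S_def)
  have slope: "\<bar>deriv g v\<bar> \<le> \<sigma>" if "v \<in> {a..b} - S a b" for v a b
  proof -
    have "g differentiable (at v)" using that by (simp add: S_def)
    then have "(g has_real_derivative deriv g v) (at v)"
      by (simp add: DERIV_deriv_iff_real_differentiable)
    then have "\<bar>deriv g v\<bar> \<in> abs_slopes g" by (auto simp: abs_slopes_def)
    then show ?thesis unfolding \<sigma>_def using bdd by (rule cSup_upper)
  qed
  \<comment> \<open>Only finitely many breakpoints lie in \<open>{0..1}\<close>, so some slope
    exists, and its modulus is a lower bound of the supremum.\<close>
  have "infinite ({0..1} - S 0 1)"
    using fin[of 0 1] by (simp add: infinite_Icc Diff_infinite_finite)
  then obtain v where v: "v \<in> {0..1} - S 0 1" using infinite_imp_nonempty by blast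
  show \<sigma>: "\<sigma> \<ge> 0" using slope[OF v] by linarith
  have *: "\<bar>g b - g a\<bar> \<le> \<sigma> * (b - a)" if "a \<le> b" for a b
  proof -
    \<comment> \<open>The value 0 at breakpoints keeps \<open>f'\<close> bounded by \<sigma>
      everywhere; the integral does not see it.\<close>
    define f' where "f' v = (if v \<in> S a b then 0 else deriv g v)" for v
    have "(f' has_integral (g b - g a)) {a..b}"
    proof (rule fundamental_theorem_of_calculus_interior_strong[OF fin that])
      fix v assume v: "v \<in> {a<..<b} - S a b"
      then have "g differentiable (at v)" by (auto simp: S_def)
      then have "(g has_real_derivative f' v) (at v)"
        using v by (simp add: DERIV_deriv_iff_real_differentiable f'_def)
      then show "(g has_vector_derivative f' v) (at v)"
        by (simp add: has_real_derivative_iff_has_vector_derivative)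
    next
      show "continuous_on {a..b} g"
        using g continuous_on_subset unfolding piecewise_differentiable_def by blast
    qed
    moreover have "norm (f' v) \<le> \<sigma>" if "v \<in> {a..b}" for v
      using slope[of v a b] that \<sigma> by (auto simp: f'_def)
    ultimately have "norm (g b - g a) \<le> \<sigma> * content {a..b}"
      using has_integral_bound_real[OF \<sigma>, of "{}" f' "g b - g a" a b] by auto
    then show ?thesis using that by simp
  qed
  show "\<bar>g a - g b\<bar> \<le> \<sigma> * \<bar>a - b\<bar>"
    using *[of a b] *[of b a] by (cases "a \<le> b") (auto simp: abs_minus_commute)
qed

lemma kron_row:
  assumes kron: "kron_reduction net = y_shunt \<cdot>\<^sub>m 1\<^sub>m N + y_series \<cdot>\<^sub>m complete_laplacian N"
    and m: "m < N"
  shows "(\<Sum>l<N. kron_reduction net $$ (m, l) * V l) =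
    (y_shunt + y_series * of_nat N) * V m - y_series * (\<Sum>l<N. V l)"
proof -
  have "(\<Sum>l<N. kron_reduction net $$ (m, l) * V l) =
      (\<Sum>l<N. (if l = m then (y_shunt + y_series * of_nat N) * V l else 0) - y_series * V l)"
    using m by (intro sum.cong) (auto simp: kron complete_laplacian_def algebra_simps)
  then show ?thesis using m by (simp add: sum_subtractf sum_distrib_left)
qed

text \<open>The spectral factorization calls for a strict gain inequality at every frequency, while
  the norm may be attained.\<close>

lemma gain_margin:
  fixes a \<sigma> :: real
  assumes "a * \<sigma> < 1" "\<sigma> \<ge> 0"
  obtains \<gamma> where "a < \<gamma>" "\<gamma> * \<sigma> < 1"
proof (cases "\<sigma> = 0")
  case False
  then have "a < 1 / \<sigma>" using assms by (simp add: pos_less_divide_eq)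
  then obtain \<gamma> where "a < \<gamma>" "\<gamma> < 1 / \<sigma>" using dense by blast
  then show ?thesis using that False assms(2) by (simp add: pos_less_divide_eq)
qed (use that[of "a + 1"] in simp)

theorem corollary4:
  fixes N :: nat
    and osc net :: rlc_network
    and g :: "real \<Rightarrow> real"
    and \<sigma> :: real
    and z_osc y_shunt y_series z_eq :: transfer_function
    and v :: "nat \<Rightarrow> real \<Rightarrow> real"
  assumes "N \<ge> 2"
    and "passive_network osc"
    and "one_port_impedance osc z_osc"
    and "piecewise_differentiable g"
    and "bdd_above (abs_slopes g)"
    and "\<sigma> = Sup (abs_slopes g)"
    and "passive_network net"
    and "connected_network net"
    and "n_boundary net = N"
    and "invertible_mat (interior_admittance net)"
    and "kron_reduction net = y_shunt \<cdot>\<^sub>m 1\<^sub>m N + y_series \<cdot>\<^sub>m complete_laplacian N"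
    and "z_eq = equivalent_impedance y_shunt z_osc"
    and "hinf_defined (lft z_eq (y_series * of_nat N))"
    and "hinf_norm (lft z_eq (y_series * of_nat N)) * \<sigma> < 1"
    and "coupled_trajectory N osc g net v"
  shows "\<forall>j<N. \<forall>k<N. ((\<lambda>t. v j t - v k t) \<longlongrightarrow> 0) at_top"
proof (intro allI impI)
  fix j k assume "j < N" "k < N"
  show "((\<lambda>t. v j t - v k t) \<longlongrightarrow> 0) at_top"
  proof (cases "j = k")
    case False
    note osc = assms(2) and net = assms(7) and nb = assms(9) and inv = assms(10) and kron = assms(11)
    define y_osc where "y_osc = kron_reduction osc $$ (0, 0)"
    have port: "n_boundary osc = 1" "invertible_mat (interior_admittance osc)" "y_osc \<noteq> 0" "z_osc = inverse y_osc"
      using assms(3) by (auto simp: one_port_impedance_def y_osc_def)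
    have jk: "j < n_boundary net" "k < n_boundary net" "j \<noteq> k"
      using \<open>j < N\<close> \<open>k < N\<close> False nb by auto
    define h where "h = lft z_eq (y_series * of_nat N)"
    \<comment> \<open>The eigenvalue of the Kron-reduced matrix on vectors with zero sum.\<close>
    define y where "y = y_shunt + y_series * of_nat N"
    note row = kron_row[OF kron, folded y_def]

    have pos_osc: "positive_real_sign y_osc"
      by (rule positive_real_sign_port[OF osc port(2), of "\<lambda>_. 1" _ 0]) (use port in \<open>auto simp: y_osc_def\<close>)
    \<comment> \<open>\<Gamma> annihilates the all-ones vector, which isolates
      \<open>y_shunt\<close>.\<close>
    have "positive_real_sign y_shunt"
      by (rule positive_real_sign_port[OF net inv, of "\<lambda>_. 1" _ j])
        (use jk row[where V = "\<lambda>_. 1"] in \<open>auto simp: nb y_def\<close>)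
    then have ne1: "y_osc + y_shunt \<noteq> 0" using positive_real_sign_add_nonzero pos_osc port(3) by blast
    have "positive_real_sign y"
    proof (rule positive_real_sign_port[OF net inv, of "differential_sign j k" _ j])
      have "(\<Sum>l<N. of_int (differential_sign j k l) :: transfer_function) = 0"
        using sum_differential_sign[of j N k "\<lambda>_. 1 :: int"] \<open>j < N\<close> \<open>k < N\<close> False
        unfolding of_int_sum[symmetric] by simp
      then show "(\<Sum>l<n_boundary net. kron_reduction net $$ (m, l) * of_int (differential_sign j k l)) =
          y * of_int (differential_sign j k m)" if "m < n_boundary net" for m
        using that by (simp add: nb row)
    qed (use jk in \<open>auto simp: differential_sign_def\<close>)
    then have ne2: "y_osc + y \<noteq> 0" using positive_real_sign_add_nonzero pos_osc port(3) by blast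
    have z_eq: "z_eq = inverse (y_osc + y_shunt)"
    proof (cases "y_shunt = 0")
      case False
      then have "inverse y_shunt + inverse y_osc = (y_osc + y_shunt) * (inverse y_shunt * inverse y_osc)"
        using inverse_add[OF False port(3)] by (simp add: ac_simps)
      then show ?thesis
        using False port(3,4) unfolding assms(12) equivalent_impedance_def Let_def
        by (simp add: inverse_eq_divide)
    qed (use assms(12) port(4) in \<open>simp add: equivalent_impedance_def\<close>)
    \<comment> \<open>Hence \<open>h\<close> is the reciprocal of the total admittance that a
      differential excitation sees.\<close>
    have "1 + z_eq * (y_series * of_nat N) = z_eq * (y_osc + y)"
      using ne1 unfolding z_eq y_def by (simp add: field_simps)
    then have "h = z_eq / (z_eq * (y_osc + y))" by (simp add: h_def lft_def)
    then have "(y_osc + y) * h = 1"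
      using ne1 ne2 by (simp add: z_eq)
    note h = this[unfolded y_osc_def]

    have "\<And>V m. m < n_boundary net \<Longrightarrow> (\<Sum>l<n_boundary net. V l) = 0 \<Longrightarrow>
        (\<Sum>l<n_boundary net. kron_reduction net $$ (m, l) * V l) = y * V m"
      by (simp add: nb row)
    from differential_response_exists[OF osc port(1,2) net inv jk this h]
    obtain P Q P' Q' n o' q d where "differential_response osc net j k h P Q P' Q' n o' q d"
      by blast
    from differential_response_hurwitz[OF osc port(1,2) net inv jk _ this]
    obtain P Q P' Q' n o' q d where r: "differential_response osc net j k h P Q P' Q' n o' q d" and d: "hurwitz d"
      using assms(13) unfolding h_def hinf_defined_def by blast

    have \<sigma>: "\<sigma> \<ge> 0" and lip: "\<bar>g a - g b\<bar> \<le> \<sigma> * \<bar>a - b\<bar>" for a b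
      using piecewise_differentiable_lipschitz[OF assms(4,5)] assms(6) by auto
    obtain \<gamma> where \<gamma>: "hinf_norm h < \<gamma>" "\<gamma> * \<sigma> < 1"
      using gain_margin[OF assms(14) \<sigma>] unfolding h_def by blast
    have gain: "cmod (poly q (\<i> * x)) < \<gamma> * cmod (poly d (\<i> * x))" for x :: real
    proof -
      let ?s = "\<i> * complex_of_real x"
      define a b where "a = fst (quot_of_fract h)" and "b = snd (quot_of_fract h)"
      have "b * q = a * d"
        unfolding a_def b_def using r by (intro transfer_function_cross_mult) (simp add: differential_response_def)
      from arg_cong[OF this, of "\<lambda>p. poly p ?s"]
      have "poly b ?s * poly q ?s = poly a ?s * poly d ?s" by simp
      moreover have "poly b ?s \<noteq> 0"
        using assms(13) by (auto simp: h_def[symmetric] hinf_defined_def tf_poles_def b_def)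
      ultimately have "poly q ?s = tf_eval h ?s * poly d ?s"
        by (simp add: tf_eval_def a_def b_def field_simps)
      moreover have "cmod (tf_eval h ?s) \<le> hinf_norm h"
        unfolding hinf_norm_def
        by (rule cSUP_upper) (use assms(13) in \<open>auto simp: h_def[symmetric] hinf_defined_def\<close>)
      moreover have "poly d ?s \<noteq> 0" using d by (auto simp: hurwitz_def)
      ultimately show ?thesis using \<gamma>(1) by (simp add: norm_mult)
    qed

    obtain i where traj: "network_trajectory net v i"
      and traj': "\<And>m. m < N \<Longrightarrow> network_trajectory osc (\<lambda>_. v m) (\<lambda>_ t. - g (v m t) - i m t)"
      using assms(15) unfolding coupled_trajectory_def by blast
    have solN: "poly_solution net P Q (\<lambda>m. n * differential_sign j k m)"
      and Pm: "\<And>m. m < N \<Longrightarrow> P m = q * differential_sign j k m"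
      and solO: "poly_solution osc P' Q' (\<lambda>_. o')" and P'0: "P' 0 = q" and no: "n + o' = d"
      using r nb by (auto simp: differential_response_def)
    \<comment> \<open>One number of integrations above all degrees serves network and one-ports
      alike, so that their identities can be combined.\<close>
    define K where "K = Suc ((\<Sum>m<n_nodes net. degree (P m)) + (\<Sum>m<n_branches net. degree (Q m)) +
      (\<Sum>m<n_nodes osc. degree (P' m)) + (\<Sum>m<n_branches osc. degree (Q' m)) + degree d)"
    have le: "f m \<le> (\<Sum>m<M. f m)" if "m < M" for f :: "nat \<Rightarrow> nat" and m M
      by (rule member_le_sum) (use that in auto)
    have degs: "\<And>m. m < n_nodes net \<Longrightarrow> degree (P m) < K" "\<And>m. m < n_branches net \<Longrightarrow> degree (Q m) < K"
      "\<And>m. m < n_nodes osc \<Longrightarrow> degree (P' m) < K" "\<And>m. m < n_branches osc \<Longrightarrow> degree (Q' m) < K"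
      "degree d \<le> K"
      using le[of _ "n_nodes net" "\<lambda>m. degree (P m)"] le[of _ "n_branches net" "\<lambda>m. degree (Q m)"]
        le[of _ "n_nodes osc" "\<lambda>m. degree (P' m)"] le[of _ "n_branches osc" "\<lambda>m. degree (Q' m)"]
      unfolding K_def by (fastforce simp: less_Suc_eq_le)+
    define s where "s m = shifted (\<lambda>t. - g (v m t) - i m t)" for m
    have sv: "shifted (v m) \<in> signals" and si: "shifted (i m) \<in> signals" and ss: "s m \<in> signals" if "m < N" for m
      using network_trajectory_signals[OF traj] network_trajectory_signals(2)[OF traj'[OF that], of 0] that nb port(1)
      by (auto simp: s_def)
    define R where "R p = poly_act (rev_poly K p)" for p
    have Rsign: "R (p * differential_sign j k m) f t = differential_sign j k m * R p f t" if "f \<in> signals" for p m f t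
    proof -
      have "p * differential_sign j k m = smult (differential_sign j k m) p" by (simp add: differential_sign_def)
      then show ?thesis by (simp add: R_def rev_poly_smult poly_act_smult that)
    qed
    obtain a where a: "\<And>l. l \<ge> K \<Longrightarrow> coeff a l = 0" and
      1: "\<And>t. (\<Sum>m<N. R (P m) (shifted (i m)) t - R (n * differential_sign j k m) (shifted (v m)) t) = poly_act a (\<lambda>t. 1) t"
      using trajectory_pairing[OF net solN traj degs(1,2)] unfolding R_def nb by blast
    have 2: "(\<Sum>m<N. R (P m) (shifted (i m)) t - R (n * differential_sign j k m) (shifted (v m)) t) =
        (\<Sum>m<N. differential_sign j k m * (R q (shifted (i m)) t - R n (shifted (v m)) t))" for t
      by (intro sum.cong) (auto simp: Pm Rsign si sv algebra_simps)
    \<comment> \<open>The response has neither voltage nor injected current at the terminals other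
      than \<open>j\<close> and \<open>k\<close>, so the remaining circuits drop out of the
      pairing.\<close>
    have net_eq: "(R q (shifted (i j)) t - R n (shifted (v j)) t) - (R q (shifted (i k)) t - R n (shifted (v k)) t) =
        poly_act a (\<lambda>t. 1) t" for t
      unfolding 1[symmetric] 2 by (rule sum_differential_sign[OF \<open>j < N\<close> \<open>k < N\<close> False, symmetric])
    have "\<exists>b. (\<forall>l\<ge>K. coeff b l = 0) \<and> (\<forall>t. R q (s m) t - R o' (shifted (v m)) t = poly_act b (\<lambda>t. 1) t)" if "m < N" for m
      using trajectory_pairing[OF osc solO traj'[OF that] degs(3,4)] by (simp add: port(1) P'0 R_def s_def)
    from this[OF \<open>j < N\<close>] this[OF \<open>k < N\<close>]
    obtain b b' where b: "\<forall>l\<ge>K. coeff b l = 0" "\<forall>t. R q (s j) t - R o' (shifted (v j)) t = poly_act b (\<lambda>t. 1) t"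
      and b': "\<forall>l\<ge>K. coeff b' l = 0" "\<forall>t. R q (s k) t - R o' (shifted (v k)) t = poly_act b' (\<lambda>t. 1) t"
      by blast
    note b = b[rule_format] and b' = b'[rule_format]

    define \<delta> where "\<delta> = (\<lambda>t. shifted (v j) t - shifted (v k) t)"
    \<comment> \<open>The currents into the network cancel, leaving -(g(v_j) - g(v_k)).\<close>
    define u where "u = (\<lambda>t. (s j t + shifted (i j) t) - (s k t + shifted (i k) t))"
    note sigs = sv[OF \<open>j < N\<close>] sv[OF \<open>k < N\<close>] si[OF \<open>j < N\<close>] si[OF \<open>k < N\<close>] ss[OF \<open>j < N\<close>] ss[OF \<open>k < N\<close>]
    have \<delta>: "\<delta> \<in> signals" and u: "u \<in> signals"
      unfolding \<delta>_def u_def by (intro signals_diff signals_add sigs)+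
    have "u t = complex_of_real (- (g (v j (1 + max 0 t)) - g (v k (1 + max 0 t))))" for t
      by (simp add: u_def s_def shifted_def)
    moreover have "\<delta> t = complex_of_real (v j (1 + max 0 t) - v k (1 + max 0 t))" for t
      by (simp add: \<delta>_def shifted_def)
    ultimately have bound: "cmod (u t) \<le> \<sigma> * cmod (\<delta> t)" for t
      using lip[of "v j (1 + max 0 t)" "v k (1 + max 0 t)"] by (simp only: norm_of_real abs_minus_cancel)
    \<comment> \<open>In the combined pairings of network and one-ports, the voltage side collects n
      + o' = d, while the current side has the common factor q.\<close>
    have eq: "R d \<delta> = (\<lambda>t. R q u t + poly_act (b' - b - a) (\<lambda>t. 1) t)"
    proof
      fix t
      have "R d f t = R n f t + R o' f t" if "f \<in> signals" for f
        unfolding no[symmetric] R_def by (simp add: rev_poly_add poly_act_add that)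
      then have "R d \<delta> t = R n (shifted (v j)) t + R o' (shifted (v j)) t - (R n (shifted (v k)) t + R o' (shifted (v k)) t)"
        unfolding \<delta>_def using sigs by (simp add: R_def poly_act_diff_right)
      moreover have "R q u t = (R q (s j) t + R q (shifted (i j)) t) - (R q (s k) t + R q (shifted (i k)) t)"
        unfolding u_def R_def using sigs by (simp add: poly_act_diff_right poly_act_add_right signals_add)
      moreover have "poly_act (b' - b - a) (\<lambda>t. 1) t =
          poly_act b' (\<lambda>t. 1) t - poly_act b (\<lambda>t. 1) t - poly_act a (\<lambda>t. 1) t"
        by (simp add: poly_act_diff)
      moreover have "R q (s j) t = poly_act b (\<lambda>t. 1) t + R o' (shifted (v j)) t"
        "R q (s k) t = poly_act b' (\<lambda>t. 1) t + R o' (shifted (v k)) t"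
        "R q (shifted (i j)) t = poly_act a (\<lambda>t. 1) t + R n (shifted (v j)) t +
          (R q (shifted (i k)) t - R n (shifted (v k)) t)"
        using net_eq[of t] b(2)[of t] b'(2)[of t] by (simp_all add: algebra_simps)
      ultimately show "R d \<delta> t = R q u t + poly_act (b' - b - a) (\<lambda>t. 1) t"
        by (simp only:) simp
    qed
    have "(\<delta> \<longlongrightarrow> 0) at_top"
      by (rule small_gain[OF d gain \<delta> u bound \<sigma> \<gamma>(2) eq[unfolded R_def] _ degs(5)])
        (simp add: a b(1) b'(1))
    then have "((\<lambda>t. \<delta> (-1 + t)) \<longlongrightarrow> 0) at_top"
      by (rule filterlim_compose) (rule filterlim_tendsto_add_at_top[OF tendsto_const filterlim_ident])
    from tendsto_Re[OF this] have "((\<lambda>t. Re (\<delta> (-1 + t))) \<longlongrightarrow> 0) at_top" by simp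
    moreover have "\<forall>\<^sub>F t in at_top. Re (\<delta> (-1 + t)) = v j t - v k t"
      using eventually_ge_at_top[of 1]
      by eventually_elim (simp add: \<delta>_def shifted_def)
    ultimately show ?thesis by (rule Lim_transform_eventually)
  qed simp
qed

end
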